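(* Let $k_1\ge k_2\ge -1$ be integers. The minimum number of crossings of a singly-anchored open meander in the stratum $\mathcal{Q}(k_1,k_2,-1^{k_1+k_2+4})$ is $\max\{2k_1+2,\,2k_2+3\}$.
   Context: An open meander is a planar configuration consisting of a bi-infinite horizontal line and a simple arc intersecting the line transversally; crossings are the intersection points. In a singly-anchored open meander the intersecting arc is anchored: it is a compact simple arc whose two endpoints (the anchors, not on the line) are punctures on the sphere, while the horizontal line together with the point at infinity is regarded as a simple closed curve on the sphere. Stratum of an anchored meander. View the configuration as a graph on the sphere whose vertices are the crossings (valence four) and the anchors (valence one). Each complementary region is treated as a polygon whose sides are the edges on its boundary, where an edge incident to a valence-one vertex is counted as a single side. A region that is a $(2k+4)$-gon is assigned order $k$ (bigons: $-1$, 4-gons: $0$, hexagons: $1$, ...). In addition each valence-one vertex contributes an order $-1$. The singly-anchored open meander lies in $\mathcal{Q}(k_1,\dots,k_n,-1^{p})$ (where $-1^p$ means $-1$ repeated $p$ times) if the resulting multiset of orders is $\{k_1,\dots,k_n,-1,\dots,-1\}$ ($p$ copies of $-1$), where additional regions of order $0$ beyond those listed are ignored; an order $0$ appearing in the list must be realised by a distinct 4-gon for each occurrence. *)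

theory Defs
  imports "HOL-Analysis.Analysis" "HOL-Library.Multiset"
begin

text \<open>
  The plane is \<^typ>\<open>complex\<close>, the horizontal line is the real axis, and the sphere is the
  one-point compactification of the plane; \<^term>\<open>None\<close> is the point at infinity.
\<close>

abbreviation sphere_top :: "complex option topology" where
  "sphere_top \<equiv> Alexandroff_compactification euclidean"

definition horizontal_line :: "complex set" where
  "horizontal_line = {z. Im z = 0}"

text \<open>
  Arcs are only assumed continuous, so transversality is the topological notion: the arc
  passes from one open side of the line to the other.
\<close>

definition crosses_line_at :: "(real \<Rightarrow> complex) \<Rightarrow> real \<Rightarrow> bool" where
  "crosses_line_at \<gamma> t \<longleftrightarrow>
     (\<forall>\<^sub>F s in at_left t. Im (\<gamma> s) < 0) \<and> (\<forall>\<^sub>F s in at_right t. Im (\<gamma> s) > 0) \<or>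
     (\<forall>\<^sub>F s in at_left t. Im (\<gamma> s) > 0) \<and> (\<forall>\<^sub>F s in at_right t. Im (\<gamma> s) < 0)"

definition singly_anchored_open_meander :: "(real \<Rightarrow> complex) \<Rightarrow> bool" where
  "singly_anchored_open_meander \<gamma> \<longleftrightarrow>
     arc \<gamma> \<and>
     pathstart \<gamma> \<notin> horizontal_line \<and> pathfinish \<gamma> \<notin> horizontal_line \<and>
     (\<forall>t\<in>{0<..<1}. \<gamma> t \<in> horizontal_line \<longrightarrow> crosses_line_at \<gamma> t)"

definition crossings :: "(real \<Rightarrow> complex) \<Rightarrow> complex set" where
  "crossings \<gamma> = path_image \<gamma> \<inter> horizontal_line"

definition anchors :: "(real \<Rightarrow> complex) \<Rightarrow> complex set" where
  "anchors \<gamma> = {pathstart \<gamma>, pathfinish \<gamma>}"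

text \<open>
  The graph on the sphere. The point at infinity lies on the closed-up line but is not a vertex,
  so the two unbounded rays of the line belong to one edge.
\<close>

definition meander_graph :: "(real \<Rightarrow> complex) \<Rightarrow> complex option set" where
  "meander_graph \<gamma> = insert None (Some ` horizontal_line) \<union> Some ` path_image \<gamma>"

definition vertices :: "(real \<Rightarrow> complex) \<Rightarrow> complex option set" where
  "vertices \<gamma> = Some ` (crossings \<gamma> \<union> anchors \<gamma>)"

definition edges :: "(real \<Rightarrow> complex) \<Rightarrow> complex option set set" where
  "edges \<gamma> = connected_components_of (subtopology sphere_top (meander_graph \<gamma> - vertices \<gamma>))"

definition regions :: "(real \<Rightarrow> complex) \<Rightarrow> complex option set set" where
  "regions \<gamma> = connected_components_of (subtopology sphere_top (- meander_graph \<gamma>))"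

text \<open>
  Sides are edges without multiplicity: an edge incident to an anchor counts once by convention,
  and any other edge has two different regions along its two sides, hence occurs only once on
  the boundary of each of them.
\<close>

definition sides :: "(real \<Rightarrow> complex) \<Rightarrow> complex option set \<Rightarrow> complex option set set" where
  "sides \<gamma> R = {e \<in> edges \<gamma>. e \<subseteq> sphere_top frontier_of R}"

definition is_order_function :: "(real \<Rightarrow> complex) \<Rightarrow> (complex option set \<Rightarrow> int) \<Rightarrow> bool" where
  "is_order_function \<gamma> ord \<longleftrightarrow> (\<forall>R\<in>regions \<gamma>. int (card (sides \<gamma> R)) = 2 * ord R + 4)"

text \<open>
  \<open>in_stratum \<gamma> K\<close>: the meander lies in the stratum whose full list of orders, including the
  entries \<open>-1\<close>, is \<open>K\<close>. The two explicit entries \<open>-1\<close> come from the two anchors, and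
  \<open>m\<close> is the number of 4-gons that are not listed in \<open>K\<close>.
\<close>

definition in_stratum :: "(real \<Rightarrow> complex) \<Rightarrow> int multiset \<Rightarrow> bool" where
  "in_stratum \<gamma> K \<longleftrightarrow>
     finite (regions \<gamma>) \<and>
     (\<exists>ord m. is_order_function \<gamma> ord \<and>
        image_mset ord (mset_set (regions \<gamma>)) + {#-1, -1#} = K + replicate_mset m 0)"

end

theory Submission
  imports Defs
begin

text \<open>
  Lower bound. Every region lies in one of the two half planes, and the pieces of the arc alternate
  between them. At a crossing that is not the end of a tail in the half plane of the region, the arc
  continues there as a crosscut, which by the Jordan curve theorem separates the two line edges at
  the crossing; hence twice the number of line edges of a region is at most \<open>n\<close> plus the number of
  tails in its half plane. So a region has at most \<open>n + 2\<close> sides, and since two regions in the same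
  half plane have no line edge in common, at most one region has more than \<open>n + 1\<close> sides.

  Upper bound. The extremal meander is drawn with half diamonds \<open>\<bar>x - c\<bar> + \<bar>y\<bar> = r\<close> and two vertical
  tails: a zigzag along the line followed by a spiral that winds inwards, with nested half diamonds
  below the line and only half diamonds of radius \<open>1/2\<close> above it. The two unbounded regions realise
  \<open>k1\<close> and \<open>k2\<close>, and all other regions are bigons and 4-gons.
\<close>

subsection \<open>Connected components on the sphere\<close>

text \<open>Edges and regions are components on the sphere, so counting sides first has to become a
  statement on plane sets and their closures. The lower bound only uses that an edge on the frontier
  lies in the closure; the construction needs the exact set of edges of every region, hence a
  drawing whose closures can be read off from inequalities. This is why half diamonds are used: they
  are circles of the l1 norm, piecewise linear over their diameter, and a vertical shift changes all
  l1 distances by the same amount. The sharp cases of the counting dictate the drawing. A region has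
  \<open>n + 2\<close> sides only if \<open>n\<close> is even and both tails lie in its half plane,
  so for \<open>k1 > k2\<close> both tails point up and the upper unbounded region realises
  \<open>k1\<close>. Below the line the spiral is hidden behind its outermost half diamond, so only
  the zigzag contributes to \<open>k2\<close>; above the line every further crossing still adds to
  \<open>k1\<close>. For \<open>k1 = k2\<close> there is no spiral, and the number of crossings is
  odd.\<close>

lemma connectedin_sphere_image_Some [simp]:
  "connectedin sphere_top (Some ` S) \<longleftrightarrow> connected S"
proof -
  let ?Y = "subtopology sphere_top (range Some)"
  have "homeomorphic_map (euclidean :: complex topology) ?Y Some"
    using embedding_map_Some[of "euclidean :: complex topology"] by (simp add: embedding_map_def)
  then have "connectedin ?Y (Some ` S) \<longleftrightarrow> connectedin euclidean S"
    by (rule homeomorphic_map_connectedness) simp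
  then show ?thesis
    by (auto simp: connectedin_subtopology)
qed

text \<open>Compactness is demanded only of closed sets that avoid infinity; those containing it are
  the complements of open plane sets. This serves the line edge through infinity.\<close>

lemma closedin_sphere_insert_None [simp]:
  "closedin sphere_top (insert None (Some ` C)) \<longleftrightarrow> closed C"
proof -
  have eq: "insert None (Some ` C) = insert None (range Some) - Some ` (- C)"
    by auto
  have clo: "closed C" if "insert None (Some ` C) = insert None (range Some) - Some ` U" "open U" for U
  proof -
    have "z \<in> C \<longleftrightarrow> z \<notin> U" for z
      using that(1)[THEN set_eq_iff[THEN iffD1], THEN spec, of "Some z"] by auto
    then have "C = - U" by auto
    then show ?thesis using that(2) by (simp add: closed_Compl)
  qed
  have c1: "closedin sphere_top (insert None (Some ` C))" if "closed C"
    unfolding closedin_Alexandroff_compactification using eq that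
    by (intro disjI2 exI[of _ "- C"]) (simp add: open_Compl)
  have c2: "closed C" if "closedin sphere_top (insert None (Some ` C))"
    using that[unfolded closedin_Alexandroff_compactification]
  proof (elim disjE exE conjE)
    fix K assume "insert None (Some ` C) = Some ` K"
    then show ?thesis by (metis imageE insertI1 option.distinct(1))
  next
    fix U assume "openin euclidean U"
      "insert None (Some ` C) = topspace sphere_top - Some ` U"
    then show ?thesis using clo[of U] by simp
  qed
  show ?thesis
    by (rule iffI[OF c2 c1])
qed

lemma Some_in_sphere_closure_of_iff:
  "Some z \<in> sphere_top closure_of (Some ` S) \<longleftrightarrow> z \<in> closure S"
proof
  assume a: "Some z \<in> sphere_top closure_of (Some ` S)"
  have "sphere_top closure_of (Some ` S) \<subseteq> insert None (Some ` closure S)"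
    by (rule closure_of_minimal) (use closure_subset in auto)
  then show "z \<in> closure S"
    using a by auto
next
  assume "z \<in> closure S"
  moreover have "Some ` closure S \<subseteq> sphere_top closure_of (Some ` S)"
    using continuous_map_image_closure_subset[OF continuous_map_Some[of euclidean], of S] by simp
  ultimately show "Some z \<in> sphere_top closure_of (Some ` S)"
    by auto
qed

text \<open>Neighbourhoods of infinity are complements of compact sets, and no compact set contains
  an unbounded one.\<close>

lemma None_in_sphere_closure_of:
  assumes "\<not> bounded S"
  shows "None \<in> sphere_top closure_of (Some ` S)"
  unfolding in_closure_of
proof (intro conjI allI impI)
  fix T assume T: "None \<in> T \<and> openin sphere_top T"
  then obtain C where C: "compact C" "T = insert None (Some ` (- C))"
    unfolding openin_Alexandroff_compactification by (auto simp: Compl_eq_Diff_UNIV)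
  then have "\<not> S \<subseteq> C"
    using assms bounded_subset compact_imp_bounded by blast
  then show "\<exists>y. y \<in> Some ` S \<and> y \<in> T"
    using C by auto
qed simp

lemma open_image_Some_frontier_eq:
  assumes "open S"
  shows "sphere_top frontier_of (Some ` S) = sphere_top closure_of (Some ` S) - Some ` S"
  using assms by (simp add: frontier_of_def interior_of_openin)

text \<open>Adding a limit point keeps a set connected. Applied to the left and to the right ray of
  the line, this makes infinity the point that joins them into one edge.\<close>

lemma connectedin_sphere_insert_None:
  assumes "connected S" "\<not> bounded S"
  shows "connectedin sphere_top (insert None (Some ` S))"
proof (rule connectedin_intermediate_closure_of[of _ "Some ` S"])
  show "insert None (Some ` S) \<subseteq> sphere_top closure_of Some ` S"
    using None_in_sphere_closure_of[OF assms(2)] closure_of_subset[of "Some ` S" sphere_top]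
    by auto
qed (use assms in auto)

text \<open>The complement of a piece is the union of the other open pieces, so every piece is
  clopen, and a connected set that meets a piece lies inside it. The regions are identified in this
  way.\<close>

lemma connected_components_of_eqI:
  assumes "\<Union> F = topspace X" "pairwise disjnt F"
    and "\<And>S. S \<in> F \<Longrightarrow> connectedin X S" "\<And>S. S \<in> F \<Longrightarrow> S \<noteq> {}"
    and op: "\<And>S. S \<in> F \<Longrightarrow> openin X S"
  shows "connected_components_of X = F"
proof -
  have F: "F \<subseteq> connected_components_of X"
  proof
    fix S assume S: "S \<in> F"
    have "topspace X - S = \<Union> (F - {S})"
      using assms(1,2) S by (auto simp: pairwise_def disjnt_iff)
    then have "closedin X S"
      using S assms(1) op by (auto simp: closedin_def intro!: openin_Union)
    then have clo: "connectedin X T \<Longrightarrow> S \<inter> T = {} \<or> T \<subseteq> S" for T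
      using op[OF S] connectedin_clopen_cases[of X T S] by (auto simp: disjnt_def)
    obtain x where x: "x \<in> S" using assms(4) S by auto
    have "connected_component_of_set X x = S"
    proof
      show "connected_component_of_set X x \<subseteq> S"
        using clo[OF connectedin_connected_component_of[of X x]] x assms(1) S
        by (metis Union_upper connected_component_of_refl disjoint_iff mem_Collect_eq subsetD)
      show "S \<subseteq> connected_component_of_set X x"
        by (intro connected_component_of_maximal assms S x)
    qed
    moreover have "x \<in> topspace X"
      using x S assms(1) by auto
    ultimately show "S \<in> connected_components_of X"
      by (metis connected_component_in_connected_components_of)
  qed
  moreover have "connected_components_of X \<subseteq> F"
  proof
    fix C assume C: "C \<in> connected_components_of X"
    then obtain x where x: "x \<in> C" "x \<in> topspace X"
      using nonempty_connected_components_of connected_components_of_subset by fastforce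
    then obtain S where "S \<in> F" "x \<in> S" using assms(1) by auto
    then show "C \<in> F"
      using F C x connected_components_of_overlap[of C X S] by auto
  qed
  ultimately show ?thesis by auto
qed

text \<open>A finite union of closed pieces is closed, so its complement, the remaining piece, is
  open. This form suits the edges, which are closed in the graph without its vertices.\<close>

lemma connected_components_of_eqI_closed:
  assumes "finite F" "\<Union> F = topspace X" "pairwise disjnt F"
    and "\<And>S. S \<in> F \<Longrightarrow> connectedin X S" "\<And>S. S \<in> F \<Longrightarrow> S \<noteq> {}"
    and "\<And>S. S \<in> F \<Longrightarrow> closedin X S"
  shows "connected_components_of X = F"
proof (rule connected_components_of_eqI)
  fix S assume S: "S \<in> F"
  have "S = topspace X - \<Union> (F - {S})"
    using assms(2,3) S by (auto simp: pairwise_def disjnt_iff)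
  moreover have "closedin X (\<Union> (F - {S}))"
    using assms(1,6) by (intro closedin_Union) auto
  ultimately show "openin X S"
    by (metis openin_diff openin_topspace)
qed (use assms in auto)

lemma ex_grid_interval:
  fixes t :: "nat \<Rightarrow> 'a::linorder"
  assumes "t 0 \<le> u" "u \<le> t N"
  shows "u \<in> t ` {..N} \<or> (\<exists>i<N. t i < u \<and> u < t (Suc i))"
  using assms(2)
proof (induction N)
  case 0
  then show ?case using assms(1) by auto
next
  case (Suc N)
  show ?case
  proof (cases "u \<le> t N")
    case True
    then show ?thesis using Suc.IH by (auto simp: less_Suc_eq atMost_Suc)
  next
    case False
    then have "u = t (Suc N) \<or> t N < u \<and> u < t (Suc N)" using Suc.prems by auto
    then show ?thesis by auto
  qed
qed

lemma unbounded_of_real_rays: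
  "\<not> bounded (complex_of_real ` {..<c})" "\<not> bounded (complex_of_real ` {c<..})"
proof -
  have "\<exists>z\<in>complex_of_real ` {..<c}. \<not> norm z \<le> a" for a
    by (rule bexI[of _ "complex_of_real (min c 0 - \<bar>a\<bar> - 1)"]) (simp_all only: norm_of_real image_eqI lessThan_iff; linarith)+
  then show "\<not> bounded (complex_of_real ` {..<c})"
    unfolding bounded_iff by blast
  have "\<exists>z\<in>complex_of_real ` {c<..}. \<not> norm z \<le> a" for a
    by (rule bexI[of _ "complex_of_real (max c 0 + \<bar>a\<bar> + 1)"]) (simp_all only: norm_of_real image_eqI greaterThan_iff; linarith)+
  then show "\<not> bounded (complex_of_real ` {c<..})"
    unfolding bounded_iff by blast
qed

subsection \<open>Edges of a meander\<close>

text \<open>The crossings in two orders: \<open>t\<close> gives their parameters along the arc, with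
  indices 0 and \<open>n + 1\<close> for the anchors, and \<open>x\<close> their positions from left
  to right. The permutation relating the two orders stays implicit.\<close>

locale meander_frame =
  fixes \<gamma> :: "real \<Rightarrow> complex" and n :: nat and t x :: "nat \<Rightarrow> real"
  assumes arc_\<gamma>: "arc \<gamma>" and n_pos: "0 < n"
    and t_less: "\<And>i j. i < j \<Longrightarrow> j \<le> Suc n \<Longrightarrow> t i < t j"
    and t_0: "t 0 = 0" and t_Suc_n: "t (Suc n) = 1"
    and x_less: "\<And>i j. 1 \<le> i \<Longrightarrow> i < j \<Longrightarrow> j \<le> n \<Longrightarrow> x i < x j"
    and Im_eq_0_iff: "\<And>u. 0 \<le> u \<Longrightarrow> u \<le> 1 \<Longrightarrow> Im (\<gamma> u) = 0 \<longleftrightarrow> u \<in> t ` {1..n}"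
    and crossings_eq: "crossings \<gamma> = complex_of_real ` x ` {1..n}"
begin

definition arc_piece :: "nat \<Rightarrow> complex set" where
  "arc_piece i = \<gamma> ` {t i<..<t (Suc i)}"

text \<open>Index 0 collects the two unbounded rays, which form one edge through infinity. With this
  convention the crossing \<open>v\<close> has the piece \<open>v - 1\<close> on its left and the
  piece \<open>v mod n\<close> on its right.\<close>

definition line_piece :: "nat \<Rightarrow> complex set" where
  "line_piece i = complex_of_real ` (if i = 0 then {r. r < x 1 \<or> x n < r} else {x i<..<x (Suc i)})"

text \<open>\<open>Inl\<close> stands for the \<open>n + 1\<close> edges on the arc,
  \<open>Inr\<close> for the \<open>n\<close> edges on the line.\<close>

definition edge :: "nat + nat \<Rightarrow> complex option set" where
  "edge a = (case a of Inl i \<Rightarrow> Some ` arc_piece i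
     | Inr i \<Rightarrow> if i = 0 then insert None (Some ` line_piece i) else Some ` line_piece i)"

lemma t_le: "i \<le> j \<Longrightarrow> j \<le> Suc n \<Longrightarrow> t i \<le> t j"
  using t_less[of i j] by (cases "i = j") auto

lemma t_bounds: "i \<le> Suc n \<Longrightarrow> 0 \<le> t i \<and> t i \<le> 1"
  using t_le[of 0 i] t_le[of i "Suc n"] t_0 t_Suc_n by auto

lemma x_le: "1 \<le> i \<Longrightarrow> i \<le> j \<Longrightarrow> j \<le> n \<Longrightarrow> x i \<le> x j"
  using x_less[of i j] by (cases "i = j") auto

lemma inj_\<gamma>: "inj_on \<gamma> {0..1}"
  using arc_\<gamma> by (simp add: arc_def)

lemma \<gamma>_eq_iff: "0 \<le> u \<Longrightarrow> u \<le> 1 \<Longrightarrow> 0 \<le> v \<Longrightarrow> v \<le> 1 \<Longrightarrow> \<gamma> u = \<gamma> v \<longleftrightarrow> u = v"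
  using inj_\<gamma> by (auto simp: inj_on_def)

lemma crossings_eq_t: "crossings \<gamma> = \<gamma> ` t ` {1..n}"
proof
  show "crossings \<gamma> \<subseteq> \<gamma> ` t ` {1..n}"
    using Im_eq_0_iff by (auto simp: crossings_def horizontal_line_def path_image_def)
  show "\<gamma> ` t ` {1..n} \<subseteq> crossings \<gamma>"
  proof clarify
    fix i assume i: "i \<in> {1..n}"
    then have "0 \<le> t i \<and> t i \<le> 1" using t_bounds[of i] by auto
    then show "\<gamma> (t i) \<in> crossings \<gamma>"
      using Im_eq_0_iff[of "t i"] i by (auto simp: crossings_def horizontal_line_def path_image_def)
  qed
qed

lemma vertices_eq: "vertices \<gamma> = Some ` \<gamma> ` t ` {..Suc n}"
proof -
  have "{..Suc n} = insert 0 (insert (Suc n) {1..n})" by auto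
  then show ?thesis
    by (auto simp: vertices_def crossings_eq_t anchors_def pathstart_def pathfinish_def t_0 t_Suc_n)
qed

lemma interval_not_grid:
  "i \<le> n \<Longrightarrow> t i < u \<Longrightarrow> u < t (Suc i) \<Longrightarrow> u \<notin> t ` {..Suc n}"
proof
  assume i: "i \<le> n" "t i < u" "u < t (Suc i)" and "u \<in> t ` {..Suc n}"
  then obtain j where "j \<le> Suc n" "u = t j" by auto
  then show False using i t_le[of j i] t_le[of "Suc i" j] by (cases "j \<le> i") auto
qed

lemma interval_bounds:
  "i \<le> n \<Longrightarrow> t i < u \<Longrightarrow> u < t (Suc i) \<Longrightarrow> 0 < u \<and> u < 1"
  using t_bounds[of i] t_bounds[of "Suc i"] by auto

lemma line_piece_not_x:
  assumes "i < n" "complex_of_real r \<in> line_piece i"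
  shows "r \<notin> x ` {1..n}"
proof
  assume "r \<in> x ` {1..n}"
  then obtain j where j: "1 \<le> j" "j \<le> n" "r = x j" by auto
  show False
  proof (cases "i = 0")
    case True
    then show ?thesis
      using assms j x_le[of 1 j] x_le[of j n] by (auto simp: line_piece_def)
  next
    case False
    then show ?thesis
      using assms j x_le[of "Suc i" j] x_le[of j i] by (cases "j \<le> i") (auto simp: line_piece_def not_le)
  qed
qed

lemma line_piece_disjoint_path:
  assumes "i < n" shows "line_piece i \<inter> path_image \<gamma> = {}"
proof -
  have "z \<notin> path_image \<gamma>" if "z \<in> line_piece i" for z
  proof
    assume z: "z \<in> path_image \<gamma>"
    obtain r where r: "z = complex_of_real r" using \<open>z \<in> line_piece i\<close> by (auto simp: line_piece_def)
    then have "z \<in> crossings \<gamma>" using z by (auto simp: crossings_def horizontal_line_def)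
    then have "r \<in> x ` {1..n}" using r by (auto simp: crossings_eq)
    then show False using line_piece_not_x assms r that by blast
  qed
  then show ?thesis by auto
qed

lemma arc_piece_subset_path: "i \<le> n \<Longrightarrow> arc_piece i \<subseteq> path_image \<gamma>"
  using interval_bounds by (fastforce simp: arc_piece_def path_image_def)

lemma arc_piece_Im_nonzero:
  assumes "i \<le> n" "z \<in> arc_piece i" shows "Im z \<noteq> 0"
proof -
  obtain u where u: "t i < u" "u < t (Suc i)" "z = \<gamma> u"
    using assms by (auto simp: arc_piece_def)
  then show ?thesis
    using Im_eq_0_iff[of u] interval_bounds[of i u] interval_not_grid[of i u] assms(1) by force
qed

lemma line_piece_cases:
  assumes "r \<notin> x ` {1..n}"
  obtains i where "i < n" "complex_of_real r \<in> line_piece i"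
proof (cases "r < x 1 \<or> x n < r")
  case True
  then show ?thesis using that[of 0] n_pos by (auto simp: line_piece_def)
next
  case False
  then have "r \<in> (\<lambda>i. x (Suc i)) ` {..n - 1} \<or> (\<exists>i<n - 1. x (Suc i) < r \<and> r < x (Suc (Suc i)))"
    using n_pos by (intro ex_grid_interval) auto
  moreover have "(\<lambda>i. x (Suc i)) ` {..n - 1} \<subseteq> x ` {1..n}"
    using n_pos by force
  ultimately obtain i where "i < n - 1" "x (Suc i) < r" "r < x (Suc (Suc i))"
    using assms by auto
  then show ?thesis using that[of "Suc i"] by (auto simp: line_piece_def)
qed

definition edge_index :: "(nat + nat) set" where
  "edge_index = {..n} <+> {..<n}"

lemma graph_minus_vertices_eq:
  "meander_graph \<gamma> - vertices \<gamma> = \<Union> (edge ` edge_index)"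
proof
  show "meander_graph \<gamma> - vertices \<gamma> \<subseteq> \<Union> (edge ` edge_index)"
  proof
    fix w assume w: "w \<in> meander_graph \<gamma> - vertices \<gamma>"
    show "w \<in> \<Union> (edge ` edge_index)"
    proof (cases w)
      case None
      then have "w \<in> edge (Inr 0)" by (simp add: edge_def)
      then show ?thesis using n_pos unfolding edge_index_def by blast
    next
      case (Some z)
      show ?thesis
      proof (cases "z \<in> path_image \<gamma>")
        case True
        then obtain u where u: "0 \<le> u" "u \<le> 1" "z = \<gamma> u" by (auto simp: path_image_def)
        moreover have "u \<notin> t ` {..Suc n}"
          using w Some u by (auto simp: vertices_eq)
        ultimately obtain i where "i < Suc n" "t i < u" "u < t (Suc i)"
          using ex_grid_interval[of t u "Suc n"] t_0 t_Suc_n by auto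
        then have "w \<in> edge (Inl i)" "i \<le> n"
          using u Some by (auto simp: edge_def arc_piece_def)
        then show ?thesis unfolding edge_index_def by blast
      next
        case False
        then have "Im z = 0" using w Some by (auto simp: meander_graph_def horizontal_line_def)
        then have z: "z = complex_of_real (Re z)" by (simp add: complex_eq_iff)
        moreover have "Re z \<notin> x ` {1..n}"
          using z w Some crossings_eq by (auto simp: vertices_def)
        ultimately obtain i where "i < n" "z \<in> line_piece i"
          using line_piece_cases by metis
        then have "w \<in> edge (Inr i)" using Some by (auto simp: edge_def)
        then show ?thesis using \<open>i < n\<close> unfolding edge_index_def by blast
      qed
    qed
  qed
next
  have "edge (Inl i) \<subseteq> meander_graph \<gamma> - vertices \<gamma>" if "i \<le> n" for i
  proof -
    have "Some z \<notin> vertices \<gamma>" if z: "z \<in> arc_piece i" for z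
    proof
      assume "Some z \<in> vertices \<gamma>"
      then obtain j where j: "j \<le> Suc n" "z = \<gamma> (t j)" by (auto simp: vertices_eq)
      obtain u where u: "t i < u" "u < t (Suc i)" "z = \<gamma> u" using z by (auto simp: arc_piece_def)
      then have "u = t j"
        using \<gamma>_eq_iff[of u "t j"] interval_bounds[OF \<open>i \<le> n\<close>, of u] t_bounds[of j] j by auto
      then show False using interval_not_grid[OF \<open>i \<le> n\<close>, of u] u j by auto
    qed
    then show ?thesis using arc_piece_subset_path[OF that] by (auto simp: edge_def meander_graph_def)
  qed
  moreover have "edge (Inr i) \<subseteq> meander_graph \<gamma> - vertices \<gamma>" if "i < n" for i
  proof -
    have "\<gamma> ` t ` {..Suc n} \<subseteq> path_image \<gamma>"
      using t_bounds by (auto simp: path_image_def)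
    then show ?thesis
      using line_piece_disjoint_path[OF that]
      by (auto simp: edge_def meander_graph_def vertices_eq line_piece_def horizontal_line_def split: if_splits)
  qed
  ultimately show "\<Union> (edge ` edge_index) \<subseteq> meander_graph \<gamma> - vertices \<gamma>"
    by (auto simp: edge_index_def)
qed

lemma arc_piece_disjoint: "i < j \<Longrightarrow> j \<le> n \<Longrightarrow> arc_piece i \<inter> arc_piece j = {}"
proof -
  assume ij: "i < j" "j \<le> n"
  have "\<gamma> u \<noteq> \<gamma> v" if "t i < u" "u < t (Suc i)" "t j < v" "v < t (Suc j)" for u v
    using \<gamma>_eq_iff[of u v] interval_bounds[of i u] interval_bounds[of j v] that ij t_le[of "Suc i" j] by force
  then show ?thesis by (auto simp: arc_piece_def)
qed

lemma line_piece_disjoint: "i < j \<Longrightarrow> j < n \<Longrightarrow> line_piece i \<inter> line_piece j = {}"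
proof -
  assume ij: "i < j" "j < n"
  show ?thesis
  proof (cases "i = 0")
    case True
    then show ?thesis using ij x_le[of 1 j] x_le[of "Suc j" n] by (auto simp: line_piece_def)
  next
    case False
    then show ?thesis using ij x_le[of "Suc i" j] by (auto simp: line_piece_def)
  qed
qed

lemma edge_disjoint:
  assumes "a \<in> edge_index" "b \<in> edge_index" "a \<noteq> b"
  shows "edge a \<inter> edge b = {}"
proof -
  have AA: "edge (Inl i) \<inter> edge (Inl j) = {}" if "i < j" "j \<le> n" for i j
    using arc_piece_disjoint[OF that] by (auto simp: edge_def)
  have BB: "edge (Inr i) \<inter> edge (Inr j) = {}" if "i < j" "j < n" for i j
    using line_piece_disjoint[OF that] that by (auto simp: edge_def)
  have AB: "edge (Inl i) \<inter> edge (Inr j) = {}" if "i \<le> n" "j < n" for i j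
    using line_piece_disjoint_path[OF that(2)] arc_piece_subset_path[OF that(1)]
    by (auto simp: edge_def split: if_splits)
  show ?thesis
  proof (cases a)
    case (Inl i)
    then have i: "i \<le> n" using assms by (auto simp: edge_index_def)
    show ?thesis
    proof (cases b)
      case (Inl j)
      then have "j \<le> n" "i \<noteq> j" using assms \<open>a = Inl i\<close> by (auto simp: edge_index_def)
      then show ?thesis using AA[of i j] AA[of j i] i \<open>a = Inl i\<close> Inl by (metis Int_commute linorder_neqE_nat)
    next
      case (Inr j)
      then show ?thesis using AB[of i j] i \<open>a = Inl i\<close> assms by (auto simp: edge_index_def)
    qed
  next
    case (Inr i)
    then have i: "i < n" using assms by (auto simp: edge_index_def)
    show ?thesis
    proof (cases b)
      case (Inr j)
      then have "j < n" "i \<noteq> j" using assms \<open>a = Inr i\<close> by (auto simp: edge_index_def)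
      then show ?thesis using BB[of i j] BB[of j i] i \<open>a = Inr i\<close> Inr by (metis Int_commute linorder_neqE_nat)
    next
      case (Inl j)
      then have "j \<le> n" using assms by (auto simp: edge_index_def)
      then show ?thesis using AB[of j i] i \<open>a = Inr i\<close> Inl by (metis Int_commute)
    qed
  qed
qed

lemma line_piece_nonempty:
  assumes "i < n" shows "line_piece i \<noteq> {}"
proof (cases "i = 0")
  case True
  then show ?thesis by (auto simp: line_piece_def intro: exI[of _ "x 1 - 1"])
next
  case False
  then show ?thesis
    using assms x_less[of i "Suc i"] dense[of "x i" "x (Suc i)"] by (auto simp: line_piece_def)
qed

lemma arc_piece_nonempty: "i \<le> n \<Longrightarrow> arc_piece i \<noteq> {}"
  using t_less[of i "Suc i"] dense[of "t i" "t (Suc i)"] by (auto simp: arc_piece_def)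

lemma edge_nonempty: "a \<in> edge_index \<Longrightarrow> edge a \<noteq> {}"
  using line_piece_nonempty arc_piece_nonempty by (auto simp: edge_index_def edge_def split: if_splits)

lemma inj_on_edge: "inj_on edge edge_index"
proof (rule inj_onI, rule ccontr)
  fix a b assume "a \<in> edge_index" "b \<in> edge_index" "edge a = edge b" "a \<noteq> b"
  then show False using edge_disjoint[of a b] edge_nonempty[of a] by auto
qed

lemma continuous_on_\<gamma>: "continuous_on {0..1} \<gamma>"
  using arc_\<gamma> by (simp add: arc_def path_def)

lemma connected_arc_piece: "i \<le> n \<Longrightarrow> connected (arc_piece i)"
  unfolding arc_piece_def
  by (intro connected_continuous_image continuous_on_subset[OF continuous_on_\<gamma>])
    (auto dest: interval_bounds intro: less_imp_le)

lemma connected_edge: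
  assumes "a \<in> edge_index" shows "connectedin sphere_top (edge a)"
proof (cases a)
  case (Inl i)
  then show ?thesis using assms connected_arc_piece by (auto simp: edge_def edge_index_def)
next
  case (Inr i)
  show ?thesis
  proof (cases "i = 0")
    case True
    let ?A = "complex_of_real ` {..<x 1}" and ?B = "complex_of_real ` {x n<..}"
    have conn: "connected ?A" "connected ?B"
      by (intro connected_continuous_image continuous_intros; simp)+
    have "\<not> bounded ?A" "\<not> bounded ?B"
      by (rule unbounded_of_real_rays)+
    with conn have "connectedin sphere_top (insert None (Some ` ?A))"
      "connectedin sphere_top (insert None (Some ` ?B))"
      by (intro connectedin_sphere_insert_None; simp)+
    then have "connectedin sphere_top (insert None (Some ` ?A) \<union> insert None (Some ` ?B))"
      by (intro connectedin_Un) auto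
    moreover have "insert None (Some ` ?A) \<union> insert None (Some ` ?B) = edge a"
      using Inr True by (auto simp: edge_def line_piece_def)
    ultimately show ?thesis by simp
  next
    case False
    then show ?thesis
      using Inr by (auto simp: edge_def line_piece_def intro!: connected_continuous_image continuous_intros)
  qed
qed

lemma closed_arc_closure: "i \<le> n \<Longrightarrow> compact (\<gamma> ` {t i..t (Suc i)})"
  by (intro compact_continuous_image continuous_on_subset[OF continuous_on_\<gamma>])
    (use t_bounds[of i] t_bounds[of "Suc i"] in auto)

text \<open>Adding the end vertices turns an edge into a closed set of the sphere: a compact arc, a
  segment, or two closed rays together with infinity. Removing the vertices again leaves just the
  edge.\<close>

lemma closedin_edge:
  assumes "a \<in> edge_index"
  shows "closedin (subtopology sphere_top (meander_graph \<gamma> - vertices \<gamma>)) (edge a)"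
proof -
  have sub: "edge a \<subseteq> meander_graph \<gamma> - vertices \<gamma>"
    using assms graph_minus_vertices_eq by auto
  have "\<exists>C. closedin sphere_top C \<and> edge a \<subseteq> C \<and> C \<subseteq> edge a \<union> vertices \<gamma>"
  proof (cases a)
    case (Inl i)
    then have i: "i \<le> n" using assms by (auto simp: edge_index_def)
    let ?C = "Some ` \<gamma> ` {t i..t (Suc i)}"
    have "{t i..t (Suc i)} \<subseteq> {t i<..<t (Suc i)} \<union> t ` {..Suc n}"
      using i by (auto simp: order_less_le)
    then have c3: "?C \<subseteq> edge a \<union> vertices \<gamma>"
      using Inl by (auto simp: edge_def arc_piece_def vertices_eq)
    have c2: "edge a \<subseteq> ?C"
      using Inl by (auto simp: edge_def arc_piece_def)
    have c1: "closedin sphere_top ?C"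
      using closed_arc_closure[OF i] by (auto simp: compact_imp_closed)
    show ?thesis by (rule exI[of _ ?C], rule conjI[OF c1 conjI[OF c2 c3]])
  next
    case (Inr i)
    then have i: "i < n" using assms by (auto simp: edge_index_def)
    have xv: "Some (complex_of_real (x j)) \<in> vertices \<gamma>" if "1 \<le> j" "j \<le> n" for j
      using that crossings_eq by (auto simp: vertices_def)
    show ?thesis
    proof (cases "i = 0")
      case True
      let ?C = "insert None (Some ` complex_of_real ` ({..x 1} \<union> {x n..}))"
      have "closed (complex_of_real ` ({..x 1} \<union> {x n..}))"
        by (intro closed_injective_image_subspace closed_injective_linear_image linear_of_real) (auto simp: inj_def)
      then have c1: "closedin sphere_top ?C" by simp
      have c2: "edge a \<subseteq> ?C" using Inr True by (auto simp: edge_def line_piece_def)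
      have c3: "?C \<subseteq> edge a \<union> vertices \<gamma>"
      proof -
        have "{..x 1} \<union> {x n..} = {r. r < x 1 \<or> x n < r} \<union> {x 1, x n}"
          by auto
        then have "?C = edge a \<union> {Some (complex_of_real (x 1)), Some (complex_of_real (x n))}"
          using Inr True by (simp only: edge_def line_piece_def image_Un) auto
        then show ?thesis
          using xv[of 1] xv[of n] n_pos by auto
      qed
      show ?thesis by (rule exI[of _ ?C], rule conjI[OF c1 conjI[OF c2 c3]])
    next
      case False
      let ?C = "Some ` complex_of_real ` {x i..x (Suc i)}"
      have "compact (complex_of_real ` {x i..x (Suc i)})"
        by (intro compact_continuous_image continuous_intros) auto
      then have c1: "closedin sphere_top ?C" by (simp add: compact_imp_closed)
      have c2: "edge a \<subseteq> ?C" using Inr False by (auto simp: edge_def line_piece_def)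
      have c3: "?C \<subseteq> edge a \<union> vertices \<gamma>"
      proof -
        have "{x i..x (Suc i)} = {x i<..<x (Suc i)} \<union> {x i, x (Suc i)}"
          using x_less[of i "Suc i"] False i by auto
        then have "?C = edge a \<union> {Some (complex_of_real (x i)), Some (complex_of_real (x (Suc i)))}"
          using Inr False by (simp only: edge_def line_piece_def image_Un) auto
        then show ?thesis
          using xv[of i] xv[of "Suc i"] i False by auto
      qed
      show ?thesis by (rule exI[of _ ?C], rule conjI[OF c1 conjI[OF c2 c3]])
    qed
  qed
  then obtain C where "closedin sphere_top C" "edge a \<subseteq> C" "C \<subseteq> edge a \<union> vertices \<gamma>"
    by blast
  moreover from this have "edge a = C \<inter> (meander_graph \<gamma> - vertices \<gamma>)"
    using sub by blast
  ultimately show ?thesis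
    unfolding closedin_subtopology by blast
qed

lemma edges_eq: "edges \<gamma> = edge ` edge_index"
  unfolding edges_def
proof (rule connected_components_of_eqI_closed)
  show "finite (edge ` edge_index)" by (simp add: edge_index_def)
  have "meander_graph \<gamma> - vertices \<gamma> \<subseteq> topspace sphere_top"
    by (auto simp: not_None_eq image_iff)
  then show "\<Union> (edge ` edge_index) = topspace (subtopology sphere_top (meander_graph \<gamma> - vertices \<gamma>))"
    unfolding topspace_subtopology graph_minus_vertices_eq[symmetric] by blast
  show "pairwise disjnt (edge ` edge_index)"
    using edge_disjoint by (auto simp: pairwise_def disjnt_def)
next
  fix S assume "S \<in> edge ` edge_index"
  then obtain a where a: "a \<in> edge_index" "S = edge a" by auto
  show "S \<noteq> {}" using edge_nonempty a by simp
  show "closedin (subtopology sphere_top (meander_graph \<gamma> - vertices \<gamma>)) S"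
    using closedin_edge a by simp
  have "edge a \<subseteq> meander_graph \<gamma> - vertices \<gamma>"
    unfolding graph_minus_vertices_eq using a by blast
  then show "connectedin (subtopology sphere_top (meander_graph \<gamma> - vertices \<gamma>)) S"
    using connected_edge[OF a(1)] a(2) unfolding connectedin_subtopology by blast
qed

lemma card_sides_eq:
  "card (sides \<gamma> R) =
     card {i. i \<le> n \<and> edge (Inl i) \<subseteq> sphere_top frontier_of R} +
     card {i. i < n \<and> edge (Inr i) \<subseteq> sphere_top frontier_of R}" (is "_ = card ?A + card ?B")
proof -
  have "sides \<gamma> R = edge ` (?A <+> ?B)"
    unfolding sides_def edges_eq edge_index_def by auto
  moreover have "inj_on edge (?A <+> ?B)"
    by (rule inj_on_subset[OF inj_on_edge]) (auto simp: edge_index_def)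
  ultimately show ?thesis
    by (simp add: card_image card_Plus)
qed

end

subsection \<open>Crosscuts and the sides of a region\<close>

definition half_plane :: "real \<Rightarrow> complex set" where
  "half_plane \<sigma> = {z. 0 < \<sigma> * Im z}"

lemma convex_half_plane: "convex (half_plane \<sigma>)"
proof -
  have "half_plane \<sigma> = {z. inner (\<sigma> *\<^sub>R \<i>) z > 0}"
    by (auto simp: half_plane_def inner_complex_def)
  then show ?thesis by (simp only: convex_halfspace_gt)
qed

lemma open_half_plane: "open (half_plane \<sigma>)"
  unfolding half_plane_def by (intro open_Collect_less continuous_intros)

lemma unbounded_half_plane:
  assumes "\<sigma> \<noteq> 0" shows "\<not> bounded (half_plane \<sigma>)"
proof
  assume "bounded (half_plane \<sigma>)"
  then obtain a where a: "\<And>z. z \<in> half_plane \<sigma> \<Longrightarrow> norm z \<le> a" by (auto simp: bounded_iff)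
  define z where "z = Complex 0 ((\<bar>a\<bar> + 1) * sgn \<sigma>)"
  have "z \<in> half_plane \<sigma>" using assms
    by (cases "0 < \<sigma>") (auto simp: half_plane_def z_def sgn_if intro: mult_neg_neg)
  moreover have "norm z = \<bar>a\<bar> + 1"
    using assms by (auto simp: z_def cmod_def abs_mult sgn_if)
  ultimately show False using a[of z] by linarith
qed

lemma half_plane_shift:
  assumes "\<sigma> \<noteq> 0" "0 < \<epsilon>"
  shows "\<exists>w\<in>half_plane \<sigma>. dist (complex_of_real c) w < \<epsilon>"
proof -
  have "Complex c (\<epsilon> / 2 * sgn \<sigma>) \<in> half_plane \<sigma>"
    using assms by (auto simp: half_plane_def sgn_if mult_less_0_iff)
  moreover have "dist (complex_of_real c) (Complex c (\<epsilon> / 2 * sgn \<sigma>)) = \<epsilon> / 2"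
    using assms by (auto simp: dist_norm cmod_def sgn_if)
  ultimately show ?thesis
    using assms(2) by (intro bexI[of _ "Complex c (\<epsilon> / 2 * sgn \<sigma>)"]) auto
qed

lemma connected_subset_half_plane:
  assumes "connected S" "S \<inter> horizontal_line = {}" "S \<noteq> {}"
  obtains \<sigma> where "\<sigma> \<in> {1, -1}" "S \<subseteq> half_plane \<sigma>"
proof -
  have "S \<subseteq> half_plane 1 \<union> half_plane (-1)"
    using assms(2) by (auto simp: half_plane_def horizontal_line_def)
  moreover have "half_plane 1 \<inter> half_plane (-1) \<inter> S = {}"
    by (auto simp: half_plane_def)
  ultimately have "half_plane 1 \<inter> S = {} \<or> half_plane (-1) \<inter> S = {}"
    using connectedD[OF assms(1) open_half_plane open_half_plane] by blast
  then show ?thesis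
    using \<open>S \<subseteq> half_plane 1 \<union> half_plane (-1)\<close> that[of 1] that[of "-1"] by blast
qed

lemma connected_subset_inside:
  assumes "connected T" "T \<inter> C = {}" "p \<in> T" "p \<in> inside C"
  shows "T \<subseteq> inside C"
proof
  fix q assume "q \<in> T"
  then have "connected_component (- C) p q"
    using assms by (auto simp: connected_component_def)
  then show "q \<in> inside C" using assms inside_same_component by metis
qed

lemma connected_subset_outside:
  assumes "connected T" "T \<inter> C = {}" "p \<in> T" "p \<in> outside C"
  shows "T \<subseteq> outside C"
proof
  fix q assume "q \<in> T"
  then have "connected_component (- C) p q"
    using assms by (auto simp: connected_component_def)
  then show "q \<in> outside C" using assms outside_same_component by metis
qed

text \<open>The crosscut and the segment between its feet form a Jordan curve. A small disc around
  \<open>d\<close> links \<open>S\<close> to the opposite half plane, which is outside the curve. A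
  half disc at \<open>c\<close> lies inside it, because \<open>c\<close> is on the frontier of the
  inside, and it also meets \<open>S\<close>.\<close>

lemma crosscut_separates:
  fixes g :: "real \<Rightarrow> complex" and a b c d \<sigma> :: real
  assumes g: "arc g" "pathstart g = of_real a" "pathfinish g = of_real b"
    and gh: "path_image g - {of_real a, of_real b} \<subseteq> half_plane \<sigma>"
    and S: "connected S" "S \<subseteq> half_plane \<sigma>" "S \<inter> path_image g = {}"
    and c: "min a b < c" "c < max a b" and d: "d < min a b \<or> max a b < d"
    and cl: "of_real c \<in> closure S" "of_real d \<in> closure S"
  shows False
proof -
  have \<sigma>: "\<sigma> \<noteq> 0"
    using S(2) cl(1) by (cases "S = {}") (auto simp: half_plane_def)
  have "a \<noteq> b" using c by auto
  have seg: "closed_segment (complex_of_real b) (of_real a) = of_real ` {min a b..max a b}"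
    by (simp add: closed_segment_of_real closed_segment_eq_real_ivl min_def max_def)
  define C where "C = path_image (g +++ linepath (of_real b) (of_real a))"
  have pi: "path_image g \<inter> closed_segment (of_real b) (of_real a) \<subseteq> {of_real a, of_real b}"
    using gh unfolding seg by (auto simp: half_plane_def)
  have sp: "simple_path (g +++ linepath (of_real b) (of_real a))"
    using \<open>a \<noteq> b\<close> pi g by (intro simple_path_join_loop) auto
  have lp: "pathfinish (g +++ linepath (of_real b) (of_real a)) = pathstart (g +++ linepath (of_real b) (of_real a))"
    using g by simp
  have Ceq: "C = path_image g \<union> of_real ` {min a b..max a b}"
    using g by (simp add: C_def path_image_join seg)
  have jor: "inside C \<inter> outside C = {}" "frontier (inside C) = C"
    using Jordan_inside_outside[OF sp lp] by (auto simp: C_def)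
  have clC: "closed C"
    unfolding C_def using sp by (simp add: closed_simple_path_image)
  have clg: "closed (path_image g)"
    using g(1) by (simp add: closed_arc_image)
  have real_g: "complex_of_real r \<notin> path_image g" if "r \<noteq> a" "r \<noteq> b" for r
    using gh that by (force simp: half_plane_def)
  have neg_disj: "half_plane (- \<sigma>) \<inter> C = {}"
    using gh by (force simp: Ceq half_plane_def)
  \<comment> \<open>The opposite half plane is connected, unbounded and disjoint from the curve, so
    its component in the complement is unbounded.\<close>
  have neg_out: "half_plane (- \<sigma>) \<subseteq> outside C"
  proof
    fix z assume z: "z \<in> half_plane (- \<sigma>)"
    have "half_plane (- \<sigma>) \<subseteq> connected_component_set (- C) z"
      using z neg_disj convex_connected[OF convex_half_plane]
      by (intro connected_component_maximal) auto
    then have "\<not> bounded (connected_component_set (- C) z)"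
      using unbounded_half_plane[of "- \<sigma>"] \<sigma> bounded_subset by auto
    then show "z \<in> outside C"
      using z neg_disj by (auto simp: outside_def)
  qed
  have SC: "S \<inter> C = {}"
    using S(2,3) by (auto simp: Ceq half_plane_def)
  have S_out: "S \<subseteq> outside C"
  proof -
    have "complex_of_real d \<notin> C"
      using d real_g[of d] by (auto simp: Ceq)
    then obtain \<epsilon> where \<epsilon>: "\<epsilon> > 0" "ball (of_real d) \<epsilon> \<subseteq> - C"
      using clC by (metis ComplI open_Compl open_contains_ball_eq)
    obtain w where w: "w \<in> half_plane (- \<sigma>)" "w \<in> ball (of_real d) \<epsilon>"
      using half_plane_shift[of "- \<sigma>" \<epsilon> d] \<sigma> \<epsilon> by auto
    have "ball (of_real d) \<epsilon> \<subseteq> outside C"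
      using connected_subset_outside[of "ball (of_real d) \<epsilon>" C w] w neg_out \<epsilon> by auto
    moreover obtain s where "s \<in> S" "s \<in> ball (of_real d) \<epsilon>"
      using cl(2) \<epsilon>(1) unfolding closure_approachable by (auto simp: dist_commute)
    ultimately show ?thesis
      using connected_subset_outside[OF S(1) SC, of s] by blast
  qed
  have "complex_of_real c \<in> - path_image g"
    using real_g[of c] c by (auto simp: min_def max_def split: if_splits)
  then obtain \<epsilon>1 where \<epsilon>1: "\<epsilon>1 > 0" "ball (of_real c) \<epsilon>1 \<subseteq> - path_image g"
    using clg by (metis open_Compl open_contains_ball_eq)
  \<comment> \<open>The disc around \<open>c\<close> then avoids the arc and meets the real line
    only within the segment. So its upper or lower half misses the curve, and a point of the disc on
    the line belongs to the curve.\<close>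
  define \<epsilon> where "\<epsilon> = min \<epsilon>1 (min (c - min a b) (max a b - c))"
  have \<epsilon>: "\<epsilon> > 0" "\<epsilon> \<le> \<epsilon>1" "\<epsilon> \<le> c - min a b" "\<epsilon> \<le> max a b - c"
    using c \<epsilon>1 by (auto simp: \<epsilon>_def)
  have half_disc: "half_plane \<sigma> \<inter> ball (of_real c) \<epsilon> \<inter> C = {}"
  proof -
    have "ball (of_real c) \<epsilon> \<subseteq> ball (of_real c) \<epsilon>1" using \<epsilon>(2) by (rule subset_ball)
    then show ?thesis using \<epsilon>1 by (auto simp: Ceq half_plane_def)
  qed
  have "of_real c \<in> closure (inside C)"
    using jor(2) c by (auto simp: Ceq frontier_def)
  then obtain p where p: "p \<in> inside C" "p \<in> ball (of_real c) \<epsilon>"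
    using \<epsilon>(1) unfolding closure_approachable by (auto simp: dist_commute)
  have "p \<in> half_plane \<sigma>"
  proof -
    have "p \<notin> half_plane (- \<sigma>)" using neg_out p(1) jor(1) by blast
    moreover have "Im p \<noteq> 0"
    proof
      assume "Im p = 0"
      then have pe: "p = of_real (Re p)" by (simp add: complex_eq_iff)
      have "\<bar>Re p - c\<bar> \<le> dist (of_real c) p"
        using abs_Re_le_cmod[of "p - of_real c"] by (simp add: dist_norm norm_minus_commute)
      then have "Re p \<in> {min a b..max a b}" using p(2) \<epsilon> by auto
      then have "p \<in> C" using pe by (auto simp: Ceq)
      then show False using p(1) inside_no_overlap by blast
    qed
    ultimately show ?thesis using \<sigma> by (auto simp: half_plane_def not_less order_less_le)
  qed
  then have "half_plane \<sigma> \<inter> ball (of_real c) \<epsilon> \<subseteq> inside C"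
    using p half_disc
    by (intro connected_subset_inside[of _ C p] convex_connected convex_Int convex_half_plane) auto
  moreover obtain q where "q \<in> S" "q \<in> ball (of_real c) \<epsilon>"
    using cl(1) \<epsilon>(1) unfolding closure_approachable by (auto simp: dist_commute)
  ultimately show False
    using S(2) S_out jor(1) by blast
qed

text \<open>A region misses the line and therefore stays in one half plane. The last clause is the
  maximality of a component, phrased for plane sets so that regions can be compared without
  returning to the sphere.\<close>

lemma region_cases:
  assumes "arc \<gamma>" "R \<in> regions \<gamma>"
  obtains S \<sigma> where "R = Some ` S" "S \<noteq> {}" "connected S" "open S" "\<sigma> \<in> {1, -1}" "S \<subseteq> half_plane \<sigma>"
    "S \<inter> path_image \<gamma> = {}"
    "\<And>T. connected T \<Longrightarrow> T \<subseteq> half_plane \<sigma> \<Longrightarrow> T \<inter> path_image \<gamma> = {} \<Longrightarrow> T \<inter> S \<noteq> {} \<Longrightarrow> T \<subseteq> S"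
proof -
  let ?X = "subtopology sphere_top (- meander_graph \<gamma>)"
  have R: "R \<in> connected_components_of ?X" using assms(2) by (simp add: regions_def)
  have sub: "R \<subseteq> - meander_graph \<gamma>"
    using connected_components_of_subset[OF R] by simp
  then have "R \<subseteq> range Some"
    by (metis ComplD Un_iff insertI1 meander_graph_def notin_range_Some subset_iff)
  then obtain S where S: "R = Some ` S" by (auto simp: subset_image_iff)
  have "connectedin sphere_top R"
    using connectedin_connected_components_of[OF R] by (simp add: connectedin_subtopology)
  then have conn: "connected S" using S by simp
  have "R \<noteq> {}" using nonempty_connected_components_of[OF R] .
  then have ne: "S \<noteq> {}" using S by simp
  have dis: "S \<inter> horizontal_line = {}" "S \<inter> path_image \<gamma> = {}"
    using sub S by (auto simp: meander_graph_def)
  have max: "T \<subseteq> S" if T: "connected T" "T \<inter> horizontal_line = {}" "T \<inter> path_image \<gamma> = {}" "T \<inter> S \<noteq> {}" for T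
  proof -
    have "connectedin ?X (Some ` T)"
      using T by (auto simp: connectedin_subtopology meander_graph_def)
    moreover have "\<not> disjnt R (Some ` T)"
      using T(4) S by (auto simp: disjnt_def)
    ultimately have "Some ` T \<subseteq> R"
      by (rule connected_components_of_maximal[OF R])
    then show ?thesis using S by auto
  qed
  obtain \<sigma> where \<sigma>: "\<sigma> \<in> {1, -1}" "S \<subseteq> half_plane \<sigma>"
    using connected_subset_half_plane[OF conn dis(1) ne] by blast
  have hl: "half_plane \<tau> \<inter> horizontal_line = {}" for \<tau>
    by (auto simp: half_plane_def horizontal_line_def)
  have "open S"
    unfolding open_contains_ball
  proof
    fix z assume z: "z \<in> S"
    have "open (half_plane \<sigma> - path_image \<gamma>)"
      using assms(1) by (simp add: open_half_plane open_Diff closed_arc_image)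
    moreover have "z \<in> half_plane \<sigma> - path_image \<gamma>" using z \<sigma> dis by auto
    ultimately obtain \<epsilon> where "\<epsilon> > 0" "ball z \<epsilon> \<subseteq> half_plane \<sigma> - path_image \<gamma>"
      by (meson open_contains_ball)
    moreover from this have "z \<in> ball z \<epsilon>" by simp
    moreover from calculation have "ball z \<epsilon> \<subseteq> S"
      using z hl by (intro max connected_ball) blast+
    ultimately show "\<exists>\<epsilon>>0. ball z \<epsilon> \<subseteq> S" by blast
  qed
  show ?thesis
    by (rule that[OF S ne conn \<open>open S\<close> \<sigma> dis(2)]) (use max hl in blast)
qed

section \<open>Enumerating the crossings along the arc and along the line\<close>

lemma finite_real_enumeration:
  fixes A :: "real set"
  assumes "finite A"
  obtains f :: "nat \<Rightarrow> real" where "\<And>i j. 1 \<le> i \<Longrightarrow> i < j \<Longrightarrow> j \<le> card A \<Longrightarrow> f i < f j" "f ` {1..card A} = A"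
proof
  let ?f = "\<lambda>i. sorted_list_of_set A ! (i - 1)"
  show "?f i < ?f j" if "1 \<le> i" "i < j" "j \<le> card A" for i j
    using that strict_sorted_list_of_set[of A]
    by (intro sorted_wrt_nth_less[of "(<)"]) auto
  have "(\<lambda>i. i - 1) ` {1..card A} = {..<card A}"
    by (force simp: image_iff intro: bexI[of _ "Suc _"])
  moreover have "(!) (sorted_list_of_set A) ` {..<card A} = A"
    using assms nth_image[of "card A" "sorted_list_of_set A"] by (simp add: lessThan_atLeast0)
  ultimately have "(!) (sorted_list_of_set A) ` (\<lambda>i. i - 1) ` {1..card A} = A"
    by (simp only:)
  then show "?f ` {1..card A} = A"
    by (simp only: image_image)
qed

text \<open>Infinitely many zeros would accumulate at a parameter \<open>l\<close>, which is a zero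
  by closedness and interior because the anchors are off the line. Transversality at
  \<open>l\<close> keeps a punctured neighbourhood free of zeros.\<close>

lemma finite_crossing_parameters:
  assumes "singly_anchored_open_meander \<gamma>"
  shows "finite {u \<in> {0..1}. Im (\<gamma> u) = 0}" (is "finite ?T")
proof (rule ccontr)
  assume inf: "infinite ?T"
  have arc: "arc \<gamma>" and ends: "Im (\<gamma> 0) \<noteq> 0" "Im (\<gamma> 1) \<noteq> 0"
    and tr: "\<And>u. 0 < u \<Longrightarrow> u < 1 \<Longrightarrow> Im (\<gamma> u) = 0 \<Longrightarrow> crosses_line_at \<gamma> u"
    using assms by (auto simp: singly_anchored_open_meander_def horizontal_line_def pathstart_def pathfinish_def)
  have "continuous_on {0..1} \<gamma>" using arc by (simp add: arc_def path_def)
  then have "closed ({0..1} \<inter> (\<lambda>u. Im (\<gamma> u)) -` {0})"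
    by (intro continuous_closed_preimage continuous_intros) auto
  moreover have "{0..1} \<inter> (\<lambda>u. Im (\<gamma> u)) -` {0} = ?T" by auto
  ultimately have "closed ?T" by (simp only:)
  have "?T \<subseteq> {0..1}" by auto
  then obtain l where l: "l islimpt ?T"
    using Heine_Borel_imp_Bolzano_Weierstrass[OF compact_Icc inf] by blast
  with \<open>closed ?T\<close> have "l \<in> ?T" unfolding closed_limpt by blast
  then have "0 \<le> l" "l \<le> 1" "Im (\<gamma> l) = 0" by auto
  moreover have "l \<noteq> 0" "l \<noteq> 1" using ends \<open>Im (\<gamma> l) = 0\<close> by auto
  ultimately have "0 < l" "l < 1" "Im (\<gamma> l) = 0" by auto
  then have "\<forall>\<^sub>F u in at l. Im (\<gamma> u) \<noteq> 0"
    using tr[of l] unfolding crosses_line_at_def eventually_at_split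
    by (auto elim!: eventually_mono)
  then have "\<forall>\<^sub>F u in at l. u \<notin> ?T"
    by (rule eventually_mono) auto
  then show False
    using l unfolding islimpt_iff_eventually by blast
qed

lemma ex_meander_frame:
  assumes m: "singly_anchored_open_meander \<gamma>" and ne: "crossings \<gamma> \<noteq> {}"
  obtains n t x where "meander_frame \<gamma> n t x" "n = card (crossings \<gamma>)"
proof -
  let ?T = "{u \<in> {0..1}. Im (\<gamma> u) = 0}"
  have arc: "arc \<gamma>" and ends: "Im (\<gamma> 0) \<noteq> 0" "Im (\<gamma> 1) \<noteq> 0"
    using m by (auto simp: singly_anchored_open_meander_def horizontal_line_def pathstart_def pathfinish_def)
  have fin: "finite ?T" using m by (rule finite_crossing_parameters)
  have T: "u \<in> ?T \<Longrightarrow> 0 < u \<and> u < 1" for u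
    using ends by (cases "u = 0 \<or> u = 1") auto
  have cr: "crossings \<gamma> = \<gamma> ` ?T"
    by (auto simp: crossings_def path_image_def horizontal_line_def)
  have "inj_on \<gamma> ?T" by (rule inj_on_subset[of _ "{0..1}"]) (use arc in \<open>auto simp: arc_def\<close>)
  then have card: "card ?T = card (crossings \<gamma>)" unfolding cr by (rule card_image[symmetric])
  define n where "n = card ?T"
  have n: "0 < n" using ne fin by (auto simp: n_def cr card_gt_0_iff)
  obtain f where f: "\<And>i j. 1 \<le> i \<Longrightarrow> i < j \<Longrightarrow> j \<le> n \<Longrightarrow> f i < f j" "f ` {1..n} = ?T"
    using finite_real_enumeration[OF fin, folded n_def] by blast
  let ?X = "Re ` crossings \<gamma>"
  have X: "complex_of_real ` ?X = crossings \<gamma>"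
  proof -
    have "complex_of_real (Re z) = z" if "z \<in> crossings \<gamma>" for z
      using that by (simp add: crossings_def horizontal_line_def complex_eq_iff)
    then show ?thesis by (simp add: image_image cong: image_cong)
  qed
  then have "card ?X = n"
    using card card_image[of complex_of_real ?X] by (simp add: n_def inj_on_def)
  have "finite ?X" using fin by (simp add: cr)
  obtain x where x: "\<And>i j. 1 \<le> i \<Longrightarrow> i < j \<Longrightarrow> j \<le> n \<Longrightarrow> x i < x j" "x ` {1..n} = ?X"
    using finite_real_enumeration[OF \<open>finite ?X\<close>, unfolded \<open>card ?X = n\<close>] by blast
  define t where "t i = (if i = 0 then 0 else if i = Suc n then 1 else f i)" for i
  have tf: "t ` {1..n} = f ` {1..n}" by (rule image_cong) (auto simp: t_def)
  have fT: "0 < f i \<and> f i < 1" if "1 \<le> i" "i \<le> n" for i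
  proof -
    have "f i \<in> ?T" unfolding f(2)[symmetric] using that by auto
    then show ?thesis by (rule T)
  qed
  have "meander_frame \<gamma> n t x"
  proof
    show "t i < t j" if "i < j" "j \<le> Suc n" for i j
      using that f(1)[of i j] fT[of i] fT[of j] by (auto simp: t_def)
    show "Im (\<gamma> u) = 0 \<longleftrightarrow> u \<in> t ` {1..n}" if "0 \<le> u" "u \<le> 1" for u
      unfolding tf f(2) using that by simp
    show "crossings \<gamma> = complex_of_real ` x ` {1..n}"
      by (simp only: x(2) X)
  qed (use arc n x in \<open>auto simp: t_def\<close>)
  then show ?thesis using that card by (simp add: n_def)
qed

section \<open>Upper bounds for the number of sides of a region\<close>

lemma closure_subset_closed_half_plane:
  assumes "S \<subseteq> half_plane \<sigma>" "z \<in> closure S"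
  shows "0 \<le> \<sigma> * Im z"
proof -
  have "closed {z. 0 \<le> \<sigma> * Im z}"
    by (intro closed_Collect_le continuous_intros)
  moreover have "S \<subseteq> {z. 0 \<le> \<sigma> * Im z}"
    using assms(1) by (auto simp: half_plane_def)
  ultimately show ?thesis
    using assms(2) closure_minimal by blast
qed

lemma card_even_atMost: "card {i. i \<le> n \<and> even i} = n div 2 + 1"
proof -
  have "{i. i \<le> n \<and> even i} = (\<lambda>j. 2 * j) ` {..n div 2}"
    by (auto elim!: evenE)
  then show ?thesis by (simp add: card_image inj_on_def)
qed

lemma card_odd_atMost: "card {i. i \<le> n \<and> odd i} = (n + 1) div 2"
proof -
  have "{i. i \<le> n \<and> odd i} = (\<lambda>j. 2 * j + 1) ` {..<(n + 1) div 2}"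
    by (auto elim!: oddE)
  then show ?thesis by (simp add: card_image inj_on_def)
qed

context meander_frame
begin

text \<open>Each crossing changes the side, so the side of an arc piece depends on the parity of its
  index; \<sigma> is the side of the first tail.\<close>

lemma arc_piece_half_plane:
  assumes m: "singly_anchored_open_meander \<gamma>"
  obtains \<sigma> where "\<sigma> \<in> {1, -1}" "\<And>i. i \<le> n \<Longrightarrow> arc_piece i \<subseteq> half_plane (\<sigma> * (-1) ^ i)"
proof -
  have side: "\<exists>\<tau>\<in>{1, -1}. arc_piece i \<subseteq> half_plane \<tau>" if "i \<le> n" for i
  proof -
    have "arc_piece i \<inter> horizontal_line = {}"
      using arc_piece_Im_nonzero[OF that] by (auto simp: horizontal_line_def)
    then show ?thesis
      using connected_subset_half_plane[OF connected_arc_piece[OF that]] arc_piece_nonempty[OF that] by metis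
  qed
  obtain \<sigma> where \<sigma>: "\<sigma> \<in> {1, -1}" "arc_piece 0 \<subseteq> half_plane \<sigma>"
    using side[of 0] by auto
  have "arc_piece i \<subseteq> half_plane (\<sigma> * (-1) ^ i)" if "i \<le> n" for i
    using that
  proof (induction i)
    case 0
    then show ?case using \<sigma> by simp
  next
    case (Suc i)
    let ?\<rho> = "\<sigma> * (-1) ^ i" and ?v = "t (Suc i)"
    have \<rho>: "?\<rho> \<in> {1, -1}" using \<sigma>(1) by (cases "even i") auto
    obtain \<tau> where \<tau>: "\<tau> \<in> {1, -1}" "arc_piece (Suc i) \<subseteq> half_plane \<tau>"
      using side[OF Suc.prems] by auto
    have lt: "t i < ?v" "?v < t (Suc (Suc i))" "0 < ?v" "?v < 1"
      using t_less[of i "Suc i"] t_less[of "Suc i" "Suc (Suc i)"] t_less[of 0 "Suc i"]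
        t_less[of "Suc i" "Suc n"] Suc.prems t_0 t_Suc_n by auto
    have "Im (\<gamma> ?v) = 0"
      using Im_eq_0_iff[of ?v] lt Suc.prems by auto
    then have cr: "crosses_line_at \<gamma> ?v"
      using m lt by (auto simp: singly_anchored_open_meander_def horizontal_line_def)
    have left: "\<forall>\<^sub>F s in at_left ?v. 0 < ?\<rho> * Im (\<gamma> s)"
      by (rule eventually_mono[OF eventually_at_left_real[OF lt(1)]])
        (use Suc in \<open>force simp: arc_piece_def half_plane_def\<close>)
    have right: "\<forall>\<^sub>F s in at_right ?v. 0 < \<tau> * Im (\<gamma> s)"
      by (rule eventually_mono[OF eventually_at_right_real[OF lt(2)]])
        (use \<tau> in \<open>force simp: arc_piece_def half_plane_def\<close>)
    \<comment> \<open>Equal sides would give Im the same sign just before and just after the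
      crossing, against transversality.\<close>
    have "\<tau> = - ?\<rho>"
    proof (rule ccontr)
      assume "\<tau> \<noteq> - ?\<rho>"
      then have eq: "\<tau> = ?\<rho>" using \<tau>(1) \<rho> by auto
      have nt: "at_left ?v \<noteq> bot" "at_right ?v \<noteq> bot" by simp_all
      have clash: False if "eventually P F" "eventually Q F" "F \<noteq> bot" "\<And>s. P s \<Longrightarrow> Q s \<Longrightarrow> False"
        for P Q and F :: "real filter"
        using eventually_happens[OF eventually_conj[OF that(1,2)]] that(3,4) by auto
      from cr show False
        unfolding crosses_line_at_def
      proof (elim disjE conjE)
        assume "\<forall>\<^sub>F s in at_left ?v. Im (\<gamma> s) < 0" "\<forall>\<^sub>F s in at_right ?v. 0 < Im (\<gamma> s)"
        from clash[OF left this(1) nt(1)] clash[OF right this(2) nt(2)] show False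
          using \<rho> eq by auto
      next
        assume "\<forall>\<^sub>F s in at_left ?v. 0 < Im (\<gamma> s)" "\<forall>\<^sub>F s in at_right ?v. Im (\<gamma> s) < 0"
        from clash[OF left this(1) nt(1)] clash[OF right this(2) nt(2)] show False
          using \<rho> eq by auto
      qed
    qed
    then show ?case using \<tau>(2) by simp
  qed
  then show ?thesis using that \<sigma>(1) by blast
qed

lemma edge_subset_frontier_imp:
  assumes "open S"
  shows "edge (Inl i) \<subseteq> sphere_top frontier_of (Some ` S) \<Longrightarrow> arc_piece i \<subseteq> closure S"
    and "edge (Inr i) \<subseteq> sphere_top frontier_of (Some ` S) \<Longrightarrow> line_piece i \<subseteq> closure S"
  unfolding open_image_Some_frontier_eq[OF assms]
  using Some_in_sphere_closure_of_iff by (auto simp: edge_def split: if_splits)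

text \<open>
  At a crossing that is not the end of a tail on the side of \<open>S\<close>, the arc leaves into the half
  plane along a crosscut, which separates the two line edges at the crossing.
\<close>

lemma line_pieces_at_crossing:
  assumes S: "connected S" "S \<subseteq> half_plane \<sigma>" "S \<inter> path_image \<gamma> = {}"
    and v: "1 \<le> v" "v \<le> n" and cl: "line_piece (v mod n) \<subseteq> closure S" "line_piece (v - 1) \<subseteq> closure S"
    and i: "1 \<le> i" "i < n" "arc_piece i \<subseteq> half_plane \<sigma>"
  shows "of_real (x v) \<noteq> \<gamma> (t i)" "of_real (x v) \<noteq> \<gamma> (t (Suc i))"
proof -
  have ti: "0 \<le> t i" "t i < t (Suc i)" "t (Suc i) \<le> 1"
    using t_bounds[of i] t_bounds[of "Suc i"] t_less[of i "Suc i"] i by auto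
  define g where "g = subpath (t i) (t (Suc i)) \<gamma>"
  have g: "arc g" "pathstart g = \<gamma> (t i)" "pathfinish g = \<gamma> (t (Suc i))" "path_image g = \<gamma> ` {t i..t (Suc i)}"
    using arc_subpath_arc[OF arc_\<gamma>, of "t i" "t (Suc i)"] ti
    by (auto simp: g_def path_image_subpath)
  have "\<gamma> (t i) \<in> crossings \<gamma>" "\<gamma> (t (Suc i)) \<in> crossings \<gamma>"
    using i by (auto simp: crossings_eq_t)
  then obtain p q where pq: "1 \<le> p" "p \<le> n" "1 \<le> q" "q \<le> n"
      "\<gamma> (t i) = of_real (x p)" "\<gamma> (t (Suc i)) = of_real (x q)"
    by (auto simp: crossings_eq)
  have "{t i..t (Suc i)} = insert (t i) (insert (t (Suc i)) {t i<..<t (Suc i)})"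
    using ti by auto
  then have gi: "path_image g - {of_real (x p), of_real (x q)} \<subseteq> half_plane \<sigma>"
    using i(3) pq by (auto simp: g arc_piece_def)
  have "path_image g \<subseteq> path_image \<gamma>"
    unfolding g(4) unfolding path_image_def using ti by (intro image_mono) auto
  then have gd: "S \<inter> path_image g = {}"
    using S(3) by blast
  have "p \<noteq> q"
    using arc_distinct_ends[OF g(1)] pq g by auto
  have outer: "of_real r \<in> closure S" if "line_piece 0 \<subseteq> closure S" "r < x 1 \<or> x n < r" for r
    using that by (auto simp: line_piece_def)
  have inner: "of_real r \<in> closure S" if "line_piece j \<subseteq> closure S" "j \<noteq> 0" "x j < r" "r < x (Suc j)" for r j
    using that by (auto simp: line_piece_def)
  \<comment> \<open>Let \<open>x w\<close> be the other foot of the crosscut. Of the two line pieces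
    at \<open>x v\<close>, the one towards \<open>x w\<close> supplies the point \<open>c\<close>
    between the feet, the one away from \<open>x w\<close> the point \<open>d\<close> beyond them.
    If \<open>x v\<close> is the first or the last crossing, \<open>d\<close> is taken on a ray of
    piece 0.\<close>
  have no: False if vw: "1 \<le> w" "w \<le> n" "w \<noteq> v" "{x p, x q} = {x v, x w}" for w
  proof -
    have mm: "min (x p) (x q) = min (x v) (x w)" "max (x p) (x q) = max (x v) (x w)"
      using vw(4) by (auto simp: doubleton_eq_iff min.commute max.commute)
    have ev: "\<exists>c d. min (x v) (x w) < c \<and> c < max (x v) (x w) \<and> (d < min (x v) (x w) \<or> max (x v) (x w) < d)
       \<and> of_real c \<in> closure S \<and> of_real d \<in> closure S"
    proof (cases "v < w")
      case True
      obtain c where c: "x v < c" "c < x (Suc v)" using x_less[of v "Suc v"] dense[of "x v" "x (Suc v)"] True v vw by auto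
      have "x (Suc v) \<le> x w" "x v < x w"
        using x_le[of "Suc v" w] x_less[of v w] True v vw by auto
      moreover have "complex_of_real c \<in> closure S"
        using cl(1) True v vw c inner[of v] by simp
      moreover obtain d where "d < x v" "complex_of_real d \<in> closure S"
      proof (cases "v = 1")
        case True
        then show ?thesis using cl(2) that[of "x 1 - 1"] outer[of "x 1 - 1"] by simp
      next
        case False
        then obtain d where "x (v - 1) < d" "d < x v"
          using x_less[of "v - 1" v] v dense[of "x (v - 1)" "x v"] by fastforce
        then show ?thesis using cl(2) that[of d] inner[of "v - 1" d] False v by simp
      qed
      ultimately show ?thesis using c
        by (intro exI[of _ c] exI[of _ d]) auto
    next
      case False
      then have "w < v" using vw by auto
      then obtain c where c: "x (v - 1) < c" "c < x v"
        using x_less[of "v - 1" v] v vw dense[of "x (v - 1)" "x v"] by fastforce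
      have "x w \<le> x (v - 1)" "x w < x v"
        using x_le[of w "v - 1"] x_less[of w v] v vw \<open>w < v\<close> by auto
      moreover have "complex_of_real c \<in> closure S"
        using cl(2) \<open>w < v\<close> v vw c inner[of "v - 1" c] by simp
      moreover obtain d where "x v < d" "complex_of_real d \<in> closure S"
      proof (cases "v = n")
        case True
        then show ?thesis using cl(1) that[of "x n + 1"] outer[of "x n + 1"] by simp
      next
        case False
        then obtain d where "x v < d" "d < x (Suc v)"
          using x_less[of v "Suc v"] v dense[of "x v" "x (Suc v)"] by fastforce
        then show ?thesis using cl(1) that[of d] inner[of v d] False v by simp
      qed
      ultimately show ?thesis using c
        by (intro exI[of _ c] exI[of _ d]) auto
    qed
    then obtain c d where "min (x p) (x q) < c" "c < max (x p) (x q)"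
      "d < min (x p) (x q) \<or> max (x p) (x q) < d" "of_real c \<in> closure S" "of_real d \<in> closure S"
      unfolding mm by blast
    then show False
      using crosscut_separates[OF g(1) _ _ gi S(1,2) gd] g(2,3) pq by auto
  qed
  have xinj: "x v = x w \<Longrightarrow> v = w" if "1 \<le> w" "w \<le> n" for w
    using x_less[of v w] x_less[of w v] v that by (metis less_irrefl linorder_neqE_nat)
  show "of_real (x v) \<noteq> \<gamma> (t i)"
    using no[of q] xinj[of p] pq \<open>p \<noteq> q\<close> by auto
  show "of_real (x v) \<noteq> \<gamma> (t (Suc i))"
    using no[of p] xinj[of q] pq \<open>p \<noteq> q\<close> by (auto simp: insert_commute)
qed

text \<open>Inclusion and exclusion: each of the two sets, crossings whose right piece is in
  \<open>B\<close> and crossings whose left piece is in \<open>B\<close>, has as many elements as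
  \<open>B\<close>, and their union has at most \<open>n\<close>.\<close>

lemma card_cyclic_pairs:
  assumes "B \<subseteq> {..<n}"
  shows "2 * card B \<le> n + card {v \<in> {1..n}. v mod n \<in> B \<and> v - 1 \<in> B}"
proof -
  let ?B1 = "{v \<in> {1..n}. v mod n \<in> B}" and ?B2 = "{v \<in> {1..n}. v - 1 \<in> B}"
  have "?B1 = (\<lambda>i. if i = 0 then n else i) ` B"
  proof
    show "?B1 \<subseteq> (\<lambda>i. if i = 0 then n else i) ` B"
    proof
      fix v assume "v \<in> ?B1"
      then show "v \<in> (\<lambda>i. if i = 0 then n else i) ` B"
        by (intro image_eqI[of _ _ "v mod n"]) (auto simp: le_less)
    qed
    show "(\<lambda>i. if i = 0 then n else i) ` B \<subseteq> ?B1"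
      using assms n_pos by auto
  qed
  moreover have "inj_on (\<lambda>i. if i = 0 then n else i) B"
    using assms by (auto simp: inj_on_def)
  ultimately have 1: "card ?B1 = card B" by (simp only: card_image)
  have "?B2 = Suc ` B"
    using assms by (force simp: image_iff Suc_le_eq gr0_conv_Suc)
  then have 2: "card ?B2 = card B" by (simp add: card_image)
  have "card (?B1 \<union> ?B2) \<le> card {1..n}"
    by (intro card_mono) auto
  moreover have "card ?B1 + card ?B2 = card (?B1 \<union> ?B2) + card (?B1 \<inter> ?B2)"
    by (rule card_Un_Int) auto
  moreover have "?B1 \<inter> ?B2 = {v \<in> {1..n}. v mod n \<in> B \<and> v - 1 \<in> B}" by auto
  ultimately show ?thesis using 1 2 by simp
qed

lemma card_line_pieces:
  assumes S: "connected S" "S \<subseteq> half_plane \<sigma>" "S \<inter> path_image \<gamma> = {}"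
    and \<sigma>: "\<sigma> \<in> {1, -1}" "\<sigma>0 \<in> {1, -1}" "\<And>i. i \<le> n \<Longrightarrow> arc_piece i \<subseteq> half_plane (\<sigma>0 * (-1) ^ i)"
  shows "2 * card {i. i < n \<and> line_piece i \<subseteq> closure S} \<le> n + card {i \<in> {0, n}. \<sigma>0 * (-1) ^ i = \<sigma>}"
proof -
  let ?B = "{i. i < n \<and> line_piece i \<subseteq> closure S}"
  let ?W = "{v \<in> {1..n}. v mod n \<in> ?B \<and> v - 1 \<in> ?B}"
  let ?T = "{i \<in> {0, n}. \<sigma>0 * (-1) ^ i = \<sigma>}"
  have "\<exists>v. 1 \<le> v \<and> v \<le> n \<and> of_real (x v) = \<gamma> (t j)" if "1 \<le> j" "j \<le> n" for j
  proof -
    have "\<gamma> (t j) \<in> crossings \<gamma>" using that by (auto simp: crossings_eq_t)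
    then show ?thesis by (auto simp: crossings_eq)
  qed
  then obtain w where w: "\<And>j. 1 \<le> j \<Longrightarrow> j \<le> n \<Longrightarrow> of_real (x (w j)) = \<gamma> (t j) \<and> 1 \<le> w j \<and> w j \<le> n"
    by metis
  have xinj: "v = v'" if "1 \<le> v" "v \<le> n" "1 \<le> v'" "v' \<le> n" "x v = x v'" for v v'
    using x_less[of v v'] x_less[of v' v] that by (metis less_irrefl linorder_neqE_nat)
  \<comment> \<open>One of the arc pieces \<open>j - 1\<close> and \<open>j\<close> at the crossing
    lies on the side \<sigma>. If both line pieces there belong to the closure, this arc piece is no
    crosscut, so it is a tail: index 0 with foot number 1, or index \<open>n\<close> with foot
    number \<open>n\<close>.\<close>
  have "?W \<subseteq> (\<lambda>i. w (if i = 0 then 1 else n)) ` ?T"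
  proof
    fix v assume v: "v \<in> ?W"
    then have v1: "1 \<le> v" "v \<le> n" by auto
    then have "complex_of_real (x v) \<in> crossings \<gamma>" by (auto simp: crossings_eq)
    then obtain j where j: "1 \<le> j" "j \<le> n" "of_real (x v) = \<gamma> (t j)"
      by (auto simp: crossings_eq_t)
    have vw: "v = w j"
      using xinj[of v "w j"] v1 w[of j] j by (metis of_real_eq_iff)
    have nope: "i = 0 \<or> i = n" if "i \<in> {j, j - 1}" "\<sigma>0 * (-1) ^ i = \<sigma>" for i
    proof (rule ccontr)
      assume "\<not> (i = 0 \<or> i = n)"
      then have i: "1 \<le> i" "i < n" using that j by auto
      have "arc_piece i \<subseteq> half_plane \<sigma>" using \<sigma>(3)[of i] i that(2) by simp
      from line_pieces_at_crossing[OF S v1 _ _ i this] v j that i show False by auto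
    qed
    have "\<sigma>0 * (-1) ^ j = \<sigma> \<or> \<sigma>0 * (-1) ^ (j - 1) = \<sigma>"
      using \<sigma>(1,2) j by (cases "even j") auto
    then consider "\<sigma>0 * (-1) ^ j = \<sigma>" "j = n" | "\<sigma>0 * (-1) ^ (j - 1) = \<sigma>" "j = 1"
      using nope[of j] nope[of "j - 1"] j by fastforce
    then show "v \<in> (\<lambda>i. w (if i = 0 then 1 else n)) ` ?T"
    proof cases
      case 1
      then show ?thesis using vw n_pos by (intro image_eqI[of _ _ n]) auto
    next
      case 2
      then show ?thesis using vw by (intro image_eqI[of _ _ 0]) auto
    qed
  qed
  then have "card ?W \<le> card ((\<lambda>i. w (if i = 0 then 1 else n)) ` ?T)"
    by (intro card_mono) auto
  also have "\<dots> \<le> card ?T"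
    by (intro card_image_le) auto
  finally show ?thesis
    using card_cyclic_pairs[of ?B] by fastforce
qed

lemma card_sides_le:
  assumes S: "connected S" "open S" "S \<subseteq> half_plane \<sigma>" "S \<inter> path_image \<gamma> = {}"
    and \<sigma>: "\<sigma> \<in> {1, -1}" "\<sigma>0 \<in> {1, -1}" "\<And>i. i \<le> n \<Longrightarrow> arc_piece i \<subseteq> half_plane (\<sigma>0 * (-1) ^ i)"
  shows "card (sides \<gamma> (Some ` S)) \<le>
      card {i. i \<le> n \<and> \<sigma>0 * (-1) ^ i = \<sigma>} + card {i. i < n \<and> line_piece i \<subseteq> closure S}"
  unfolding card_sides_eq
proof (rule add_mono)
  have "\<sigma>0 * (-1) ^ i = \<sigma>" if i: "i \<le> n" "arc_piece i \<subseteq> closure S" for i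
  proof -
    obtain z where z: "z \<in> arc_piece i" using arc_piece_nonempty[OF i(1)] by auto
    then have "0 < \<sigma>0 * (-1) ^ i * Im z" using \<sigma>(3)[OF i(1)] by (auto simp: half_plane_def)
    moreover have "0 \<le> \<sigma> * Im z" using closure_subset_closed_half_plane[OF S(3)] i z by auto
    ultimately show ?thesis using \<sigma>(1,2) by (cases "even i") auto
  qed
  then show "card {i. i \<le> n \<and> edge (Inl i) \<subseteq> sphere_top frontier_of Some ` S}
      \<le> card {i. i \<le> n \<and> \<sigma>0 * (-1) ^ i = \<sigma>}"
    using edge_subset_frontier_imp(1)[OF S(2)] by (intro card_mono) auto
  show "card {i. i < n \<and> edge (Inr i) \<subseteq> sphere_top frontier_of Some ` S}
      \<le> card {i. i < n \<and> line_piece i \<subseteq> closure S}"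
    using edge_subset_frontier_imp(2)[OF S(2)] by (intro card_mono) auto
qed

text \<open>The side \<sigma>0 of the first tail has \<open>n div 2 + 1\<close> arc pieces, the
  other side \<open>(n + 1) div 2\<close>. For even \<open>n\<close> both tails are on the side
  \<sigma>0, for odd \<open>n\<close> there is one on each side. Together with the bound on line
  pieces this gives \<open>n + 2\<close> on the side \<sigma>0 and \<open>n\<close> on the other
  side for even \<open>n\<close>, and \<open>n + 1\<close> on both sides for odd \<open>n\<close>.
  The third claim leaves the line pieces uncounted, so that two regions can share them.\<close>

lemma card_sides_le_sign:
  assumes S: "connected S" "open S" "S \<subseteq> half_plane \<sigma>" "S \<inter> path_image \<gamma> = {}"
    and \<sigma>: "\<sigma> \<in> {1, -1}" "\<sigma>0 \<in> {1, -1}" "\<And>i. i \<le> n \<Longrightarrow> arc_piece i \<subseteq> half_plane (\<sigma>0 * (-1) ^ i)"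
  shows "card (sides \<gamma> (Some ` S)) \<le> n + 2"
    and "odd n \<or> \<sigma> \<noteq> \<sigma>0 \<Longrightarrow> card (sides \<gamma> (Some ` S)) \<le> n + 1"
    and "\<sigma> = \<sigma>0 \<Longrightarrow> card (sides \<gamma> (Some ` S)) \<le> n div 2 + 1 + card {i. i < n \<and> line_piece i \<subseteq> closure S}"
proof -
  let ?P = "{i. i \<le> n \<and> \<sigma>0 * (-1) ^ i = \<sigma>}"
  let ?T = "{i \<in> {0, n}. \<sigma>0 * (-1) ^ i = \<sigma>}"
  note le = card_sides_le[OF assms] card_line_pieces[OF S(1,3,4) \<sigma>]
  have P: "?P = (if \<sigma> = \<sigma>0 then {i. i \<le> n \<and> even i} else {i. i \<le> n \<and> odd i})"
    using \<sigma>(1,2) by (auto simp: minus_one_power_iff split: if_splits)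
  have T: "?T = (if \<sigma> = \<sigma>0 then if even n then {0, n} else {0} else if even n then {} else {n})"
    using \<sigma>(1,2) by (auto simp: minus_one_power_iff intro: gr0I split: if_splits)
  have c: "card ?P = (if \<sigma> = \<sigma>0 then n div 2 + 1 else (n + 1) div 2)"
    unfolding P using card_even_atMost[of n] card_odd_atMost[of n] by simp
  have d: "card ?T = (if \<sigma> = \<sigma>0 then if even n then 2 else 1 else if even n then 0 else 1)"
    unfolding T using n_pos by simp
  note le = le[unfolded c d]
  show "card (sides \<gamma> (Some ` S)) \<le> n + 2"
    using le by (cases "even n"; cases "\<sigma> = \<sigma>0") (auto elim!: evenE oddE)
  show "card (sides \<gamma> (Some ` S)) \<le> n + 1" if "odd n \<or> \<sigma> \<noteq> \<sigma>0"
    using le that by (cases "even n"; cases "\<sigma> = \<sigma>0") (auto elim!: evenE oddE)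
  show "card (sides \<gamma> (Some ` S)) \<le> n div 2 + 1 + card {i. i < n \<and> line_piece i \<subseteq> closure S}"
    if "\<sigma> = \<sigma>0"
    using le that by simp
qed

lemma card_sides_region_le:
  assumes m: "singly_anchored_open_meander \<gamma>" and R: "R \<in> regions \<gamma>"
  shows "card (sides \<gamma> R) \<le> n + 2"
proof -
  obtain \<sigma>0 where \<sigma>0: "\<sigma>0 \<in> {1, -1}" "\<And>i. i \<le> n \<Longrightarrow> arc_piece i \<subseteq> half_plane (\<sigma>0 * (-1) ^ i)"
    using arc_piece_half_plane[OF m] by blast
  obtain S \<sigma> where S: "R = Some ` S" "connected S" "open S" "\<sigma> \<in> {1, -1}" "S \<subseteq> half_plane \<sigma>"
    "S \<inter> path_image \<gamma> = {}"
    using region_cases[OF arc_\<gamma> R] by metis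
  show ?thesis
    using card_sides_le_sign(1)[OF S(2,3,5,6,4) \<sigma>0] S(1) by simp
qed

text \<open>Two exceptions would both lie on the side \<sigma>0 with \<open>n\<close> even. Each has
  at most \<open>n div 2 + 1\<close> arc sides, and they divide the \<open>n\<close> line edges
  among themselves, which leaves at most \<open>2 * n + 2\<close> sides in total instead of
  \<open>2 * n + 4\<close>.\<close>

lemma card_sides_two_regions_le:
  assumes m: "singly_anchored_open_meander \<gamma>"
    and R: "R1 \<in> regions \<gamma>" "R2 \<in> regions \<gamma>" "R1 \<noteq> R2"
  shows "card (sides \<gamma> R1) \<le> n + 1 \<or> card (sides \<gamma> R2) \<le> n + 1"
proof (rule ccontr)
  assume contr: "\<not> ?thesis"
  obtain \<sigma>0 where \<sigma>0: "\<sigma>0 \<in> {1, -1}" "\<And>i. i \<le> n \<Longrightarrow> arc_piece i \<subseteq> half_plane (\<sigma>0 * (-1) ^ i)"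
    using arc_piece_half_plane[OF m] by blast
  obtain S1 \<sigma>1 where S1: "R1 = Some ` S1" "connected S1" "open S1" "\<sigma>1 \<in> {1, -1}" "S1 \<subseteq> half_plane \<sigma>1"
    "S1 \<inter> path_image \<gamma> = {}" "S1 \<noteq> {}"
    and max1: "\<And>T. connected T \<Longrightarrow> T \<subseteq> half_plane \<sigma>1 \<Longrightarrow> T \<inter> path_image \<gamma> = {} \<Longrightarrow> T \<inter> S1 \<noteq> {} \<Longrightarrow> T \<subseteq> S1"
    using region_cases[OF arc_\<gamma> R(1)] by (metis (no_types, lifting))
  obtain S2 \<sigma>2 where S2: "R2 = Some ` S2" "connected S2" "open S2" "\<sigma>2 \<in> {1, -1}" "S2 \<subseteq> half_plane \<sigma>2"
    "S2 \<inter> path_image \<gamma> = {}" "S2 \<noteq> {}"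
    and max2: "\<And>T. connected T \<Longrightarrow> T \<subseteq> half_plane \<sigma>2 \<Longrightarrow> T \<inter> path_image \<gamma> = {} \<Longrightarrow> T \<inter> S2 \<noteq> {} \<Longrightarrow> T \<subseteq> S2"
    using region_cases[OF arc_\<gamma> R(2)] by (metis (no_types, lifting))
  let ?B = "\<lambda>S. {i. i < n \<and> line_piece i \<subseteq> closure S}"
  note le1 = card_sides_le_sign[OF S1(2,3,5,6,4) \<sigma>0]
  note le2 = card_sides_le_sign[OF S2(2,3,5,6,4) \<sigma>0]
  have ev: "even n" "\<sigma>1 = \<sigma>0" "\<sigma>2 = \<sigma>0"
    using le1(2) le2(2) contr S1(1) S2(1) by auto
  have "?B S1 \<inter> ?B S2 = {}"
  proof (rule ccontr)
    assume "?B S1 \<inter> ?B S2 \<noteq> {}"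
    then obtain i where i: "i < n" "line_piece i \<subseteq> closure S1" "line_piece i \<subseteq> closure S2"
      by blast
    obtain z where z: "z \<in> line_piece i" using line_piece_nonempty[OF i(1)] by auto
    then have "z \<in> - path_image \<gamma>" using line_piece_disjoint_path[OF i(1)] by auto
    then obtain \<epsilon> where \<epsilon>: "0 < \<epsilon>" "ball z \<epsilon> \<subseteq> - path_image \<gamma>"
      using closed_arc_image[OF arc_\<gamma>] by (metis open_Compl open_contains_ball_eq)
    \<comment> \<open>This half disc at a point of the line piece is connected and misses the arc,
      so a region that meets it contains it. Two regions with this line piece in their closures
      therefore coincide.\<close>
    let ?T = "ball z \<epsilon> \<inter> half_plane \<sigma>0"
    have T: "connected ?T" "?T \<inter> path_image \<gamma> = {}"
      using \<epsilon>(2) by (auto intro: convex_connected convex_Int convex_half_plane)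
    have "z \<in> closure S1" "z \<in> closure S2" using z i by auto
    then obtain s1 s2 where s: "s1 \<in> S1" "s1 \<in> ball z \<epsilon>" "s2 \<in> S2" "s2 \<in> ball z \<epsilon>"
      using \<epsilon>(1) by (metis closure_approachable dist_commute mem_ball)
    have "?T \<subseteq> S1"
      using max1[OF T(1)] T(2) ev s(1,2) S1(5) by blast
    moreover have "?T \<subseteq> S2"
      using max2[OF T(1)] T(2) ev s(3,4) S2(5) by blast
    moreover have "s1 \<in> ?T" using s S1(5) ev by auto
    ultimately have "S1 \<inter> S2 \<noteq> {}" by blast
    then have "S1 \<subseteq> S2" "S2 \<subseteq> S1"
      using max1[OF S2(2)] max2[OF S1(2)] S1 S2 ev by blast+
    then show False using R(3) S1(1) S2(1) by simp
  qed
  then have "card (?B S1) + card (?B S2) = card (?B S1 \<union> ?B S2)"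
    by (subst card_Un_disjoint) auto
  also have "\<dots> \<le> card {..<n}"
    by (intro card_mono) auto
  finally have "card (?B S1) + card (?B S2) \<le> n" by simp
  then show False
    using le1(3) le2(3) ev contr S1(1) S2(1) by (auto elim!: evenE)
qed

end

section \<open>The lower bound\<close>

text \<open>Excludes meanders without crossings, to which no frame applies. The half plane without
  the arc is a region whose only possible side is the whole line, whereas an order of at least -1
  requires two sides.\<close>

lemma ex_region_card_sides_le_1:
  assumes m: "singly_anchored_open_meander \<gamma>" and cr: "crossings \<gamma> = {}"
  shows "\<exists>R\<in>regions \<gamma>. card (sides \<gamma> R) \<le> 1"
proof -
  have arc: "arc \<gamma>" using m by (simp add: singly_anchored_open_meander_def)
  have "path_image \<gamma> \<inter> horizontal_line = {}" using cr by (simp add: crossings_def)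
  then obtain \<sigma> where \<sigma>: "\<sigma> \<in> {1, -1}" "path_image \<gamma> \<subseteq> half_plane \<sigma>"
    using connected_subset_half_plane[of "path_image \<gamma>"] arc path_image_nonempty
    by (metis arc_imp_path connected_path_image)
  let ?H = "half_plane (- \<sigma>)"
  have H: "?H \<noteq> {}" using unbounded_half_plane[of "- \<sigma>"] \<sigma>(1) by auto
  have dis: "half_plane \<sigma> \<inter> ?H = {}" by (auto simp: half_plane_def)
  let ?X = "subtopology sphere_top (- meander_graph \<gamma>)"
  have "Some ` ?H \<subseteq> - meander_graph \<gamma>"
    using \<sigma>(2) dis by (auto simp: meander_graph_def half_plane_def horizontal_line_def)
  then have "connectedin ?X (Some ` ?H)"
    by (simp add: connectedin_subtopology convex_connected convex_half_plane)
  moreover from this H have "?X \<noteq> trivial_topology"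
    by (metis connectedin_subset_topspace image_is_empty subset_empty topspace_discrete_topology)
  ultimately obtain R where R: "R \<in> regions \<gamma>" "Some ` ?H \<subseteq> R"
    unfolding regions_def using exists_connected_component_of_superset by metis
  obtain S \<tau> where S: "R = Some ` S" "\<tau> \<in> {1, -1}" "S \<subseteq> half_plane \<tau>"
    using region_cases[OF arc R(1)] by metis
  have "?H \<subseteq> half_plane \<tau>" using R(2) S by auto
  then have "\<tau> = - \<sigma>" using H S(2) \<sigma>(1) by (auto simp: half_plane_def)
  then have R_eq: "R = Some ` ?H" using S R(2) by auto
  let ?L = "insert None (Some ` horizontal_line)"
  have "horizontal_line = range complex_of_real"
    by (auto simp: horizontal_line_def complex_eq_iff image_iff)
  moreover have "connected (range complex_of_real)"
    by (intro connected_continuous_image continuous_intros) auto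
  moreover have "\<not> bounded (range complex_of_real)"
    using unbounded_of_real_rays(1)[of 0] by (meson bounded_subset image_mono subset_UNIV)
  ultimately have Lc: "connectedin sphere_top ?L"
    by (intro connectedin_sphere_insert_None) auto
  have L_sub: "?L \<subseteq> meander_graph \<gamma> - vertices \<gamma>"
    using m cr by (auto simp: meander_graph_def vertices_def anchors_def singly_anchored_open_meander_def)
  have "e = ?L" if e: "e \<in> sides \<gamma> R" for e
  proof
    have e1: "e \<in> connected_components_of (subtopology sphere_top (meander_graph \<gamma> - vertices \<gamma>))"
      using e by (simp add: sides_def edges_def)
    then have e2: "e \<subseteq> meander_graph \<gamma>" "e \<noteq> {}"
      using connected_components_of_subset nonempty_connected_components_of by fastforce+
    have "e \<subseteq> sphere_top closure_of (Some ` ?H)"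
      using e R_eq open_image_Some_frontier_eq[OF open_half_plane] by (auto simp: sides_def)
    moreover have "z \<notin> path_image \<gamma>" if "Some z \<in> sphere_top closure_of (Some ` ?H)" for z
    proof -
      have "0 \<le> - \<sigma> * Im z"
        using that closure_subset_closed_half_plane[of ?H "- \<sigma>" z] by (simp add: Some_in_sphere_closure_of_iff)
      then show ?thesis using \<sigma>(2) by (auto simp: half_plane_def)
    qed
    ultimately show sub: "e \<subseteq> ?L"
      using e2(1) unfolding meander_graph_def by blast
    show "?L \<subseteq> e"
      using sub e2(2) L_sub Lc
      by (intro connected_components_of_maximal[OF e1]) (auto simp: connectedin_subtopology disjnt_def)
  qed
  then have "sides \<gamma> R \<subseteq> {?L}" by blast
  then have "card (sides \<gamma> R) \<le> 1"
    using card_mono[of "{?L}"] by fastforce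
  then show ?thesis using R(1) by blast
qed

lemma crossings_lower_bound:
  fixes k1 k2 :: int
  assumes k: "k1 \<ge> k2" "k2 \<ge> -1"
    and m: "singly_anchored_open_meander \<gamma>"
    and str: "in_stratum \<gamma> ({#k1, k2#} + replicate_mset r (-1))"
  shows "int (card (crossings \<gamma>)) \<ge> max (2 * k1 + 2) (2 * k2 + 3)"
proof -
  obtain ord q where fin: "finite (regions \<gamma>)"
    and ord: "is_order_function \<gamma> ord"
    and eq: "image_mset ord (mset_set (regions \<gamma>)) + {#-1, -1#} =
      {#k1, k2#} + replicate_mset r (-1) + replicate_mset q 0"
    using str by (auto simp: in_stratum_def)
  have cs: "int (card (sides \<gamma> R)) = 2 * ord R + 4" if "R \<in> regions \<gamma>" for R
    using ord that by (auto simp: is_order_function_def)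
  have ge: "- 1 \<le> ord R" if "R \<in> regions \<gamma>" for R
  proof -
    have "ord R \<in># image_mset ord (mset_set (regions \<gamma>)) + {#-1, -1#}" using that fin by simp
    then have "ord R \<in> {k1, k2, -1, 0}" unfolding eq by (auto split: if_splits)
    then show ?thesis using k by auto
  qed
  have ne: "crossings \<gamma> \<noteq> {}"
  proof
    assume "crossings \<gamma> = {}"
    then obtain R where "R \<in> regions \<gamma>" "card (sides \<gamma> R) \<le> 1"
      using ex_region_card_sides_le_1[OF m] by blast
    then show False using cs[of R] ge[of R] by linarith
  qed
  obtain n t x where fr: "meander_frame \<gamma> n t x" and n: "n = card (crossings \<gamma>)"
    using ex_meander_frame[OF m ne] by blast
  interpret meander_frame \<gamma> n t x by (rule fr)
  \<comment> \<open>An entry -1 may stem from an anchor, so only a nonnegative order is sure to be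
    realised by a region; for \<open>k1 = -1\<close> the bound follows from
    \<open>0 < n\<close>.\<close>
  have b1: "2 * k1 + 2 \<le> int n"
  proof (cases "0 \<le> k1")
    case True
    have "k1 \<in># {#k1, k2#} + replicate_mset r (-1) + replicate_mset q 0" by simp
    then have "k1 \<in># image_mset ord (mset_set (regions \<gamma>)) + {#-1, -1#}" unfolding eq .
    then obtain R where "R \<in> regions \<gamma>" "ord R = k1" using True fin by auto
    then show ?thesis using cs[of R] card_sides_region_le[OF m, of R] by linarith
  next
    case False
    then show ?thesis using n_pos by linarith
  qed
  have b2: "2 * k2 + 3 \<le> int n"
  proof (cases "0 \<le> k2")
    case True
    let ?M = "image_mset ord (mset_set (regions \<gamma>))"
    have "{#k1, k2#} \<subseteq># ?M + {#-1, -1#}" unfolding eq by simp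
    then have "{#k1, k2#} \<subseteq># ?M"
      using True k by (auto simp: subseteq_mset_def split: if_splits)
    \<comment> \<open>Taking the two orders out of the multiset one after the other yields different
      regions even if \<open>k1 = k2\<close>, because \<open>mset_set\<close> has no multiplicity
      above one.\<close>
    then obtain N where N: "?M = add_mset k1 (add_mset k2 N)"
      by (metis add_mset_add_single mset_subset_eq_exists_conv union_mset_add_mset_left add.left_neutral)
    then obtain R1 M1 where R1: "mset_set (regions \<gamma>) = add_mset R1 M1" "ord R1 = k1"
      "image_mset ord M1 = add_mset k2 N"
      by (metis msed_map_invR)
    then obtain R2 M2 where R2: "M1 = add_mset R2 M2" "ord R2 = k2"
      by (metis msed_map_invR)
    have eqm: "mset_set (regions \<gamma>) = add_mset R1 (add_mset R2 M2)" using R1 R2 by simp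
    then have "R1 \<in># mset_set (regions \<gamma>)" "R2 \<in># mset_set (regions \<gamma>)"
      by simp_all
    then have "R1 \<in> regions \<gamma>" "R2 \<in> regions \<gamma>"
      using fin by simp_all
    moreover have "R1 \<noteq> R2"
    proof
      assume "R1 = R2"
      then have "count (mset_set (regions \<gamma>)) R1 \<ge> 2" using eqm by simp
      then show False using count_mset_set'[of "regions \<gamma>" R1] by (auto split: if_splits)
    qed
    \<comment> \<open>Both orders are at least \<open>k2\<close>, so whichever region has at most
      \<open>n + 1\<close> sides gives \<open>2 * k2 + 4 \<le> n + 1\<close>.\<close>
    ultimately show ?thesis
      using card_sides_two_regions_le[OF m, of R1 R2] cs[of R1] cs[of R2] R1(2) R2(2) k by linarith
  next
    case False
    then have "k2 = -1" using k by simp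
    then show ?thesis using n_pos by linarith
  qed
  show ?thesis using b1 b2 n by simp
qed

subsection \<open>Meanders drawn with half diamonds\<close>

text \<open>The way in which points are put into the closure of a region below: they move into it
  along a fixed unit direction.\<close>

lemma closure_shiftI:
  fixes z v :: complex
  assumes "0 < e" "norm v = 1" "\<And>\<epsilon>. 0 < \<epsilon> \<Longrightarrow> \<epsilon> < e \<Longrightarrow> z + of_real \<epsilon> * v \<in> S"
  shows "z \<in> closure S"
  unfolding closure_approachable
proof (intro allI impI)
  fix d :: real assume "0 < d"
  define \<epsilon> where "\<epsilon> = min d e / 2"
  have "0 < \<epsilon>" "\<epsilon> < e" "\<epsilon> < d" using assms(1) \<open>0 < d\<close> by (auto simp: \<epsilon>_def min_def)
  moreover have "dist (z + of_real \<epsilon> * v) z = \<epsilon>"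
    using \<open>0 < \<epsilon>\<close> assms(2) by (simp add: dist_norm norm_mult)
  ultimately show "\<exists>y\<in>S. dist y z < d" using assms(3)[of \<epsilon>] by metis
qed

text \<open>The crossings sit at the integers from 1 to \<open>n\<close>; \<open>p i\<close> is the
  position of the \<open>i\<close>-th one along the arc.\<close>

locale diamond_meander =
  fixes n :: nat and p :: "nat \<Rightarrow> nat"
  assumes n_pos: "0 < n" and bij_p: "bij_betw p {1..n} {1..n}"
begin

definition sg :: "nat \<Rightarrow> real" where
  "sg i = (-1) ^ i"

definition cen :: "nat \<Rightarrow> real" where
  "cen i = (real (p i) + real (p (Suc i))) / 2"

definition rad :: "nat \<Rightarrow> real" where
  "rad i = \<bar>real (p (Suc i)) - real (p i)\<bar> / 2"

text \<open>The l1 distance from the centre of half diamond \<open>i\<close>.\<close>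

definition dia :: "nat \<Rightarrow> complex \<Rightarrow> real" where
  "dia i z = \<bar>Re z - cen i\<bar> + \<bar>Im z\<bar>"

definition inner_piece :: "nat \<Rightarrow> bool" where
  "inner_piece i \<longleftrightarrow> 1 \<le> i \<and> i < n"

text \<open>Index 0 comes down from an anchor at height 1 to the first crossing, and index
  \<open>n\<close> leaves the last crossing for the other anchor. On an inner piece the abscissa is
  linear in \<open>w\<close>, and the height is a tent over it.\<close>

definition piece :: "nat \<Rightarrow> real \<Rightarrow> complex" where
  "piece i w = Complex
     (if i = 0 then p 1 else if i = n then p n else p i + (real (p (Suc i)) - real (p i)) * w)
     (sg i * (if i = 0 then 1 - w else if i = n then w else 2 * rad i * min w (1 - w)))"

text \<open>The implicit form of piece \<open>i\<close> off the line, with the anchor included for a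
  tail.\<close>

definition piece_set :: "nat \<Rightarrow> complex set" where
  "piece_set i = {z. 0 < sg i * Im z \<and>
     (if i = 0 then Re z = p 1 \<and> \<bar>Im z\<bar> \<le> 1 else if i = n then Re z = p n \<and> \<bar>Im z\<bar> \<le> 1
      else dia i z = rad i)}"

text \<open>The \<open>min\<close> keeps \<open>s = 1\<close>, where the floor is
  \<open>n + 1\<close>, on the last piece.\<close>

definition curve :: "real \<Rightarrow> complex" where
  "curve s = (let u = real (Suc n) * s; i = min n (nat \<lfloor>u\<rfloor>) in piece i (u - real i))"

lemma sg_cases: "sg i = 1 \<or> sg i = -1"
  by (cases "even i") (auto simp: sg_def)

lemma sg_eq_iff: "sg i = sg j \<longleftrightarrow> (even i \<longleftrightarrow> even j)"
  by (auto simp: sg_def minus_one_power_iff)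

lemma sg_Suc: "sg (Suc i) = - sg i"
  by (simp add: sg_def)

lemma p_bounds: "1 \<le> i \<Longrightarrow> i \<le> n \<Longrightarrow> 1 \<le> p i \<and> p i \<le> n"
  using bij_betwE[OF bij_p] by auto

lemma p_eq_iff: "1 \<le> i \<Longrightarrow> i \<le> n \<Longrightarrow> 1 \<le> j \<Longrightarrow> j \<le> n \<Longrightarrow> p i = p j \<longleftrightarrow> i = j"
  using inj_on_eq_iff[OF bij_betw_imp_inj_on[OF bij_p], of i j] by simp

lemma rad_ge: "inner_piece i \<Longrightarrow> 1 / 2 \<le> rad i"
proof -
  assume "inner_piece i"
  then have "p i \<noteq> p (Suc i)" using p_eq_iff[of i "Suc i"] by (simp add: inner_piece_def)
  then consider "real (p i) + 1 \<le> real (p (Suc i))" | "real (p (Suc i)) + 1 \<le> real (p i)"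
    by linarith
  then show ?thesis by cases (auto simp: rad_def abs_if)
qed

lemma piece_0: "1 \<le> i \<Longrightarrow> i \<le> n \<Longrightarrow> piece i 0 = of_real (p i)"
  by (cases "i = n") (simp_all add: piece_def complex_eq_iff)

lemma piece_1: "i < n \<Longrightarrow> piece i 1 = of_real (p (Suc i))"
  by (cases "i = 0") (simp_all add: piece_def complex_eq_iff)

text \<open>Closed intervals allow the pieces to be glued continuously. At the right end the floor
  already selects the next piece, which begins at the crossing where this one ends.\<close>

lemma curve_eq:
  assumes "i \<le> n" "real i \<le> real (Suc n) * s" "real (Suc n) * s \<le> real (Suc i)"
  shows "curve s = piece i (real (Suc n) * s - real i)"
proof (cases "real (Suc n) * s = real (Suc i)")
  case True
  have fl: "nat \<lfloor>real (Suc i)\<rfloor> = Suc i" by linarith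
  have "curve s = piece (min n (Suc i)) (real (Suc i) - real (min n (Suc i)))"
    by (simp only: curve_def Let_def True fl)
  then show ?thesis
    unfolding True using assms(1) piece_0[of "Suc i"] piece_1[of i]
    by (cases "i = n") (simp_all add: min.absorb2)
next
  case False
  then have "\<lfloor>real (Suc n) * s\<rfloor> = int i"
    using assms by (intro floor_unique) auto
  then show ?thesis using assms(1) by (simp add: curve_def Let_def min_def)
qed

lemma piece_in_piece_set:
  assumes "i \<le> n" "0 \<le> w" "w \<le> 1" "w = 0 \<Longrightarrow> i = 0" "w = 1 \<Longrightarrow> i = n"
  shows "piece i w \<in> piece_set i"
proof -
  have sq: "sg i * sg i = 1" using sg_cases[of i] by auto
  consider "i = 0" | "i = n" "i \<noteq> 0" | "inner_piece i" using assms(1) by (force simp: inner_piece_def)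
  then show ?thesis
  proof cases
    case 1
    then have "w < 1" using assms n_pos by (cases "w = 1") auto
    then show ?thesis using 1 assms by (auto simp: piece_def piece_set_def sg_def)
  next
    case 2
    then have "0 < w" using assms by (cases "w = 0") auto
    then show ?thesis using 2 assms sg_cases[of n] n_pos by (auto simp: piece_def piece_set_def)
  next
    case 3
    then have i: "i \<noteq> 0" "i \<noteq> n" by (auto simp: inner_piece_def)
    then have w: "0 < w" "w < 1" using assms by (metis order_le_less)+
    have "Re (piece i w) - cen i = (real (p (Suc i)) - real (p i)) * (w - 1 / 2)"
      using i by (simp add: piece_def cen_def field_simps)
    then have "\<bar>Re (piece i w) - cen i\<bar> = 2 * rad i * \<bar>w - 1 / 2\<bar>"
      by (simp add: rad_def abs_mult)
    moreover have im: "sg i * Im (piece i w) = 2 * rad i * min w (1 - w)"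
      using i sq by (simp add: piece_def)
    moreover have pos: "0 < 2 * rad i * min w (1 - w)"
      using rad_ge[OF 3] w by (intro mult_pos_pos) auto
    moreover have "\<bar>Im (piece i w)\<bar> = sg i * Im (piece i w)"
      using im pos sg_cases[of i] by auto
    ultimately have "dia i (piece i w) = 2 * rad i * (\<bar>w - 1 / 2\<bar> + min w (1 - w))"
      by (simp add: dia_def distrib_left)
    also have "\<bar>w - 1 / 2\<bar> + min w (1 - w) = 1 / 2" by (auto simp: min_def)
    finally show ?thesis using i im pos by (simp add: piece_set_def)
  qed
qed

lemma piece_set_eq_piece:
  assumes "i \<le> n" "z \<in> piece_set i"
  obtains w where "0 \<le> w" "w \<le> 1" "z = piece i w"
proof -
  have z: "0 < sg i * Im z" using assms(2) by (simp add: piece_set_def)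
  consider "i = 0" | "i = n" "i \<noteq> 0" | "inner_piece i" using assms(1) by (force simp: inner_piece_def)
  then show ?thesis
  proof cases
    case 1
    then show ?thesis
      using assms(2) by (intro that[of "1 - Im z"]) (auto simp: piece_set_def piece_def sg_def complex_eq_iff)
  next
    case 2
    then show ?thesis
      using assms(2) sg_cases[of n]
      by (intro that[of "\<bar>Im z\<bar>"]) (auto simp: piece_set_def piece_def complex_eq_iff)
  next
    case 3
    then have i: "i \<noteq> 0" "i \<noteq> n" by (auto simp: inner_piece_def)
    let ?D = "real (p (Suc i)) - real (p i)"
    define w where "w = (Re z - p i) / ?D"
    have rp: "0 < rad i" using rad_ge[OF 3] by simp
    then have D: "?D \<noteq> 0" by (auto simp: rad_def)
    then have re: "Re z = p i + ?D * w" by (simp add: w_def)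
    have dz: "\<bar>Re z - cen i\<bar> + \<bar>Im z\<bar> = rad i"
      using assms(2) i by (simp add: piece_set_def dia_def)
    have "Re z - cen i = ?D * (w - 1 / 2)" using re by (simp add: cen_def field_simps)
    then have ab: "\<bar>Re z - cen i\<bar> = 2 * rad i * \<bar>w - 1 / 2\<bar>" by (simp add: rad_def abs_mult)
    then have "rad i * (2 * \<bar>w - 1 / 2\<bar>) \<le> rad i * 1" using dz by simp
    then have "2 * \<bar>w - 1 / 2\<bar> \<le> 1" using rp by (simp only: mult_le_cancel_left_pos)
    then have "\<bar>w - 1 / 2\<bar> \<le> 1 / 2" by simp
    then have "0 \<le> w \<and> w \<le> 1" unfolding abs_le_iff by simp
    then have w: "0 \<le> w" "w \<le> 1" by auto
    have mw: "min w (1 - w) = 1 / 2 - \<bar>w - 1 / 2\<bar>" by (auto simp: min_def)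
    have "sg i * Im z = \<bar>Im z\<bar>" using z sg_cases[of i] by auto
    also have "\<dots> = 2 * rad i * min w (1 - w)"
      unfolding mw using dz ab by (simp add: right_diff_distrib)
    finally have "Im z = sg i * (2 * rad i * min w (1 - w))"
      using sg_cases[of i] by auto
    then have "z = piece i w" using re i by (simp add: piece_def complex_eq_iff)
    then show ?thesis using w that by blast
  qed
qed

lemma piece_inj:
  assumes "i \<le> n" "piece i w = piece i w'"
  shows "w = w'"
proof -
  consider "i = 0" | "i = n" "i \<noteq> 0" | "inner_piece i" using assms(1) by (force simp: inner_piece_def)
  then show ?thesis
  proof cases
    case 1
    then show ?thesis using assms(2) by (simp add: piece_def sg_def)
  next
    case 2
    then have "sg i * w = sg i * w'" using assms(2) by (simp add: piece_def)
    then show ?thesis using sg_cases[of i] by auto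
  next
    case 3
    then have i: "i \<noteq> 0" "i \<noteq> n" by (auto simp: inner_piece_def)
    have "real (p (Suc i)) - real (p i) \<noteq> 0" using rad_ge[OF 3] by (auto simp: rad_def)
    moreover have "(real (p (Suc i)) - real (p i)) * w = (real (p (Suc i)) - real (p i)) * w'"
      using assms(2) i by (simp add: piece_def)
    ultimately show ?thesis by (metis mult_left_cancel)
  qed
qed

lemma continuous_on_piece: "continuous_on A (piece i)"
  unfolding piece_def Complex_eq
  by (cases "i = 0"; cases "i = n") (auto intro!: continuous_intros)

lemma continuous_on_curve: "continuous_on {0..1} curve"
proof -
  let ?I = "\<lambda>i. {real i / real (Suc n)..real (Suc i) / real (Suc n)}"
  have "continuous_on (?I i) curve" if "i \<le> n" for i
  proof -
    have c1: "continuous_on (?I i) (\<lambda>s. piece i (real (Suc n) * s - real i))"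
      by (intro continuous_on_compose2[OF continuous_on_piece[of UNIV i]] continuous_intros) auto
    have c2: "piece i (real (Suc n) * s - real i) = curve s" if "s \<in> ?I i" for s
      using that \<open>i \<le> n\<close> by (intro curve_eq[symmetric]) (auto simp: field_simps)
    show ?thesis by (rule continuous_on_eq[OF c1 c2])
  qed
  then have "continuous_on (\<Union>i\<in>{..n}. ?I i) curve"
    by (intro continuous_on_closed_Union) auto
  moreover have "{0..1} \<subseteq> (\<Union>i\<in>{..n}. ?I i)"
  proof
    fix s :: real assume s: "s \<in> {0..1}"
    let ?t = "\<lambda>i. real i / real (Suc n)"
    have "s \<in> ?t ` {..Suc n} \<or> (\<exists>i<Suc n. ?t i < s \<and> s < ?t (Suc i))"
      using s by (intro ex_grid_interval) auto
    then show "s \<in> (\<Union>i\<in>{..n}. ?I i)"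
    proof
      assume "s \<in> ?t ` {..Suc n}"
      then obtain i where "i \<le> Suc n" "s = ?t i" by auto
      then show ?thesis
        by (intro UN_I[of "min i n"]) (auto simp: min_def divide_right_mono)
    next
      assume "\<exists>i<Suc n. ?t i < s \<and> s < ?t (Suc i)"
      then obtain i where "i < Suc n" "?t i < s" "s < ?t (Suc i)" by blast
      then show ?thesis by (intro UN_I[of i]) auto
    qed
  qed
  ultimately show ?thesis by (rule continuous_on_subset)
qed

lemma curve_cases:
  assumes "0 \<le> s" "s \<le> 1"
  obtains (crossing) i where "1 \<le> i" "i \<le> n" "real (Suc n) * s = real i" "curve s = of_real (p i)"
  | (piece) i where "i \<le> n" "curve s = piece i (real (Suc n) * s - real i)" "curve s \<in> piece_set i"
      "real i \<le> real (Suc n) * s" "real (Suc n) * s \<le> real (Suc i)"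
proof -
  let ?u = "real (Suc n) * s"
  have u: "0 \<le> ?u" "?u \<le> real (Suc n)" using assms mult_left_le[of s "real (Suc n)"] by auto
  have use_piece: thesis if "i \<le> n" "real i \<le> ?u" "?u \<le> real (Suc i)" "?u = real i \<Longrightarrow> i = 0" "?u = real (Suc i) \<Longrightarrow> i = n" for i
  proof -
    have "curve s = piece i (?u - real i)" using that by (intro curve_eq)
    moreover from this have "curve s \<in> piece_set i" using that by (auto intro!: piece_in_piece_set)
    ultimately show ?thesis using that piece by blast
  qed
  have "?u \<in> real ` {..Suc n} \<or> (\<exists>i<Suc n. real i < ?u \<and> ?u < real (Suc i))"
    using u by (intro ex_grid_interval) auto
  then show ?thesis
  proof
    assume "?u \<in> real ` {..Suc n}"
    then obtain i where i: "i \<le> Suc n" "?u = real i" by auto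
    consider "i = 0" | "i = Suc n" | "1 \<le> i" "i \<le> n" using i by linarith
    then show ?thesis
    proof cases
      case 1
      then show ?thesis using i by (intro use_piece[of 0]) auto
    next
      case 2
      then show ?thesis using i by (intro use_piece[of n]) auto
    next
      case 3
      then have "curve s = piece i (?u - real i)" using i by (intro curve_eq) auto
      then show ?thesis using 3 i piece_0[of i] crossing by simp
    qed
  next
    assume "\<exists>i<Suc n. real i < ?u \<and> ?u < real (Suc i)"
    then obtain i where "i < Suc n" "real i < ?u" "?u < real (Suc i)" by blast
    then show ?thesis by (intro use_piece[of i]) auto
  qed
qed

lemma piece_set_Im: "z \<in> piece_set i \<Longrightarrow> Im z \<noteq> 0"
  by (auto simp: piece_set_def)

lemma path_image_curve: "path_image curve = complex_of_real ` real ` {1..n} \<union> (\<Union>i\<le>n. piece_set i)"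
proof
  show "path_image curve \<subseteq> complex_of_real ` real ` {1..n} \<union> (\<Union>i\<le>n. piece_set i)"
  proof
    fix z assume "z \<in> path_image curve"
    then obtain s where s: "0 \<le> s" "s \<le> 1" "z = curve s" by (auto simp: path_image_def)
    show "z \<in> complex_of_real ` real ` {1..n} \<union> (\<Union>i\<le>n. piece_set i)"
      using s(1,2)
    proof (cases rule: curve_cases)
      case (crossing i)
      then have "real (p i) \<in> real ` {1..n}" "z = complex_of_real (real (p i))"
        using s p_bounds[of i] by auto
      then show ?thesis by blast
    next
      case (piece i)
      then show ?thesis using s by auto
    qed
  qed
  have "complex_of_real (real j) \<in> path_image curve" if j: "j \<in> {1..n}" for j
  proof -
    have "j \<in> p ` {1..n}" using j bij_p by (simp add: bij_betw_def)
    then obtain i where i: "1 \<le> i" "i \<le> n" "j = p i" by auto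
    have "curve (real i / real (Suc n)) = piece i 0"
      using i curve_eq[of i "real i / real (Suc n)"] by simp
    then show ?thesis
      using i piece_0[of i] by (auto simp: path_image_def intro!: image_eqI[of _ _ "real i / real (Suc n)"])
  qed
  moreover have "z \<in> path_image curve" if z: "i \<le> n" "z \<in> piece_set i" for i z
  proof -
    obtain w where w: "0 \<le> w" "w \<le> 1" "z = piece i w" using piece_set_eq_piece[OF z] by blast
    have "curve ((real i + w) / real (Suc n)) = piece i w"
      using w z curve_eq[of i "(real i + w) / real (Suc n)"] by simp
    then show ?thesis
      using w z by (auto simp: path_image_def field_simps intro!: image_eqI[of _ _ "(real i + w) / real (Suc n)"])
  qed
  ultimately show "complex_of_real ` real ` {1..n} \<union> (\<Union>i\<le>n. piece_set i) \<subseteq> path_image curve"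
    by auto
qed

end

text \<open>These conditions make the curve simple and every bounded region explicit: it is the band
  between two consecutive concentric half diamonds, or the interior of one of radius 1/2. The
  summand 1 in \<open>separated\<close> reflects the integer spacing of the feet. The last two
  conditions keep the tails out of all half diamonds, so that they border only the unbounded
  regions.\<close>

locale noncrossing_diamond_meander = diamond_meander +
  assumes nested: "\<And>i. inner_piece i \<Longrightarrow> rad i \<noteq> 1 / 2 \<Longrightarrow>
      \<exists>j. inner_piece j \<and> sg j = sg i \<and> cen j = cen i \<and> rad j = rad i - 1"
    and separated: "\<And>i j. inner_piece i \<Longrightarrow> inner_piece j \<Longrightarrow> i \<noteq> j \<Longrightarrow> sg i = sg j \<Longrightarrow>
      cen i = cen j \<and> 1 \<le> \<bar>rad i - rad j\<bar> \<or> rad i + rad j + 1 \<le> \<bar>cen i - cen j\<bar>"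
    and first_outside: "\<And>i. inner_piece i \<Longrightarrow> sg i = sg 0 \<Longrightarrow> rad i < \<bar>real (p 1) - cen i\<bar>"
    and last_outside: "\<And>i. inner_piece i \<Longrightarrow> sg i = sg n \<Longrightarrow> rad i < \<bar>real (p n) - cen i\<bar>"
begin

lemma dia_separated:
  assumes "rad i + rad j + 1 \<le> \<bar>cen i - cen j\<bar>" "dia i z \<le> rad i"
  shows "rad j < dia j z"
proof -
  have "\<bar>cen i - cen j\<bar> \<le> \<bar>Re z - cen i\<bar> + \<bar>Re z - cen j\<bar>" by linarith
  then show ?thesis using assms unfolding dia_def by linarith
qed

lemma piece_set_disjoint:
  assumes "i < j" "j \<le> n"
  shows "piece_set i \<inter> piece_set j = {}"
proof (rule ccontr)
  assume "piece_set i \<inter> piece_set j \<noteq> {}"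
  then obtain z where z: "z \<in> piece_set i" "z \<in> piece_set j" by blast
  have "0 < sg i * Im z" "0 < sg j * Im z" using z by (auto simp: piece_set_def)
  then have sg: "sg i = sg j" using sg_cases[of i] sg_cases[of j] by auto
  consider "i = 0" "j = n" | "i = 0" "inner_piece j" | "inner_piece i" "j = n" | "inner_piece i" "inner_piece j"
    using assms by (force simp: inner_piece_def)
  then show False
  proof cases
    case 1
    \<comment> \<open>Both tails are on one side only for even \<open>n\<close>; then there are at
      least two crossings, and the tails stand on different ones.\<close>
    then have "even n" "n \<noteq> 1" using sg by (auto simp: sg_eq_iff)
    moreover have "p 1 = p n" using z 1 assms by (auto simp: piece_set_def)
    ultimately show False using p_eq_iff[of 1 n] n_pos by simp
  next
    case 2
    then have "Re z = p 1" "dia j z = rad j" using z by (auto simp: piece_set_def inner_piece_def)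
    then show False using first_outside[of j] 2 sg by (auto simp: dia_def)
  next
    case 3
    then have "Re z = p n" "dia i z = rad i" using z by (auto simp: piece_set_def inner_piece_def)
    then show False using last_outside[of i] 3 sg by (auto simp: dia_def)
  next
    case 4
    then have "dia i z = rad i" "dia j z = rad j" using z by (auto simp: piece_set_def inner_piece_def)
    moreover have "dia i z = dia j z" if "cen i = cen j" using that by (simp add: dia_def)
    ultimately show False
      using separated[OF 4 _ sg] assms(1) dia_separated[of i j z] by fastforce
  qed
qed

lemma inj_on_curve: "inj_on curve {0..1}"
proof (rule inj_onI)
  fix s s' assume ss: "s \<in> {0..1::real}" "s' \<in> {0..1::real}" and eq: "curve s = curve s'"
  have s: "0 \<le> s" "s \<le> 1" and s': "0 \<le> s'" "s' \<le> 1" using ss by auto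
  have "real (Suc n) * s = real (Suc n) * s'"
    using s
  proof (cases rule: curve_cases)
    case i: (crossing i)
    show ?thesis
      using s'
    proof (cases rule: curve_cases)
      case (crossing j)
      then have "p i = p j" using i(4) eq by simp
      then show ?thesis using i crossing p_eq_iff[of i j] by simp
    next
      case (piece j)
      then show ?thesis using i(4) eq piece_set_Im[of "curve s'" j] by (metis Im_complex_of_real)
    qed
  next
    case i: (piece i)
    show ?thesis
      using s'
    proof (cases rule: curve_cases)
      case (crossing j)
      then show ?thesis using i(3) eq piece_set_Im[of "curve s" i] by (metis Im_complex_of_real)
    next
      case (piece j)
      then have "\<not> i < j" "\<not> j < i"
        using piece_set_disjoint[of i j] piece_set_disjoint[of j i] i eq by auto
      then have "i = j" by simp
      then show ?thesis using i(1,2) piece(2) eq piece_inj[of i] by fastforce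
    qed
  qed
  then show "s = s'" by simp
qed

lemma arc_curve: "arc curve"
  by (simp add: arc_def path_def continuous_on_curve inj_on_curve)

lemma crossings_curve: "crossings curve = complex_of_real ` real ` {1..n}"
  using piece_set_Im by (auto simp: crossings_def path_image_curve horizontal_line_def)

definition grid :: "nat \<Rightarrow> real" where
  "grid i = real i / real (Suc n)"

lemma grid_less: "i < j \<Longrightarrow> grid i < grid j"
  by (simp add: grid_def divide_strict_right_mono)

lemma curve_crossing:
  assumes "1 \<le> i" "i \<le> n" shows "curve (grid i) = of_real (p i)"
  using curve_eq[of i "grid i"] piece_0[OF assms] assms by (simp add: grid_def)

lemma curve_between:
  assumes "i \<le> n" "grid i < s" "s < grid (Suc i)"
  shows "curve s \<in> piece_set i"
proof -
  have "real i < real (Suc n) * s" "real (Suc n) * s < real (Suc i)"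
    using assms by (auto simp: grid_def field_simps)
  then show ?thesis
    using assms(1) curve_eq[of i s] piece_in_piece_set[of i "real (Suc n) * s - real i"] by simp
qed

lemma Im_curve_eq_0_iff:
  assumes "0 \<le> s" "s \<le> 1"
  shows "Im (curve s) = 0 \<longleftrightarrow> s \<in> grid ` {1..n}"
proof -
  have "Im (curve s) = 0 \<Longrightarrow> s \<in> grid ` {1..n}"
    using assms
  proof (cases rule: curve_cases)
    case (crossing i)
    then have "s = grid i" by (simp add: grid_def field_simps)
    then show ?thesis using crossing by auto
  qed (use piece_set_Im in blast)
  then show ?thesis using curve_crossing by auto
qed

text \<open>The positions from left to right are 1 to \<open>n\<close>, so \<open>real\<close>
  itself enumerates them, and line piece \<open>i\<close> with \<open>i > 0\<close> is the open
  interval from \<open>i\<close> to \<open>i + 1\<close>.\<close>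

sublocale meander_frame curve n grid real
proof
  show "Im (curve u) = 0 \<longleftrightarrow> u \<in> grid ` {1..n}" if "0 \<le> u" "u \<le> 1" for u
    using Im_curve_eq_0_iff that .
qed (simp_all add: n_pos arc_curve crossings_curve grid_less grid_def[of 0] grid_def[of "Suc n"])

lemma arc_piece_subset: "i \<le> n \<Longrightarrow> arc_piece i \<subseteq> piece_set i"
  unfolding arc_piece_def using curve_between by auto

lemma meander_curve: "singly_anchored_open_meander curve"
  unfolding singly_anchored_open_meander_def
proof (intro conjI ballI impI)
  show "arc curve" by (rule arc_curve)
  have "curve 0 = piece 0 0" "curve 1 = piece n 1"
    using curve_eq[of 0 0] curve_eq[of n 1] by auto
  then show "pathstart curve \<notin> horizontal_line" "pathfinish curve \<notin> horizontal_line"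
    using piece_in_piece_set[of 0 0] piece_in_piece_set[of n 1] piece_set_Im
    by (auto simp: pathstart_def pathfinish_def horizontal_line_def)
  fix s :: real assume s: "s \<in> {0<..<1}" "curve s \<in> horizontal_line"
  then obtain i where i: "1 \<le> i" "i \<le> n" "s = grid i"
    using Im_curve_eq_0_iff[of s] by (auto simp: horizontal_line_def)
  have near: "grid (i - 1) < s" "s < grid (Suc i)"
    using i by (auto intro: grid_less)
  note eventually_at_left_real[OF near(1)] eventually_at_right_real[OF near(2)]
  moreover have "u \<in> {grid (i - 1)<..<s} \<Longrightarrow> 0 < sg (i - 1) * Im (curve u)" for u
    using curve_between[of "i - 1" u] i by (auto simp: piece_set_def)
  moreover have "u \<in> {s<..<grid (Suc i)} \<Longrightarrow> 0 < sg i * Im (curve u)" for u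
    using curve_between[of i u] i by (auto simp: piece_set_def)
  ultimately have "\<forall>\<^sub>F u in at_left s. 0 < sg (i - 1) * Im (curve u)" "\<forall>\<^sub>F u in at_right s. 0 < sg i * Im (curve u)"
    by (auto elim!: eventually_mono)
  moreover have "sg i = - sg (i - 1)" using sg_Suc[of "i - 1"] i by simp
  ultimately show "crosses_line_at curve s"
    using sg_cases[of "i - 1"] by (auto simp: crosses_line_at_def)
qed

section \<open>The complementary regions of the drawing\<close>

definition outer_region :: "real \<Rightarrow> complex set" where
  "outer_region \<sigma> = {z. 0 < \<sigma> * Im z \<and> (\<forall>j. inner_piece j \<and> sg j = \<sigma> \<longrightarrow> rad j < dia j z) \<and>
     (sg 0 = \<sigma> \<longrightarrow> Re z \<noteq> p 1 \<or> 1 < \<bar>Im z\<bar>) \<and> (sg n = \<sigma> \<longrightarrow> Re z \<noteq> p n \<or> 1 < \<bar>Im z\<bar>)}"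

text \<open>
  Inside the half diamond of index \<open>j\<close> there is at most the next concentric one, of radius
  \<open>rad j - 1\<close>; if \<open>rad j = 1 / 2\<close>, the lower bound on \<open>dia\<close> is void.
\<close>

definition inner_region :: "nat \<Rightarrow> complex set" where
  "inner_region j = {z. 0 < sg j * Im z \<and> rad j - 1 < dia j z \<and> dia j z < rad j}"

lemma continuous_on_dia [continuous_intros]: "continuous_on A (dia j)"
  unfolding dia_def by (intro continuous_intros)

lemma open_inner_region: "open (inner_region j)"
  unfolding inner_region_def
  by (intro open_Collect_conj open_Collect_less continuous_intros)

lemma open_outer_region: "open (outer_region \<sigma>)"
proof -
  have tail: "open {z. sg k = \<sigma> \<longrightarrow> Re z \<noteq> a \<or> 1 < \<bar>Im z\<bar>}" for k a
    by (intro open_Collect_imp open_Collect_disj open_Collect_neq open_Collect_less continuous_intros) auto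
  have "{z. \<forall>j. inner_piece j \<and> sg j = \<sigma> \<longrightarrow> rad j < dia j z} =
      (\<Inter>j\<in>{j. inner_piece j \<and> sg j = \<sigma>}. {z. rad j < dia j z})"
    by auto
  moreover have "finite {j. inner_piece j \<and> sg j = \<sigma>}"
    by (rule finite_subset[of _ "{..n}"]) (auto simp: inner_piece_def)
  ultimately have "open {z. \<forall>j. inner_piece j \<and> sg j = \<sigma> \<longrightarrow> rad j < dia j z}"
    by (auto intro!: open_INT open_Collect_less continuous_intros)
  then show ?thesis
    unfolding outer_region_def
    by (intro open_Collect_conj open_Collect_less continuous_intros tail)
qed

text \<open>The gain from l1 distances: the increment is the same for every centre, so one vertical
  shift settles the inequalities for all half diamonds at once.\<close>

lemma dia_up:
  assumes "\<sigma> \<in> {1, -1}" "0 \<le> \<sigma> * Im z" "0 \<le> \<epsilon>"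
  shows "dia j (z + of_real \<epsilon> * Complex 0 \<sigma>) = dia j z + \<epsilon>"
    "\<sigma> * Im (z + of_real \<epsilon> * Complex 0 \<sigma>) = \<sigma> * Im z + \<epsilon>"
    "\<bar>Im (z + of_real \<epsilon> * Complex 0 \<sigma>)\<bar> = \<bar>Im z\<bar> + \<epsilon>"
  using assms by (auto simp: dia_def)

lemma dia_down:
  assumes "\<sigma> \<in> {1, -1}" "0 \<le> \<epsilon>" "\<epsilon> \<le> \<sigma> * Im z"
  shows "dia j (z + of_real \<epsilon> * Complex 0 (- \<sigma>)) = dia j z - \<epsilon>"
    "\<sigma> * Im (z + of_real \<epsilon> * Complex 0 (- \<sigma>)) = \<sigma> * Im z - \<epsilon>"
  using assms by (auto simp: dia_def)

lemma sg_mem: "sg j \<in> {1, -1}"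
  using sg_cases[of j] by auto

text \<open>Polar coordinates for diamonds: the radius \<rho> and the relative abscissa \<theta> map
  an open rectangle onto the region.\<close>

lemma connected_inner_region:
  assumes "inner_piece j" shows "connected (inner_region j)"
proof -
  let ?f = "\<lambda>(\<rho>, \<theta>). Complex (cen j + \<rho> * \<theta>) (sg j * (\<rho> * (1 - \<bar>\<theta>\<bar>)))"
  \<comment> \<open>For radius 1/2 the lower bound \<open>rad j - 1\<close> is negative, and the
    radius \<rho> starts at 0.\<close>
  let ?A = "{max 0 (rad j - 1)<..<rad j} \<times> {-1<..<1::real}"
  have "connected (?f ` ?A)"
    unfolding Complex_eq case_prod_unfold
    by (intro connected_continuous_image continuous_intros connected_Times) auto
  moreover have "?f ` ?A = inner_region j"
  proof
    have "Complex (cen j + \<rho> * \<theta>) (sg j * (\<rho> * (1 - \<bar>\<theta>\<bar>))) \<in> inner_region j"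
      if "0 < \<rho>" "rad j - 1 < \<rho>" "\<rho> < rad j" "\<bar>\<theta>\<bar> < 1" for \<rho> \<theta>
    proof -
      have pos: "0 < \<rho> * (1 - \<bar>\<theta>\<bar>)" using that by simp
      have "\<bar>sg j * y\<bar> = y" if "0 < y" for y
        using that sg_mem[of j] by auto
      from this[OF pos] have "dia j (Complex (cen j + \<rho> * \<theta>) (sg j * (\<rho> * (1 - \<bar>\<theta>\<bar>)))) = \<rho> * \<bar>\<theta>\<bar> + \<rho> * (1 - \<bar>\<theta>\<bar>)"
        using that(1) by (simp add: dia_def abs_mult)
      also have "\<dots> = \<rho>" by (simp add: algebra_simps)
      finally show ?thesis
        using that pos sg_mem[of j] by (auto simp: inner_region_def)
    qed
    then show "?f ` ?A \<subseteq> inner_region j" by auto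
    show "inner_region j \<subseteq> ?f ` ?A"
    proof
      fix z assume z: "z \<in> inner_region j"
      define \<rho> where "\<rho> = dia j z"
      define \<theta> where "\<theta> = (Re z - cen j) / \<rho>"
      have im: "0 < \<bar>Im z\<bar>" "\<bar>Im z\<bar> = sg j * Im z" "Im z = sg j * \<bar>Im z\<bar>"
        using z sg_mem[of j] by (auto simp: inner_region_def)
      then have \<rho>: "0 < \<rho>" "\<bar>Re z - cen j\<bar> < \<rho>" by (auto simp: \<rho>_def dia_def)
      then have re: "\<rho> * \<theta> = Re z - cen j" by (simp add: \<theta>_def)
      have th: "\<bar>\<theta>\<bar> < 1" using \<rho> by (simp add: \<theta>_def divide_less_eq)
      have "\<rho> * \<bar>\<theta>\<bar> = \<bar>Re z - cen j\<bar>" using re \<rho>(1) by (metis abs_mult abs_of_pos)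
      then have "\<rho> * (1 - \<bar>\<theta>\<bar>) = \<bar>Im z\<bar>" by (simp add: right_diff_distrib \<rho>_def dia_def)
      then have "z = ?f (\<rho>, \<theta>)" using re im(3) by (simp add: complex_eq_iff)
      moreover have "(\<rho>, \<theta>) \<in> ?A"
        using z \<rho>(1) th by (auto simp: inner_region_def \<rho>_def abs_less_iff)
      ultimately show "z \<in> ?f ` ?A" by blast
    qed
  qed
  ultimately show ?thesis by simp
qed

lemma inner_region_nonempty:
  assumes "inner_piece j" shows "inner_region j \<noteq> {}"
proof -
  \<comment> \<open>A point on the axis at l1 distance \<open>rad j - 1 / 4\<close>, which is
    positive because \<open>rad j\<close> is at least 1/2.\<close>
  have "Complex (cen j) (sg j * (rad j - 1 / 4)) \<in> inner_region j"
    using rad_ge[OF assms] sg_mem[of j] by (auto simp: inner_region_def dia_def)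
  then show ?thesis by auto
qed

lemma rad_le: "inner_piece j \<Longrightarrow> rad j \<le> real n"
  using p_bounds[of j] p_bounds[of "Suc j"] by (auto simp: inner_piece_def rad_def)

text \<open>The height \<open>n + 1\<close> clears every half diamond, since radii are at most
  \<open>n\<close>, and both tails, which end at height 1.\<close>

lemma high_half_plane_subset_outer_region:
  assumes "real n + 1 < \<sigma> * Im z" "\<sigma> \<in> {1, -1}"
  shows "z \<in> outer_region \<sigma>"
proof -
  have "real n + 1 < \<bar>Im z\<bar>" using assms by auto
  moreover from this have "rad j < dia j z" if "inner_piece j" for j
    using rad_le[OF that] by (auto simp: dia_def)
  moreover have "0 < \<sigma> * Im z" using assms(1) by linarith
  ultimately show ?thesis by (auto simp: outer_region_def)
qed

lemma outer_region_up:
  assumes "z \<in> outer_region \<sigma>" "\<sigma> \<in> {1, -1}" "0 \<le> \<epsilon>"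
  shows "z + of_real \<epsilon> * Complex 0 \<sigma> \<in> outer_region \<sigma>"
proof -
  have z: "0 < \<sigma> * Im z" "0 \<le> \<sigma> * Im z" using assms(1) by (auto simp: outer_region_def)
  note up = dia_up[OF assms(2) z(2) assms(3)]
  have re: "Re (z + of_real \<epsilon> * Complex 0 \<sigma>) = Re z" by simp
  show ?thesis
    using assms(1,3) z(1) unfolding outer_region_def mem_Collect_eq up re by fastforce
qed

text \<open>Every point escapes along the vertical ray \<open>V z\<close>, which never leaves the
  region, into the half plane \<open>H\<close> beyond all pieces.\<close>

lemma connected_outer_region:
  assumes \<sigma>: "\<sigma> \<in> {1, -1}"
  shows "connected (outer_region \<sigma>)"
proof -
  define H where "H = {z. real n + 1 < \<sigma> * Im z}"
  define V where "V z = (\<lambda>\<epsilon>. z + of_real \<epsilon> * Complex 0 \<sigma>) ` {0..}" for z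
  have H: "H \<subseteq> outer_region \<sigma>"
    using high_half_plane_subset_outer_region \<sigma> by (auto simp: H_def)
  have "H = {z. inner (\<sigma> *\<^sub>R \<i>) z > real n + 1}"
    by (auto simp: H_def inner_complex_def)
  then have "connected H" by (simp only: convex_connected convex_halfspace_gt)
  have V: "V z \<subseteq> outer_region \<sigma>" if "z \<in> outer_region \<sigma>" for z
    using outer_region_up[OF that \<sigma>] by (auto simp: V_def)
  have VH: "connected (V z \<union> H)" if z: "z \<in> outer_region \<sigma>" for z
  proof (rule connected_Un)
    show "connected (V z)"
      unfolding V_def by (intro connected_continuous_image continuous_intros) auto
    have "0 \<le> \<sigma> * Im z" using z by (auto simp: outer_region_def)
    then have "z + of_real (real n + 2) * Complex 0 \<sigma> \<in> H"
      using dia_up(2)[OF \<sigma>, of z "real n + 2"] by (simp add: H_def)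
    then show "V z \<inter> H \<noteq> {}"
      unfolding V_def by (metis (no_types, lifting) atLeast_iff disjoint_iff image_eqI of_nat_0_le_iff add_nonneg_nonneg zero_le_numeral)
  qed fact
  have "z \<in> V z" for z by (auto simp: V_def intro!: image_eqI[of _ _ 0])
  then have "outer_region \<sigma> = (\<Union>z\<in>outer_region \<sigma>. V z \<union> H)"
    using H V by blast
  moreover have "connected (\<Union>z\<in>outer_region \<sigma>. V z \<union> H)"
  proof (rule connected_Union)
    have "Complex 0 (\<sigma> * (real n + 2)) \<in> H" using \<sigma> by (auto simp: H_def)
    then show "\<Inter> ((\<lambda>z. V z \<union> H) ` outer_region \<sigma>) \<noteq> {}" by auto
  qed (use VH in auto)
  ultimately show ?thesis by simp
qed

lemma outer_region_nonempty:
  assumes "\<sigma> \<in> {1, -1}" shows "outer_region \<sigma> \<noteq> {}"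
proof -
  have "Complex 0 (\<sigma> * (real n + 2)) \<in> outer_region \<sigma>"
    using assms by (intro high_half_plane_subset_outer_region) auto
  then show ?thesis by auto
qed

lemma outer_region_disjoint_piece_set:
  assumes "k \<le> n" "\<sigma> \<in> {1, -1}" shows "outer_region \<sigma> \<inter> piece_set k = {}"
proof (rule ccontr)
  assume "outer_region \<sigma> \<inter> piece_set k \<noteq> {}"
  then obtain z where z: "z \<in> outer_region \<sigma>" "z \<in> piece_set k" by blast
  have "0 < \<sigma> * Im z" "0 < sg k * Im z" using z by (auto simp: outer_region_def piece_set_def)
  then have True: "sg k = \<sigma>" using sg_mem[of k] assms(2) by auto
  consider "k = 0" | "k = n" "k \<noteq> 0" | "inner_piece k" using assms(1) by (force simp: inner_piece_def)
  then show False
  proof cases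
    case 1
    then show False using z True by (simp add: outer_region_def piece_set_def)
  next
    case 2
    then show False using z True by (simp add: outer_region_def piece_set_def)
  next
    case 3
    then have "dia k z = rad k" using z by (auto simp: piece_set_def inner_piece_def)
    then show False using z(1) 3 True by (auto simp: outer_region_def)
  qed
qed

lemma inner_region_disjoint_piece_set:
  assumes j: "inner_piece j" and k: "k \<le> n" shows "inner_region j \<inter> piece_set k = {}"
proof (rule ccontr)
  assume "inner_region j \<inter> piece_set k \<noteq> {}"
  then obtain z where z: "z \<in> inner_region j" "z \<in> piece_set k" by blast
  have "0 < sg j * Im z" "0 < sg k * Im z" using z by (auto simp: inner_region_def piece_set_def)
  then have sg: "sg j = sg k" using sg_mem[of k] sg_mem[of j] by auto
  have d: "rad j - 1 < dia j z" "dia j z < rad j" using z by (auto simp: inner_region_def)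
  consider "k = 0" | "k = n" "k \<noteq> 0" | "inner_piece k" using k by (force simp: inner_piece_def)
  then show False
  proof cases
    case 1
    then have "Re z = p 1" using z by (simp add: piece_set_def)
    then show False using first_outside[OF j] sg 1 d by (auto simp: dia_def)
  next
    case 2
    then have "Re z = p n" using z by (simp add: piece_set_def)
    then show False using last_outside[OF j] sg 2 d by (auto simp: dia_def)
  next
    case 3
    then have dk: "dia k z = rad k" using z by (auto simp: piece_set_def inner_piece_def)
    show False
    proof (cases "k = j")
      case False
      then have "j \<noteq> k" by simp
      from separated[OF j 3 this sg] show False
      proof (elim disjE conjE)
        assume "cen j = cen k" "1 \<le> \<bar>rad j - rad k\<bar>"
        then show False using d dk by (auto simp: dia_def)
      next
        assume "rad j + rad k + 1 \<le> \<bar>cen j - cen k\<bar>"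
        then show False using dia_separated[of j k z] d dk by auto
      qed
    qed (use d dk in auto)
  qed
qed

lemma inner_regions_disjoint:
  assumes j: "inner_piece j" and k: "inner_piece k" and jk: "j \<noteq> k"
  shows "inner_region j \<inter> inner_region k = {}"
proof (rule ccontr)
  assume "inner_region j \<inter> inner_region k \<noteq> {}"
  then obtain z where z: "z \<in> inner_region j" "z \<in> inner_region k" by blast
  have "0 < sg j * Im z" "0 < sg k * Im z" using z by (auto simp: inner_region_def)
  then have sg: "sg j = sg k" using sg_mem[of k] sg_mem[of j] by auto
  have d: "rad j - 1 < dia j z" "dia j z < rad j" "rad k - 1 < dia k z" "dia k z < rad k"
    using z by (auto simp: inner_region_def)
  from separated[OF j k jk sg] show False
  proof (elim disjE conjE)
    assume "cen j = cen k" "1 \<le> \<bar>rad j - rad k\<bar>"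
    then show False using d by (auto simp: dia_def)
  next
    assume "rad j + rad k + 1 \<le> \<bar>cen j - cen k\<bar>"
    then show False using dia_separated[of j k z] d by auto
  qed
qed

lemma outer_inner_regions_disjoint:
  assumes "inner_piece j" "\<sigma> \<in> {1, -1}"
  shows "outer_region \<sigma> \<inter> inner_region j = {}"
proof (rule ccontr)
  assume "outer_region \<sigma> \<inter> inner_region j \<noteq> {}"
  then obtain z where z: "z \<in> outer_region \<sigma>" "z \<in> inner_region j" by blast
  have "0 < \<sigma> * Im z" "0 < sg j * Im z" using z by (auto simp: inner_region_def outer_region_def)
  then have "sg j = \<sigma>" using sg_mem[of j] assms by auto
  then show False using z assms(1) by (auto simp: inner_region_def outer_region_def)
qed

text \<open>If half diamonds on the side of the point cover it, the smallest of them gives its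
  region: were the point also within the radius reduced by 1, \<open>nested\<close> would supply a
  smaller one. Radius 1/2 is no exception, because \<open>dia\<close> is positive off the
  line.\<close>

lemma complement_cover:
  assumes im: "Im z \<noteq> 0" and np: "\<And>k. k \<le> n \<Longrightarrow> z \<notin> piece_set k"
  shows "z \<in> outer_region 1 \<or> z \<in> outer_region (-1) \<or> (\<exists>j. inner_piece j \<and> z \<in> inner_region j)"
proof -
  define \<sigma> where "\<sigma> = sgn (Im z)"
  have \<sigma>: "\<sigma> \<in> {1, -1}" "0 < \<sigma> * Im z" "\<bar>Im z\<bar> = \<sigma> * Im z"
    using im by (auto simp: \<sigma>_def sgn_if)
  let ?J = "{j. inner_piece j \<and> sg j = \<sigma> \<and> dia j z \<le> rad j}"
  have fin: "finite ?J"
    by (rule finite_subset[of _ "{..n}"]) (auto simp: inner_piece_def)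
  show ?thesis
  proof (cases "?J = {}")
    case True
    have "Re z \<noteq> p 1 \<or> 1 < \<bar>Im z\<bar>" if "sg 0 = \<sigma>"
      using np[of 0] \<sigma>(2) that by (auto simp: piece_set_def)
    moreover have "Re z \<noteq> p n \<or> 1 < \<bar>Im z\<bar>" if "sg n = \<sigma>"
      using np[of n] \<sigma>(2) that n_pos by (auto simp: piece_set_def)
    ultimately have "z \<in> outer_region \<sigma>"
      using True \<sigma>(2) by (auto simp: outer_region_def not_le)
    then show ?thesis using \<sigma>(1) by auto
  next
    case False
    define j where "j = arg_min_on rad ?J"
    have j: "inner_piece j" "sg j = \<sigma>" "dia j z \<le> rad j"
      using arg_min_if_finite(1)[OF fin False, of rad] by (auto simp: j_def)
    have least: "rad j \<le> rad k" if "k \<in> ?J" for k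
      using arg_min_least[OF fin False that, of rad] by (simp add: j_def)
    have "dia j z \<noteq> rad j"
      using np[of j] j \<sigma>(2) by (auto simp: piece_set_def inner_piece_def)
    moreover have "rad j - 1 < dia j z"
    proof (rule ccontr)
      assume neg: "\<not> rad j - 1 < dia j z"
      have "0 < dia j z" using im by (auto simp: dia_def)
      then have "rad j \<noteq> 1 / 2" using neg by auto
      then obtain k where k: "inner_piece k" "sg k = sg j" "cen k = cen j" "rad k = rad j - 1"
        using nested[OF j(1)] by blast
      then have "k \<in> ?J" using j neg by (auto simp: dia_def)
      then show False using least[of k] k(4) by simp
    qed
    ultimately have "z \<in> inner_region j" using j \<sigma>(2) by (auto simp: inner_region_def)
    then show ?thesis using j(1) by auto
  qed
qed

lemma regions_curve:
  "regions curve = {Some ` outer_region 1, Some ` outer_region (-1)} \<union>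
     (\<lambda>j. Some ` inner_region j) ` {j. inner_piece j}" (is "_ = ?F")
  unfolding regions_def
proof (rule connected_components_of_eqI)
  have sub: "S \<subseteq> - meander_graph curve" if S: "S \<in> ?F" for S
  proof -
    have "z \<notin> horizontal_line \<union> path_image curve"
      if "Im z \<noteq> 0" "\<And>k. k \<le> n \<Longrightarrow> z \<notin> piece_set k" for z
      using that by (auto simp: horizontal_line_def path_image_curve)
    moreover have "Im z \<noteq> 0 \<and> (\<forall>k\<le>n. z \<notin> piece_set k)" if zS: "Some z \<in> S" for z
    proof -
      consider "z \<in> outer_region 1" | "z \<in> outer_region (-1)" | j where "inner_piece j" "z \<in> inner_region j"
        using S zS by auto
      then show ?thesis
      proof cases
        case 1
        then show ?thesis
          using outer_region_disjoint_piece_set[of _ 1] by (auto simp: outer_region_def)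
      next
        case 2
        then show ?thesis
          using outer_region_disjoint_piece_set[of _ "-1"] by (auto simp: outer_region_def)
      next
        case 3
        then show ?thesis
          using inner_region_disjoint_piece_set[of j] by (auto simp: inner_region_def)
      qed
    qed
    moreover have "None \<notin> S" using S by auto
    ultimately show ?thesis
      by (auto simp: meander_graph_def)
  qed
  show "\<Union> ?F = topspace (subtopology sphere_top (- meander_graph curve))"
  proof
    have "insert None (range Some) = (UNIV :: complex option set)"
      using not_None_eq by (auto simp: image_iff)
    then have top: "topspace (subtopology sphere_top (- meander_graph curve)) = - meander_graph curve"
      by simp
    show "\<Union> ?F \<subseteq> topspace (subtopology sphere_top (- meander_graph curve))"
      unfolding top by (intro Union_least sub)
    show "topspace (subtopology sphere_top (- meander_graph curve)) \<subseteq> \<Union> ?F"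
      unfolding top
    proof
      fix w assume w: "w \<in> - meander_graph curve"
      then obtain z where z: "w = Some z" by (cases w) (auto simp: meander_graph_def)
      then have "Im z \<noteq> 0" "\<And>k. k \<le> n \<Longrightarrow> z \<notin> piece_set k"
        using w by (auto simp: meander_graph_def horizontal_line_def path_image_curve)
      from complement_cover[OF this] show "w \<in> \<Union> ?F" unfolding z by blast
    qed
  qed
  show "pairwise disjnt ?F"
  proof -
    have 1: "outer_region 1 \<inter> outer_region (-1) = {}" by (auto simp: outer_region_def)
    have inj: "Some ` A \<inter> Some ` B = {} \<longleftrightarrow> A \<inter> B = {}" for A B :: "complex set" by auto
    have 2: "disjnt (Some ` outer_region \<sigma>) (Some ` inner_region j)" if "\<sigma> \<in> {1, -1}" "inner_piece j" for \<sigma> j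
      using outer_inner_regions_disjoint[OF that(2,1)] unfolding disjnt_def inj .
    have 3: "disjnt (Some ` inner_region i) (Some ` inner_region j)"
      if "inner_piece i" "inner_piece j" "Some ` inner_region i \<noteq> Some ` inner_region j" for i j
      using inner_regions_disjoint[of i j] that unfolding disjnt_def inj by blast
    have 4: "disjnt (Some ` outer_region 1) (Some ` outer_region (-1))"
      using 1 unfolding disjnt_def inj .
    show ?thesis
      unfolding pairwise_def using 2[of 1] 2[of "-1"] 3 4 disjnt_sym by blast
  qed
  fix S assume S: "S \<in> ?F"
  then consider "S = Some ` outer_region 1" | "S = Some ` outer_region (-1)" | j where "inner_piece j" "S = Some ` inner_region j"
    by auto
  then have "connectedin sphere_top S \<and> S \<noteq> {} \<and> openin sphere_top S"
  proof cases
    case 1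
    then show ?thesis
      by (simp add: connected_outer_region outer_region_nonempty open_outer_region)
  next
    case 2
    then show ?thesis
      by (simp add: connected_outer_region outer_region_nonempty open_outer_region)
  next
    case 3
    then show ?thesis
      by (simp add: connected_inner_region inner_region_nonempty open_inner_region)
  qed
  then show "connectedin (subtopology sphere_top (- meander_graph curve)) S" "S \<noteq> {}"
    "openin (subtopology sphere_top (- meander_graph curve)) S"
    using sub[OF S] by (auto simp: connectedin_subtopology openin_subset_topspace_eq openin_subtopology intro!: exI[of _ S])
qed

section \<open>The edges on the boundary of each region of the drawing\<close>

text \<open>Edges are disjoint from the open set \<open>S\<close>, so closure can replace frontier.
  Infinity comes for free: once the rays of piece 0 lie in the closure, \<open>S\<close> is
  unbounded.\<close>

lemma frontier_region_iff:
  assumes "Some ` S \<in> regions curve" "open S"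
  shows "k \<le> n \<Longrightarrow> edge (Inl k) \<subseteq> sphere_top frontier_of (Some ` S) \<longleftrightarrow> arc_piece k \<subseteq> closure S"
    and "i < n \<Longrightarrow> edge (Inr i) \<subseteq> sphere_top frontier_of (Some ` S) \<longleftrightarrow> line_piece i \<subseteq> closure S"
proof -
  have "Some ` S \<subseteq> - meander_graph curve"
    using assms(1) connected_components_of_subset unfolding regions_def by fastforce
  then have dis: "e \<inter> Some ` S = {}" if "e \<subseteq> meander_graph curve" for e
    using that by blast
  have eg: "a \<in> edge_index \<Longrightarrow> edge a \<inter> Some ` S = {}" for a
    by (rule dis) (use graph_minus_vertices_eq in blast)
  have cl: "Some ` A \<subseteq> sphere_top closure_of (Some ` S) \<longleftrightarrow> A \<subseteq> closure S" for A
    using Some_in_sphere_closure_of_iff by auto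
  show "edge (Inl k) \<subseteq> sphere_top frontier_of (Some ` S) \<longleftrightarrow> arc_piece k \<subseteq> closure S" if "k \<le> n"
  proof -
    have "Inl k \<in> edge_index" unfolding edge_index_def by (rule InlI) (simp add: that)
    from eg[OF this] cl[of "arc_piece k"] show ?thesis
      unfolding open_image_Some_frontier_eq[OF assms(2)] by (auto simp: edge_def)
  qed
  show "edge (Inr i) \<subseteq> sphere_top frontier_of (Some ` S) \<longleftrightarrow> line_piece i \<subseteq> closure S" if "i < n"
  proof -
    have None: "None \<in> sphere_top closure_of (Some ` S)" if "i = 0" "line_piece i \<subseteq> closure S"
    proof (rule None_in_sphere_closure_of)
      have "complex_of_real ` {..<1} \<subseteq> line_piece 0" by (auto simp: line_piece_def)
      then show "\<not> bounded S"
        using that unbounded_of_real_rays(1)[of 1] bounded_closure bounded_subset by metis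
    qed
    have "Inr i \<in> edge_index" unfolding edge_index_def by (rule InrI) (simp add: \<open>i < n\<close>)
    from eg[OF this] cl[of "line_piece i"] None show ?thesis
      unfolding open_image_Some_frontier_eq[OF assms(2)] by (auto simp: edge_def split: if_splits)
  qed
qed

lemma card_sides_region:
  assumes "Some ` S \<in> regions curve" "open S"
  shows "card (sides curve (Some ` S)) =
    card {k. k \<le> n \<and> arc_piece k \<subseteq> closure S} + card {i. i < n \<and> line_piece i \<subseteq> closure S}"
  unfolding card_sides_eq using frontier_region_iff[OF assms] by (simp cong: conj_cong)

text \<open>The left and right foot of a half diamond, kept as naturals for comparison with indices
  of line pieces.\<close>

definition lo :: "nat \<Rightarrow> nat" where "lo j = min (p j) (p (Suc j))"
definition hi :: "nat \<Rightarrow> nat" where "hi j = max (p j) (p (Suc j))"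

lemma lo_hi:
  assumes "inner_piece j"
  shows "1 \<le> lo j" "lo j < hi j" "hi j \<le> n"
    "real (lo j) = cen j - rad j" "real (hi j) = cen j + rad j"
proof -
  have "p j \<noteq> p (Suc j)" using p_eq_iff[of j "Suc j"] assms by (simp add: inner_piece_def)
  then consider "p j < p (Suc j)" | "p (Suc j) < p j" by linarith
  note c = this
  show "1 \<le> lo j" "hi j \<le> n"
    using p_bounds[of j] p_bounds[of "Suc j"] assms by (auto simp: lo_def hi_def inner_piece_def)
  show "lo j < hi j" "real (lo j) = cen j - rad j" "real (hi j) = cen j + rad j"
    using c by (cases; simp add: lo_def hi_def cen_def rad_def field_simps)+
qed

text \<open>The feet are integers, so an integer beyond them is a whole unit away. This is the room
  needed to shift a point off a tail horizontally.\<close>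

lemma nat_outside:
  assumes "inner_piece j" "rad j < \<bar>real m - cen j\<bar>"
  shows "rad j + 1 \<le> \<bar>real m - cen j\<bar>"
proof -
  have "m < lo j \<or> hi j < m"
  proof (rule ccontr)
    assume "\<not> (m < lo j \<or> hi j < m)"
    then have "real (lo j) \<le> real m" "real m \<le> real (hi j)" by simp_all
    then have "\<bar>real m - cen j\<bar> \<le> rad j"
      unfolding lo_hi(4,5)[OF assms(1)] by linarith
    then show False using assms(2) by simp
  qed
  then have "real m + 1 \<le> real (lo j) \<or> real (hi j) + 1 \<le> real m" by linarith
  then show ?thesis
    unfolding lo_hi(4,5)[OF assms(1)] by linarith
qed

lemma closure_inner_region:
  assumes "z \<in> closure (inner_region j)"
  shows "0 \<le> sg j * Im z" "rad j - 1 \<le> dia j z" "dia j z \<le> rad j"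
proof -
  have "closed {z. 0 \<le> sg j * Im z \<and> rad j - 1 \<le> dia j z \<and> dia j z \<le> rad j}"
    by (intro closed_Collect_conj closed_Collect_le continuous_intros)
  moreover have "inner_region j \<subseteq> {z. 0 \<le> sg j * Im z \<and> rad j - 1 \<le> dia j z \<and> dia j z \<le> rad j}"
    by (auto simp: inner_region_def)
  ultimately have "z \<in> {z. 0 \<le> sg j * Im z \<and> rad j - 1 \<le> dia j z \<and> dia j z \<le> rad j}"
    using assms closure_minimal by blast
  then show "0 \<le> sg j * Im z" "rad j - 1 \<le> dia j z" "dia j z \<le> rad j" by auto
qed

lemma closure_outer_region:
  assumes "z \<in> closure (outer_region \<sigma>)"
  shows "0 \<le> \<sigma> * Im z" "inner_piece j \<Longrightarrow> sg j = \<sigma> \<Longrightarrow> rad j \<le> dia j z"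
proof -
  show "0 \<le> \<sigma> * Im z"
    by (rule closure_subset_closed_half_plane[OF _ assms]) (auto simp: outer_region_def half_plane_def)
  assume j: "inner_piece j" "sg j = \<sigma>"
  have "closed {z. rad j \<le> dia j z}"
    by (intro closed_Collect_le continuous_intros)
  moreover have "outer_region \<sigma> \<subseteq> {z. rad j \<le> dia j z}"
    using j by (auto simp: outer_region_def)
  ultimately show "rad j \<le> dia j z"
    using assms closure_minimal by blast
qed

text \<open>Meant for the boundary points on the line and on the next smaller concentric half
  diamond; those on half diamond \<open>j\<close> itself are reached by moving down.\<close>

lemma up_in_closure_inner_region:
  assumes "0 \<le> sg j * Im z" "rad j - 1 \<le> dia j z" "dia j z < rad j"
  shows "z \<in> closure (inner_region j)"
proof (rule closure_shiftI[of "rad j - dia j z" "Complex 0 (sg j)"])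
  show "norm (Complex 0 (sg j)) = 1" using sg_mem[of j] by (auto simp: cmod_def)
  fix \<epsilon> assume e: "0 < \<epsilon>" "\<epsilon> < rad j - dia j z"
  then have "0 \<le> \<epsilon>" by simp
  note up = dia_up[OF sg_mem assms(1) this]
  show "z + of_real \<epsilon> * Complex 0 (sg j) \<in> inner_region j"
    unfolding inner_region_def mem_Collect_eq using up e assms by simp
qed (use assms in simp)

lemma down_in_closure_inner_region:
  assumes "0 < sg j * Im z" "dia j z = rad j"
  shows "z \<in> closure (inner_region j)"
proof (rule closure_shiftI[of "min 1 (sg j * Im z)" "Complex 0 (- sg j)"])
  show "norm (Complex 0 (- sg j)) = 1" using sg_mem[of j] by (auto simp: cmod_def)
  fix \<epsilon> assume e: "0 < \<epsilon>" "\<epsilon> < min 1 (sg j * Im z)"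
  then have "\<epsilon> \<le> sg j * Im z" "0 \<le> \<epsilon>" by auto
  note down = dia_down[OF sg_mem this(2,1)]
  show "z + of_real \<epsilon> * Complex 0 (- sg j) \<in> inner_region j"
    unfolding inner_region_def mem_Collect_eq using down e assms by simp
qed (use assms in simp)

lemma piece_sign_eq:
  assumes "z \<in> piece_set k" "0 \<le> \<sigma> * Im z" "\<sigma> \<in> {1, -1}"
  shows "sg k = \<sigma>"
  using assms sg_mem[of k] by (auto simp: piece_set_def)

text \<open>For the exclusion of other pieces one point suffices. Its distance from the centre lies
  between \<open>rad j - 1\<close> and \<open>rad j\<close>, and \<open>separated\<close> leaves
  only the two ends of this range; tails and half diamonds with another centre are too far
  away.\<close>

lemma arc_piece_in_closure_inner_region:
  assumes j: "inner_piece j" and k: "k \<le> n"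
  shows "arc_piece k \<subseteq> closure (inner_region j) \<longleftrightarrow>
    k = j \<or> (inner_piece k \<and> sg k = sg j \<and> cen k = cen j \<and> rad k = rad j - 1)"
proof
  assume "k = j \<or> (inner_piece k \<and> sg k = sg j \<and> cen k = cen j \<and> rad k = rad j - 1)"
  then show "arc_piece k \<subseteq> closure (inner_region j)"
  proof
    assume kj: "k = j"
    show ?thesis
    proof
      fix z assume "z \<in> arc_piece k"
      then have "z \<in> piece_set j" using arc_piece_subset[OF k] kj by auto
      then show "z \<in> closure (inner_region j)"
        using j by (intro down_in_closure_inner_region) (auto simp: piece_set_def inner_piece_def)
    qed
  next
    assume kk: "inner_piece k \<and> sg k = sg j \<and> cen k = cen j \<and> rad k = rad j - 1"
    show ?thesis
    proof
      fix z assume "z \<in> arc_piece k"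
      then have z: "z \<in> piece_set k" using arc_piece_subset[OF k] by auto
      then have "dia k z = rad k" "0 < sg j * Im z" using kk by (auto simp: piece_set_def inner_piece_def)
      moreover have "dia j z = dia k z" using kk by (simp add: dia_def)
      ultimately show "z \<in> closure (inner_region j)"
        using kk by (intro up_in_closure_inner_region) auto
    qed
  qed
next
  assume sub: "arc_piece k \<subseteq> closure (inner_region j)"
  obtain z where z: "z \<in> arc_piece k" using arc_piece_nonempty[OF k] by auto
  then have zk: "z \<in> piece_set k" using arc_piece_subset[OF k] by auto
  note cl = closure_inner_region[OF subsetD[OF sub z]]
  have sg: "sg k = sg j" using piece_sign_eq[OF zk cl(1) sg_mem] .
  show "k = j \<or> (inner_piece k \<and> sg k = sg j \<and> cen k = cen j \<and> rad k = rad j - 1)"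
  proof (rule ccontr)
    assume neg: "\<not> ?thesis"
    consider "k = 0" | "k = n" "k \<noteq> 0" | "inner_piece k" using k by (force simp: inner_piece_def)
    then show False
    proof cases
      case 1
      then have "Re z = p 1" using zk by (simp add: piece_set_def)
      then show False using first_outside[OF j] sg 1 cl(3) by (auto simp: dia_def)
    next
      case 2
      then have "Re z = p n" using zk by (simp add: piece_set_def)
      then show False using last_outside[OF j] sg 2 cl(3) by (auto simp: dia_def)
    next
      case 3
      then have dk: "dia k z = rad k" using zk by (auto simp: piece_set_def inner_piece_def)
      have "j \<noteq> k" using neg by auto
      from separated[OF j 3 this sg[symmetric]] show False
      proof (elim disjE conjE)
        assume c: "cen j = cen k" "1 \<le> \<bar>rad j - rad k\<bar>"
        then have "dia j z = rad k" using dk by (simp add: dia_def)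
        then have "rad k = rad j - 1" using cl(2,3) c(2) by auto
        then show False using neg 3 sg c(1) by auto
      next
        assume "rad j + rad k + 1 \<le> \<bar>cen j - cen k\<bar>"
        then show False using dia_separated[of j k z] dk cl(3) by auto
      qed
    qed
  qed
qed

lemma dia_of_real: "dia j (complex_of_real r) = \<bar>r - cen j\<bar>"
  by (simp add: dia_def)

lemma line_piece_midpoint:
  assumes "i \<noteq> 0" shows "complex_of_real (real i + 1 / 2) \<in> line_piece i"
  using assms unfolding line_piece_def by (intro imageI) simp

text \<open>The closure meets the line in the first and the last unit segment between the feet,
  which coincide for radius 1/2. Other pieces are excluded by one test point, the midpoint
  \<open>i + 1 / 2\<close>, or \<open>n + 1\<close> for the piece through infinity.\<close>

lemma line_piece_in_closure_inner_region:
  assumes j: "inner_piece j" and i: "i < n"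
  shows "line_piece i \<subseteq> closure (inner_region j) \<longleftrightarrow> i = lo j \<or> Suc i = hi j"
proof
  note lh = lo_hi[OF j]
  assume a: "i = lo j \<or> Suc i = hi j"
  show "line_piece i \<subseteq> closure (inner_region j)"
  proof
    fix z assume z: "z \<in> line_piece i"
    have "i \<noteq> 0" using a lh(1,2) by auto
    then obtain r where r: "z = complex_of_real r" "real i < r" "r < real i + 1"
      using z by (auto simp: line_piece_def)
    have h: "cen j - rad j + 1 \<le> cen j + rad j" using lh(2) unfolding lh(4,5)[symmetric] by simp
    have "rad j - 1 \<le> \<bar>r - cen j\<bar>" "\<bar>r - cen j\<bar> < rad j"
      using a
    proof (atomize (full), elim disjE)
      assume "i = lo j"
      then have "real i = cen j - rad j" using lh(4) by simp
      then show "rad j - 1 \<le> \<bar>r - cen j\<bar> \<and> \<bar>r - cen j\<bar> < rad j"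
        using r(2,3) h by (intro conjI; linarith)
    next
      assume "Suc i = hi j"
      then have "real i + 1 = cen j + rad j" using lh(5) by linarith
      then show "rad j - 1 \<le> \<bar>r - cen j\<bar> \<and> \<bar>r - cen j\<bar> < rad j"
        using r(2,3) h by (intro conjI; linarith)
    qed
    then show "z \<in> closure (inner_region j)"
      unfolding r(1) by (intro up_in_closure_inner_region) (simp_all only: dia_of_real Im_complex_of_real mult_zero_right order_refl)
  qed
next
  note lh = lo_hi[OF j]
  assume sub: "line_piece i \<subseteq> closure (inner_region j)"
  show "i = lo j \<or> Suc i = hi j"
  proof (cases "i = 0")
    case True
    then have "complex_of_real (real n + 1) \<in> line_piece i"
      unfolding line_piece_def by (intro imageI) simp
    note closure_inner_region(3)[OF subsetD[OF sub this], unfolded dia_of_real]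
    then have "real n + 1 \<le> real (hi j)" unfolding lh(5) by linarith
    then show ?thesis using lh(3) by simp
  next
    case False
    note cl = closure_inner_region(2,3)[OF subsetD[OF sub line_piece_midpoint[OF False]], unfolded dia_of_real]
    have 1: "real i + 1 / 2 \<le> real (hi j)" "real (lo j) \<le> real i + 1 / 2"
      unfolding lh(4,5) using cl(2) by linarith+
    have 2: "real i + 1 / 2 \<le> real (lo j) + 1 \<or> real (hi j) - 1 \<le> real i + 1 / 2"
      unfolding lh(4,5) using cl(1) by linarith
    show ?thesis using 1 2 by linarith
  qed
qed

text \<open>From the unbounded region only the outermost half diamond of a concentric family is
  visible, and every tail is. Half diamonds are approached vertically, tails horizontally, because a
  vertical shift can stay on the tail.\<close>

lemma arc_piece_in_closure_outer_region:
  assumes \<sigma>: "\<sigma> \<in> {1, -1}" and k: "k \<le> n"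
  shows "arc_piece k \<subseteq> closure (outer_region \<sigma>) \<longleftrightarrow>
    sg k = \<sigma> \<and> (inner_piece k \<longrightarrow> (\<forall>j. inner_piece j \<and> sg j = \<sigma> \<and> cen j = cen k \<longrightarrow> rad j \<le> rad k))"
proof
  assume sub: "arc_piece k \<subseteq> closure (outer_region \<sigma>)"
  obtain z where z: "z \<in> arc_piece k" using arc_piece_nonempty[OF k] by auto
  then have zk: "z \<in> piece_set k" using arc_piece_subset[OF k] by auto
  note cl = closure_outer_region[OF subsetD[OF sub z]]
  have "sg k = \<sigma>" using piece_sign_eq[OF zk cl(1) \<sigma>] .
  moreover have "rad j \<le> rad k" if "inner_piece k" "inner_piece j" "sg j = \<sigma>" "cen j = cen k" for j
  proof -
    have "dia k z = rad k" using that(1) zk by (auto simp: piece_set_def inner_piece_def)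
    then show ?thesis using cl(2)[OF that(2,3)] that(4) by (simp add: dia_def)
  qed
  ultimately show "sg k = \<sigma> \<and> (inner_piece k \<longrightarrow> (\<forall>j. inner_piece j \<and> sg j = \<sigma> \<and> cen j = cen k \<longrightarrow> rad j \<le> rad k))"
    by blast
next
  assume a: "sg k = \<sigma> \<and> (inner_piece k \<longrightarrow> (\<forall>j. inner_piece j \<and> sg j = \<sigma> \<and> cen j = cen k \<longrightarrow> rad j \<le> rad k))"
  show "arc_piece k \<subseteq> closure (outer_region \<sigma>)"
  proof
    fix z assume "z \<in> arc_piece k"
    then have zk: "z \<in> piece_set k" using arc_piece_subset[OF k] by auto
    have tail: "z \<in> closure (outer_region \<sigma>)"
      if m: "Re z = real m" "\<And>j. inner_piece j \<Longrightarrow> sg j = \<sigma> \<Longrightarrow> rad j < \<bar>real m - cen j\<bar>" "0 < \<sigma> * Im z" for m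
    proof (rule closure_shiftI[of 1 1])
      fix \<epsilon> :: real assume e: "0 < \<epsilon>" "\<epsilon> < 1"
      have "rad j < dia j (z + of_real \<epsilon> * 1)" if "inner_piece j" "sg j = \<sigma>" for j
        using nat_outside[OF that(1) m(2)[OF that]] m(1) e by (auto simp: dia_def)
      \<comment> \<open>A shift by less than 1 from an integer abscissa misses all integers and
        hence both tails.\<close>
      moreover have "Re (z + of_real \<epsilon> * 1) \<noteq> real q" for q
      proof
        assume "Re (z + of_real \<epsilon> * 1) = real q"
        then have "real m < real q" "real q < real (Suc m)" using m(1) e by auto
        then show False unfolding of_nat_less_iff by simp
      qed
      ultimately show "z + of_real \<epsilon> * 1 \<in> outer_region \<sigma>"
        using m(3) by (auto simp: outer_region_def)
    qed simp_all
    have pos: "0 < \<sigma> * Im z" using a zk by (auto simp: piece_set_def)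
    consider "k = 0" | "k = n" "k \<noteq> 0" | "inner_piece k" using k by (force simp: inner_piece_def)
    then show "z \<in> closure (outer_region \<sigma>)"
    proof cases
      case 1
      then show ?thesis using zk a first_outside pos by (intro tail[of "p 1"]) (auto simp: piece_set_def)
    next
      case 2
      then show ?thesis using zk a last_outside pos by (intro tail[of "p n"]) (auto simp: piece_set_def)
    next
      case 3
      then have dk: "dia k z = rad k" using zk by (auto simp: piece_set_def inner_piece_def)
      then have re: "\<bar>Re z - cen k\<bar> \<le> rad k" by (auto simp: dia_def)
      have ge: "rad j \<le> dia j z" if j: "inner_piece j" "sg j = \<sigma>" for j
      proof (cases "j = k")
        case False
        then have "k \<noteq> j" by simp
        from separated[OF 3 j(1) this] a j(2)
        have "cen k = cen j \<and> 1 \<le> \<bar>rad k - rad j\<bar> \<or> rad k + rad j + 1 \<le> \<bar>cen k - cen j\<bar>" by simp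
        then show ?thesis
        proof (elim disjE conjE)
          assume c: "cen k = cen j"
          then have "rad j \<le> rad k" using a 3 j by auto
          moreover have "dia j z = dia k z" using c by (simp add: dia_def)
          ultimately show ?thesis using dk by simp
        next
          assume "rad k + rad j + 1 \<le> \<bar>cen k - cen j\<bar>"
          then show ?thesis using dia_separated[of k j z] dk by simp
        qed
      qed (simp add: dk)
      show ?thesis
      proof (rule closure_shiftI[of 1 "Complex 0 \<sigma>"])
        show "norm (Complex 0 \<sigma>) = 1" using \<sigma> by (auto simp: cmod_def)
        fix \<epsilon> :: real assume e: "0 < \<epsilon>" "\<epsilon> < 1"
        have le: "0 \<le> \<sigma> * Im z" "0 \<le> \<epsilon>" using pos e by auto
        note up = dia_up[OF \<sigma> le]
        have "rad j < dia j (z + of_real \<epsilon> * Complex 0 \<sigma>)" if "inner_piece j" "sg j = \<sigma>" for j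
          unfolding up using ge[OF that] e by simp
        moreover have "Re z \<noteq> real (p 1)" if "sg 0 = \<sigma>"
          using first_outside[OF 3] a that re by auto
        moreover have "Re z \<noteq> real (p n)" if "sg n = \<sigma>"
          using last_outside[OF 3] a that re by auto
        moreover have "0 < \<sigma> * Im (z + of_real \<epsilon> * Complex 0 \<sigma>)" unfolding up using pos e by simp
        moreover have "Re (z + of_real \<epsilon> * Complex 0 \<sigma>) = Re z" by simp
        ultimately show "z + of_real \<epsilon> * Complex 0 \<sigma> \<in> outer_region \<sigma>"
          unfolding outer_region_def mem_Collect_eq by (metis (no_types, lifting))
      qed simp
    qed
  qed
qed

lemma line_piece_in_closure_outer_region:
  assumes \<sigma>: "\<sigma> \<in> {1, -1}" and i: "i < n"
  shows "line_piece i \<subseteq> closure (outer_region \<sigma>) \<longleftrightarrow>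
    (\<forall>j. inner_piece j \<and> sg j = \<sigma> \<longrightarrow> i < lo j \<or> hi j \<le> i)"
proof
  assume sub: "line_piece i \<subseteq> closure (outer_region \<sigma>)"
  show "\<forall>j. inner_piece j \<and> sg j = \<sigma> \<longrightarrow> i < lo j \<or> hi j \<le> i"
  proof (intro allI impI, elim conjE, rule ccontr)
    fix j assume j: "inner_piece j" "sg j = \<sigma>" and neg: "\<not> (i < lo j \<or> hi j \<le> i)"
    note lh = lo_hi[OF j(1)]
    have "i \<noteq> 0" using lh(1) neg by auto
    from closure_outer_region(2)[OF subsetD[OF sub line_piece_midpoint[OF this]] j]
    have "rad j \<le> \<bar>real i + 1 / 2 - cen j\<bar>" unfolding dia_of_real .
    moreover have "real (lo j) \<le> real i" "real i + 1 \<le> real (hi j)" using neg by auto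
    ultimately show False unfolding lh(4,5) by linarith
  qed
next
  assume a: "\<forall>j. inner_piece j \<and> sg j = \<sigma> \<longrightarrow> i < lo j \<or> hi j \<le> i"
  show "line_piece i \<subseteq> closure (outer_region \<sigma>)"
  proof
    fix z assume "z \<in> line_piece i"
    then obtain r where r: "z = complex_of_real r"
      "if i = 0 then r < 1 \<or> real n < r else real i < r \<and> r < real i + 1"
      by (auto simp: line_piece_def split: if_splits)
    have ge: "rad j \<le> \<bar>r - cen j\<bar>" if j: "inner_piece j" "sg j = \<sigma>" for j
    proof -
      note lh = lo_hi[OF j(1)]
      have "real (lo j) \<ge> 1" "real (hi j) \<le> real n" using lh by auto
      moreover have "real i + 1 \<le> real (lo j) \<or> real (hi j) \<le> real i" using a j by fastforce
      ultimately have "r \<le> real (lo j) \<or> real (hi j) \<le> r"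
        using r(2) lh(2) by (auto split: if_splits)
      then show ?thesis unfolding lh(4,5) by linarith
    qed
    have ne: "r \<noteq> real m" if "1 \<le> m" "m \<le> n" for m
    proof
      assume "r = real m"
      then show False using r(2) that by (cases "i = 0") auto
    qed
    have p1: "r \<noteq> real (p 1)" "r \<noteq> real (p n)"
      using ne p_bounds[of 1] p_bounds[of n] n_pos by auto
    show "z \<in> closure (outer_region \<sigma>)"
    proof (rule closure_shiftI[of 1 "Complex 0 \<sigma>"])
      show "norm (Complex 0 \<sigma>) = 1" using \<sigma> by (auto simp: cmod_def)
      fix \<epsilon> :: real assume e: "0 < \<epsilon>" "\<epsilon> < 1"
      have le: "0 \<le> \<sigma> * Im z" "0 \<le> \<epsilon>" using r(1) e by auto
      note up = dia_up[OF \<sigma> le]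
      have "rad j < dia j (z + of_real \<epsilon> * Complex 0 \<sigma>)" if "inner_piece j" "sg j = \<sigma>" for j
        unfolding up using ge[OF that] e r(1) by (simp add: dia_of_real)
      moreover have "0 < \<sigma> * Im (z + of_real \<epsilon> * Complex 0 \<sigma>)" unfolding up using r(1) e by simp
      moreover have "Re (z + of_real \<epsilon> * Complex 0 \<sigma>) = r" using r(1) by simp
      ultimately show "z + of_real \<epsilon> * Complex 0 \<sigma> \<in> outer_region \<sigma>"
        unfolding outer_region_def mem_Collect_eq using p1 by (metis (no_types, lifting))
    qed simp
  qed
qed

text \<open>Two line sides and two arc sides; for radius 1/2 the two line sides are the same edge,
  and there is no smaller half diamond inside.\<close>

lemma card_sides_inner_region:
  assumes j: "inner_piece j"
  shows "card (sides curve (Some ` inner_region j)) = (if rad j = 1 / 2 then 2 else 4)"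
proof -
  note lh = lo_hi[OF j]
  have jn: "j < n" using j by (simp add: inner_piece_def)
  have reg: "Some ` inner_region j \<in> regions curve" using j by (auto simp: regions_curve)
  have "{i. i < n \<and> line_piece i \<subseteq> closure (inner_region j)} = {i. i < n \<and> (i = lo j \<or> Suc i = hi j)}"
    using line_piece_in_closure_inner_region[OF j] by blast
  also have "\<dots> = {lo j, hi j - 1}" using lh(1-3) by auto
  finally have "{i. i < n \<and> line_piece i \<subseteq> closure (inner_region j)} = {lo j, hi j - 1}" .
  moreover have "rad j = 1 / 2 \<longleftrightarrow> real (hi j) = real (lo j) + 1" unfolding lh(4,5) by linarith
  then have "rad j = 1 / 2 \<longleftrightarrow> hi j - 1 = lo j" using lh(2) by linarith
  ultimately have L: "card {i. i < n \<and> line_piece i \<subseteq> closure (inner_region j)} = (if rad j = 1 / 2 then 1 else 2)"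
    by simp
  have A0: "{k. k \<le> n \<and> arc_piece k \<subseteq> closure (inner_region j)} =
      {k. k \<le> n \<and> (k = j \<or> (inner_piece k \<and> sg k = sg j \<and> cen k = cen j \<and> rad k = rad j - 1))}"
    using arc_piece_in_closure_inner_region[OF j] by blast
  have A: "card {k. k \<le> n \<and> arc_piece k \<subseteq> closure (inner_region j)} = (if rad j = 1 / 2 then 1 else 2)"
  proof (cases "rad j = 1 / 2")
    case True
    then have "{k. k \<le> n \<and> arc_piece k \<subseteq> closure (inner_region j)} = {j}"
      unfolding A0 using jn rad_ge by fastforce
    then show ?thesis using True by simp
  next
    case False
    then obtain k where k: "inner_piece k" "sg k = sg j" "cen k = cen j" "rad k = rad j - 1"
      using nested[OF j] by blast
    have uniq: "k' = k" if "inner_piece k'" "sg k' = sg j" "cen k' = cen j" "rad k' = rad j - 1" for k'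
      using separated[OF that(1) k(1)] k that rad_ge[OF k(1)] by auto
    have "k \<le> n" "j \<le> n" using k(1) j by (auto simp: inner_piece_def)
    then have "{k. k \<le> n \<and> arc_piece k \<subseteq> closure (inner_region j)} = {j, k}"
      unfolding A0 using uniq k by blast
    moreover have "j \<noteq> k" using k by auto
    ultimately show ?thesis using False by simp
  qed
  show ?thesis
    unfolding card_sides_region[OF reg open_inner_region] L A by simp
qed

text \<open>The \<open>a + 2\<close> entries -1 are the bigons cut off by half diamonds of radius
  1/2 and the two anchors. All other bounded regions have order 0 and make up the unlisted
  4-gons.\<close>

lemma in_stratum_curve:
  fixes k1 k2 :: int
  assumes o1: "int (card (sides curve (Some ` outer_region 1))) = 2 * k1 + 4"
    and o2: "int (card (sides curve (Some ` outer_region (-1)))) = 2 * k2 + 4"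
    and h: "card {j. inner_piece j \<and> rad j = 1 / 2} = a"
  shows "in_stratum curve ({#k1, k2#} + replicate_mset (a + 2) (-1))"
proof -
  \<comment> \<open>The division is exact on every region: by \<open>o1\<close> and
    \<open>o2\<close> on the unbounded ones, and because the bounded ones have 2 or 4 sides.\<close>
  define ord where "ord R = (int (card (sides curve R)) - 4) div 2" for R
  let ?N = "\<lambda>j. Some ` inner_region j"
  let ?J = "{j. inner_piece j}"
  let ?J1 = "{j. inner_piece j \<and> rad j = 1 / 2}" and ?J2 = "{j. inner_piece j \<and> rad j \<noteq> 1 / 2}"
  have finJ: "finite ?J" by (rule finite_subset[of _ "{..n}"]) (auto simp: inner_piece_def)
  have fin1: "finite ?J1" "finite ?J2" by (rule finite_subset[OF _ finJ]; auto)+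
  have ordN: "ord (?N j) = (if rad j = 1 / 2 then -1 else 0)" if "inner_piece j" for j
    using card_sides_inner_region[OF that] by (simp add: ord_def)
  have ordO: "ord (Some ` outer_region 1) = k1" "ord (Some ` outer_region (-1)) = k2"
    using o1 o2 by (simp_all add: ord_def)
  have isord: "is_order_function curve ord"
    unfolding is_order_function_def
  proof
    fix R assume "R \<in> regions curve"
    then consider "R = Some ` outer_region 1" | "R = Some ` outer_region (-1)" | j where "inner_piece j" "R = ?N j"
      unfolding regions_curve by auto
    then show "int (card (sides curve R)) = 2 * ord R + 4"
      using o1 o2 ordO ordN card_sides_inner_region by cases simp_all
  qed
  have inj: "inj_on ?N ?J"
  proof (rule inj_onI, rule ccontr)
    fix i j assume ij: "i \<in> ?J" "j \<in> ?J" "?N i = ?N j" "i \<noteq> j"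
    then have "inner_region i = inner_region j" by (simp add: inj_image_eq_iff)
    then show False using inner_regions_disjoint[of i j] inner_region_nonempty[of i] ij by auto
  qed
  have "outer_region 1 \<inter> outer_region (-1) = {}" by (auto simp: outer_region_def)
  then have "outer_region 1 \<noteq> outer_region (-1)" using outer_region_nonempty[of 1] by auto
  then have ne: "Some ` outer_region 1 \<noteq> Some ` outer_region (-1)" by (simp add: inj_image_eq_iff)
  have "outer_region \<sigma> \<noteq> inner_region j" if "\<sigma> \<in> {1, -1}" "inner_piece j" for \<sigma> j
    using outer_inner_regions_disjoint[OF that(2,1)] inner_region_nonempty[OF that(2)] by auto
  then have notin: "Some ` outer_region \<sigma> \<notin> ?N ` ?J" if "\<sigma> \<in> {1, -1}" for \<sigma>
    using that by (auto simp: inj_image_eq_iff)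
  have reg: "regions curve = insert (Some ` outer_region 1) (insert (Some ` outer_region (-1)) (?N ` ?J))"
    unfolding regions_curve by auto
  have "mset_set (regions curve) =
      add_mset (Some ` outer_region 1) (add_mset (Some ` outer_region (-1)) (image_mset ?N (mset_set ?J)))"
    unfolding reg using finJ notin[of 1] notin[of "-1"] ne
    by (simp add: image_mset_mset_set[OF inj])
  then have "image_mset ord (mset_set (regions curve)) = {#k1, k2#} + image_mset (\<lambda>j. ord (?N j)) (mset_set ?J)"
    by (simp add: ordO image_mset.compositionality comp_def)
  also have "?J = ?J1 \<union> ?J2" by auto
  also have "mset_set (?J1 \<union> ?J2) = mset_set ?J1 + mset_set ?J2"
    using fin1 by (intro mset_set_Union) auto
  also have "image_mset (\<lambda>j. ord (?N j)) (mset_set ?J1 + mset_set ?J2) =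
      image_mset (\<lambda>j. -1) (mset_set ?J1) + image_mset (\<lambda>j. 0) (mset_set ?J2)"
    unfolding image_mset_union
    by (intro arg_cong2[where f = "(+)"] image_mset_cong) (use fin1 ordN in auto)
  also have "\<dots> = replicate_mset a (-1) + replicate_mset (card ?J2) 0"
    by (simp only: image_mset_const_eq size_mset_set h)
  finally have "image_mset ord (mset_set (regions curve)) + {#-1, -1#} =
      {#k1, k2#} + replicate_mset (a + 2) (-1) + replicate_mset (card ?J2) 0"
    by simp
  then show ?thesis
    unfolding in_stratum_def using isord finJ by (auto simp: reg)
qed

lemma card_sides_outer_region:
  assumes \<sigma>: "\<sigma> \<in> {1, -1}"
  shows "card (sides curve (Some ` outer_region \<sigma>)) =
    card {k. k \<le> n \<and> sg k = \<sigma> \<and>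
      (inner_piece k \<longrightarrow> (\<forall>j. inner_piece j \<and> sg j = \<sigma> \<and> cen j = cen k \<longrightarrow> rad j \<le> rad k))} +
    card {i. i < n \<and> (\<forall>j. inner_piece j \<and> sg j = \<sigma> \<longrightarrow> i < lo j \<or> hi j \<le> i)}"
proof -
  have reg: "Some ` outer_region \<sigma> \<in> regions curve" using \<sigma> by (auto simp: regions_curve)
  show ?thesis
    unfolding card_sides_region[OF reg open_outer_region]
    using arc_piece_in_closure_outer_region[OF \<sigma>] line_piece_in_closure_outer_region[OF \<sigma>]
    by (simp cong: conj_cong)
qed

end

subsection \<open>Zigzag and spiral\<close>

text \<open>
  \<open>spiral b h j\<close> is the position on the line of the \<open>j\<close>-th crossing along the arc: a zigzag through
  \<open>1, \<dots>, b\<close>, then \<open>b + 1\<close>, \<open>b + 2h\<close>, \<open>b + 2h - 1\<close>, \<open>b + 2\<close>, \<open>b + 3\<close>, \<open>b + 2h - 2\<close> and so on inwards.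
\<close>

definition spiral :: "nat \<Rightarrow> nat \<Rightarrow> nat \<Rightarrow> nat" where
  "spiral b h j = (if j \<le> b then j
     else if (j - b - 1) mod 4 = 0 \<or> (j - b - 1) mod 4 = 3 then b + 1 + (j - b - 1) div 2
     else b + 2 * h - (j - b - 1) div 2)"

text \<open>The crossings \<open>b + 1 + 2 * i\<close> and \<open>b + 2 + 2 * i\<close> are the feet
  of the \<open>i\<close>-th nested half diamond. The arc enters at the left foot for even
  \<open>i\<close> and at the right foot for odd \<open>i\<close>.\<close>

lemma spiral_odd: "spiral b h (b + 1 + 2 * i) = (if even i then b + 1 + i else b + 2 * h - i)"
proof -
  have "2 * i mod 4 = 0 \<longleftrightarrow> even i" "2 * i mod 4 \<noteq> 3" by presburger+
  then show ?thesis by (simp add: spiral_def)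
qed

lemma spiral_even: "spiral b h (b + 2 + 2 * i) = (if even i then b + 2 * h - i else b + 1 + i)"
proof -
  have "Suc (2 * i) mod 4 = 3 \<longleftrightarrow> odd i" "Suc (2 * i) mod 4 \<noteq> 0" by presburger+
  then show ?thesis by (simp add: spiral_def)
qed

text \<open>Beyond the zigzag, \<open>s div 2\<close> is the depth in the spiral and
  \<open>s mod 4\<close> selects the left or right half. Depths are below \<open>h\<close>, so the
  halves do not overlap, and a position determines depth and half.\<close>

lemma bij_betw_spiral: "bij_betw (spiral b h) {1..b + 2 * h} {1..b + 2 * h}"
proof -
  have range: "spiral b h j \<in> {1..b + 2 * h}" if "j \<in> {1..b + 2 * h}" for j
    using that by (auto simp: spiral_def)
  have inj: "inj_on (spiral b h) {1..b + 2 * h}"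
  proof (rule inj_onI)
    fix i j assume i: "i \<in> {1..b + 2 * h}" and j: "j \<in> {1..b + 2 * h}" and eq: "spiral b h i = spiral b h j"
    have small: "spiral b h k \<le> b \<longleftrightarrow> k \<le> b" if "k \<in> {1..b + 2 * h}" for k
      using that by (auto simp: spiral_def)
    show "i = j"
    proof (cases "i \<le> b")
      case True
      then have "j \<le> b" using small[OF i] small[OF j] eq by simp
      then show ?thesis using True eq by (simp add: spiral_def)
    next
      case False
      then have "\<not> j \<le> b" using small[OF i] small[OF j] eq by simp
      define s t where "s = i - b - 1" and "t = j - b - 1"
      have st: "i = b + 1 + s" "j = b + 1 + t" "s < 2 * h" "t < 2 * h"
        using False \<open>\<not> j \<le> b\<close> i j by (auto simp: s_def t_def)
      have "(if s mod 4 = 0 \<or> s mod 4 = 3 then b + 1 + s div 2 else b + 2 * h - s div 2) =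
          (if t mod 4 = 0 \<or> t mod 4 = 3 then b + 1 + t div 2 else b + 2 * h - t div 2)"
        using eq False \<open>\<not> j \<le> b\<close> unfolding spiral_def s_def[symmetric] t_def[symmetric] by simp
      moreover have "s div 2 < h" "t div 2 < h" using st by auto
      ultimately have half: "s div 2 = t div 2"
        and res: "s mod 4 = 0 \<or> s mod 4 = 3 \<longleftrightarrow> t mod 4 = 0 \<or> t mod 4 = 3"
        by (cases "s mod 4 = 0 \<or> s mod 4 = 3"; cases "t mod 4 = 0 \<or> t mod 4 = 3"; simp; linarith)+
      \<comment> \<open>Depth and half together determine the parity of \<open>r\<close>, and with
        the depth also \<open>r\<close> itself.\<close>
      have "(r mod 4 = 0 \<or> r mod 4 = 3) = (even r = even (r div 2))" for r :: nat
        by presburger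
      from this[of s] this[of t] have "even s = even t"
        unfolding half res by argo
      then have "s mod 2 = t mod 2" by (simp only: mod2_eq_if)
      then have "s = t" using half by (metis div_mult_mod_eq)
      then show ?thesis using st by simp
    qed
  qed
  have "spiral b h ` {1..b + 2 * h} = {1..b + 2 * h}"
    by (rule endo_inj_surj[OF _ _ inj]) (use range in auto)
  then show ?thesis using inj by (simp add: bij_betw_def)
qed

text \<open>Either an even, possibly empty, zigzag followed by \<open>h\<close> nested half
  diamonds, with both tails above the line, or an odd pure zigzag, with the tails on opposite
  sides.\<close>

locale spiral_meander =
  fixes b h :: nat
  assumes shape: "even b \<and> 1 \<le> h \<or> odd b \<and> h = 0"
begin

sublocale diamond_meander "b + 2 * h" "spiral b h"
proof
  show "0 < b + 2 * h" using shape by (cases b) auto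
qed (rule bij_betw_spiral)

text \<open>\<open>low\<close> is the zigzag including its link to the spiral, \<open>arch i\<close>
  the \<open>i\<close>-th nested half diamond below the line, and \<open>turn i\<close> the small
  one above the line that leads to the next nested one.\<close>

lemma inner_piece_cases:
  assumes "inner_piece j"
  obtains (low) "1 \<le> j" "j \<le> b" "j < b + 2 * h"
  | (arch) i where "i < h" "j = b + 1 + 2 * i"
  | (turn) i where "Suc i < h" "j = b + 2 + 2 * i"
proof -
  have j: "1 \<le> j" "j < b + 2 * h" using assms by (auto simp: inner_piece_def)
  show ?thesis
  proof (cases "j \<le> b")
    case True
    then show ?thesis using low j by blast
  next
    case False
    then have "j = b + 1 + (j - b - 1)" "(j - b - 1) + 1 < 2 * h"
      using j by linarith+
    then obtain s where s: "j = b + 1 + s" "s + 1 < 2 * h" by blast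
    show ?thesis
    proof (cases "even s")
      case True
      then obtain i where "s = 2 * i" by (elim evenE)
      then show ?thesis using arch[of i] s by auto
    next
      case False
      then obtain i where "s = 2 * i + 1" by (elim oddE)
      then show ?thesis using turn[of i] s by auto
    qed
  qed
qed

lemma low_piece:
  assumes "1 \<le> j" "j \<le> b"
  shows "spiral b h j = j" "j < b + 2 * h \<Longrightarrow> spiral b h (Suc j) = Suc j"
    "j < b + 2 * h \<Longrightarrow> cen j = real j + 1 / 2" "j < b + 2 * h \<Longrightarrow> rad j = 1 / 2"
proof -
  show 1: "spiral b h j = j" using assms by (simp add: spiral_def)
  assume "j < b + 2 * h"
  show 2: "spiral b h (Suc j) = Suc j"
    using assms spiral_odd[of b h 0] by (cases "j = b") (simp_all add: spiral_def)
  show "cen j = real j + 1 / 2" "rad j = 1 / 2" by (simp_all add: cen_def rad_def 1 2)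
qed

lemma arch_piece:
  assumes "i < h"
  shows "cen (b + 1 + 2 * i) = real b + real h + 1 / 2" "rad (b + 1 + 2 * i) = real h - real i - 1 / 2"
    "sg (b + 1 + 2 * i) = -1"
proof -
  have "Suc (b + 1 + 2 * i) = b + 2 + 2 * i" by simp
  then have p: "spiral b h (Suc (b + 1 + 2 * i)) = (if even i then b + 2 * h - i else b + 1 + i)"
    using spiral_even[of b h i] by simp
  have r: "real (b + 2 * h - i) = real b + 2 * real h - real i" using assms by simp
  show "cen (b + 1 + 2 * i) = real b + real h + 1 / 2"
    unfolding cen_def p spiral_odd using r by simp
  show "rad (b + 1 + 2 * i) = real h - real i - 1 / 2"
    unfolding rad_def p spiral_odd using r assms by (auto simp: abs_if)
  show "sg (b + 1 + 2 * i) = -1" using shape assms by (auto simp: sg_def)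
qed

lemma turn_piece:
  assumes "Suc i < h"
  shows "rad (b + 2 + 2 * i) = 1 / 2" "sg (b + 2 + 2 * i) = 1"
proof -
  have "Suc (b + 2 + 2 * i) = b + 1 + 2 * Suc i" by simp
  then have p: "spiral b h (Suc (b + 2 + 2 * i)) = (if even (Suc i) then b + 1 + Suc i else b + 2 * h - Suc i)"
    using spiral_odd[of b h "Suc i"] by simp
  have r: "real (b + 2 * h - i) = real b + 2 * real h - real i"
    "real (b + 2 * h - Suc i) = real b + 2 * real h - real i - 1" using assms by auto
  show "rad (b + 2 + 2 * i) = 1 / 2"
    unfolding rad_def p spiral_even using r by (cases "even i") simp_all
  show "sg (b + 2 + 2 * i) = 1" using shape assms by (auto simp: sg_def)
qed

lemma positive_piece_unit:
  assumes "inner_piece j" "sg j = 1" shows "rad j = 1 / 2"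
  using assms(1)
proof (cases rule: inner_piece_cases)
  case low
  then show ?thesis using low_piece by simp
next
  case (arch i)
  then show ?thesis using arch_piece(3)[of i] assms(2) by simp
next
  case (turn i)
  then show ?thesis using turn_piece by simp
qed

text \<open>Pieces on one side have indices of equal parity, so they are never consecutive and their
  four feet are distinct. Unit intervals with integer ends and no common end have midpoints at
  distance at least 2.\<close>

lemma unit_pieces_apart:
  assumes i: "inner_piece i" and j: "inner_piece j" and ij: "i \<noteq> j" and sg: "sg i = sg j"
    and r: "rad i = 1 / 2" "rad j = 1 / 2"
  shows "2 \<le> \<bar>cen i - cen j\<bar>"
proof -
  let ?p = "spiral b h"
  have "Suc i \<noteq> j" "Suc j \<noteq> i" using sg by (auto simp: sg_eq_iff)
  then have ne: "?p i \<noteq> ?p j" "?p i \<noteq> ?p (Suc j)" "?p (Suc i) \<noteq> ?p j" "?p (Suc i) \<noteq> ?p (Suc j)"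
    using p_eq_iff i j ij by (auto simp: inner_piece_def)
  have "?p (Suc i) = ?p i + 1 \<or> ?p i = ?p (Suc i) + 1" "?p (Suc j) = ?p j + 1 \<or> ?p j = ?p (Suc j) + 1"
    using r by (auto simp: rad_def abs_if split: if_splits)
  then have "min (?p i) (?p (Suc i)) + 2 \<le> min (?p j) (?p (Suc j)) \<or> min (?p j) (?p (Suc j)) + 2 \<le> min (?p i) (?p (Suc i))"
    using ne by (auto simp: min_def)
  moreover have "cen i = real (min (?p i) (?p (Suc i))) + 1 / 2" "cen j = real (min (?p j) (?p (Suc j))) + 1 / 2"
    using \<open>?p (Suc i) = _ \<or> _\<close> \<open>?p (Suc j) = _ \<or> _\<close> by (auto simp: cen_def min_def)
  ultimately show ?thesis by (auto simp: abs_if)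
qed

lemma unit_piece_outside:
  assumes i: "inner_piece i" and m: "1 \<le> m" "m \<le> b + 2 * h" "m \<noteq> i" "m \<noteq> Suc i" and r: "rad i = 1 / 2"
  shows "rad i < \<bar>real (spiral b h m) - cen i\<bar>"
proof -
  let ?p = "spiral b h"
  have ne: "?p m \<noteq> ?p i" "?p m \<noteq> ?p (Suc i)" using p_eq_iff i m by (auto simp: inner_piece_def)
  have "?p (Suc i) = ?p i + 1 \<or> ?p i = ?p (Suc i) + 1"
    using r by (auto simp: rad_def abs_if split: if_splits)
  then show ?thesis
  proof
    assume a: "?p (Suc i) = ?p i + 1"
    then have "real (?p m) + 1 \<le> real (?p i) \<or> real (?p i) + 2 \<le> real (?p m)" using ne by linarith
    moreover have "cen i = real (?p i) + 1 / 2" using a by (simp add: cen_def)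
    ultimately show ?thesis unfolding r by (elim disjE; linarith)
  next
    assume a: "?p i = ?p (Suc i) + 1"
    then have "real (?p m) + 1 \<le> real (?p (Suc i)) \<or> real (?p (Suc i)) + 2 \<le> real (?p m)"
      using ne by linarith
    moreover have "cen i = real (?p (Suc i)) + 1 / 2" using a by (simp add: cen_def)
    ultimately show ?thesis unfolding r by (elim disjE; linarith)
  qed
qed

text \<open>Parity makes the room: \<open>j\<close> is odd and \<open>b\<close> even, so the right
  foot \<open>j + 1\<close> is at most \<open>b\<close>, while all nested half diamonds start at
  \<open>b + 1\<close> or later.\<close>

lemma low_arch_apart:
  assumes "1 \<le> j" "j \<le> b" "j < b + 2 * h" "i < h" "sg j = -1"
  shows "rad j + rad (b + 1 + 2 * i) + 1 \<le> \<bar>cen j - cen (b + 1 + 2 * i)\<bar>"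
proof -
  have "odd j" using assms(5) by (auto simp: sg_def minus_one_power_iff split: if_splits)
  then have "j \<noteq> b" using shape assms(4) by auto
  then have "real j + 1 \<le> real b" using assms(2) by linarith
  then show ?thesis using low_piece(3,4)[OF assms(1-3)] arch_piece[OF assms(4)] by simp
qed

sublocale noncrossing_diamond_meander "b + 2 * h" "spiral b h"
proof
  fix i assume i: "inner_piece i" "rad i \<noteq> 1 / 2"
  from i(1) show "\<exists>j. inner_piece j \<and> sg j = sg i \<and> cen j = cen i \<and> rad j = rad i - 1"
  proof (cases rule: inner_piece_cases)
    case low
    then show ?thesis using low_piece i(2) by simp
  next
    case (turn k)
    then show ?thesis using turn_piece i(2) by simp
  next
    case (arch k)
    then have "k \<noteq> h - 1" using i(2) arch_piece(2)[of k] by auto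
    then have k: "Suc k < h" using arch by simp
    show ?thesis
      using arch_piece[OF arch(1)] arch_piece[OF k] k arch(2)
      by (intro exI[of _ "b + 1 + 2 * Suc k"]) (simp add: inner_piece_def)
  qed
next
  fix i j assume i: "inner_piece i" and j: "inner_piece j" and ij: "i \<noteq> j" and sg: "sg i = sg j"
  show "cen i = cen j \<and> 1 \<le> \<bar>rad i - rad j\<bar> \<or> rad i + rad j + 1 \<le> \<bar>cen i - cen j\<bar>"
  proof (cases "rad i = 1 / 2 \<and> rad j = 1 / 2")
    case True
    then show ?thesis using unit_pieces_apart[OF i j ij sg] by simp
  next
    case False
    \<comment> \<open>Radii other than 1/2 occur only below the line, so both pieces lie there and
      no \<open>turn\<close> is involved.\<close>
    then have "sg i \<noteq> 1" using positive_piece_unit i j sg by auto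
    then have m1: "sg i = -1" "sg j = -1" using sg sg_cases[of i] by auto
    show ?thesis
      using i
    proof (cases rule: inner_piece_cases)
      case ilow: low
      show ?thesis
        using j
      proof (cases rule: inner_piece_cases)
        case low
        then show ?thesis using False ilow low_piece by simp
      next
        case (arch k)
        then show ?thesis using low_arch_apart[OF ilow arch(1) m1(1)] by simp
      next
        case (turn k)
        then show ?thesis using turn_piece(2)[of k] m1 by simp
      qed
    next
      case iarch: (arch l)
      show ?thesis
        using j
      proof (cases rule: inner_piece_cases)
        case low
        then show ?thesis using low_arch_apart[OF low iarch(1) m1(2)] iarch(2) by (simp add: abs_minus_commute add.commute)
      next
        case (arch k)
        then have "k \<noteq> l" using ij iarch by auto
        then have "1 \<le> \<bar>real l - real k\<bar>" by linarith
        then show ?thesis using arch_piece[OF arch(1)] arch_piece[OF iarch(1)] iarch(2) arch(2) by (simp add: abs_minus_commute)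
      next
        case (turn k)
        then show ?thesis using turn_piece(2)[of k] m1 by simp
      qed
    next
      case (turn l)
      then show ?thesis using turn_piece(2)[of l] m1 by simp
    qed
  qed
next
  fix i assume i: "inner_piece i" "sg i = sg 0"
  have "even i" using i(2) by (simp add: sg_eq_iff)
  then have "1 \<noteq> i" by auto
  have "1 \<noteq> Suc i" using i(1) by (simp add: inner_piece_def)
  have "rad i = 1 / 2" using positive_piece_unit[OF i(1)] i(2) by (simp add: sg_def)
  then show "rad i < \<bar>real (spiral b h 1) - cen i\<bar>"
    using unit_piece_outside[OF i(1), of 1] n_pos \<open>1 \<noteq> i\<close> \<open>1 \<noteq> Suc i\<close> by simp
next
  fix i assume i: "inner_piece i" "sg i = sg (b + 2 * h)"
  \<comment> \<open>By parity, no half diamond on the side of the last tail ends at the last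
    crossing.\<close>
  have "even i \<longleftrightarrow> even (b + 2 * h)" using i(2) by (simp only: sg_eq_iff)
  then have "b + 2 * h \<noteq> Suc i" by (metis even_Suc)
  have "rad i = 1 / 2"
  proof (cases "even b")
    case True
    then have "sg i = 1" using i(2) by (simp add: sg_def)
    then show ?thesis using positive_piece_unit[OF i(1)] by simp
  next
    case False
    then have "h = 0" using shape by auto
    have "1 \<le> i" "i < b + 2 * h" using i(1) by (auto simp: inner_piece_def)
    with \<open>h = 0\<close> show ?thesis by (intro low_piece(4)) auto
  qed
  moreover have "b + 2 * h \<noteq> i" using i(1) by (simp add: inner_piece_def)
  ultimately show "rad i < \<bar>real (spiral b h (b + 2 * h)) - cen i\<bar>"
    using unit_piece_outside[OF i(1), of "b + 2 * h"] n_pos \<open>b + 2 * h \<noteq> Suc i\<close> by simp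
qed

section \<open>The sides of the two unbounded regions and the number of bigons\<close>

lemma lo_hi_low:
  assumes "1 \<le> j" "j \<le> b" "j < b + 2 * h"
  shows "lo j = j" "hi j = Suc j"
proof -
  have "inner_piece j" using assms by (simp add: inner_piece_def)
  from lo_hi(4,5)[OF this] low_piece(3,4)[OF assms]
  have "real (lo j) = real j" "real (hi j) = real (Suc j)" by simp_all
  then show "lo j = j" "hi j = Suc j" unfolding of_nat_eq_iff .
qed

lemma inner_piece_arch: "i < h \<Longrightarrow> inner_piece (b + 1 + 2 * i)"
  by (simp add: inner_piece_def)

lemma lo_hi_arch:
  assumes "i < h"
  shows "lo (b + 1 + 2 * i) = b + 1 + i" "hi (b + 1 + 2 * i) = b + 2 * h - i"
proof -
  from lo_hi(4,5)[OF inner_piece_arch[OF assms]] arch_piece[OF assms]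
  have "real (lo (b + 1 + 2 * i)) = real (b + 1 + i)" "real (hi (b + 1 + 2 * i)) = real (b + 2 * h - i)"
    using assms by simp_all
  then show "lo (b + 1 + 2 * i) = b + 1 + i" "hi (b + 1 + 2 * i) = b + 2 * h - i"
    unfolding of_nat_eq_iff .
qed

text \<open>Above the line no half diamond hides another one, so all arc pieces of even index are
  sides. Each of the \<open>(n - 1) div 2\<close> half diamonds there, with
  \<open>n = b + 2 * h\<close>, removes exactly the one line piece between its feet.\<close>

lemma card_sides_outer_region_pos:
  "card (sides curve (Some ` outer_region 1)) =
    (b + 2 * h) div 2 + 1 + (b + 2 * h - (b + 2 * h - 1) div 2)"
proof -
  let ?n = "b + 2 * h"
  let ?E = "{j. inner_piece j \<and> sg j = 1}"
  have sg1: "sg k = 1 \<longleftrightarrow> even k" for k by (simp add: sg_def minus_one_power_iff)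
  have "rad j \<le> rad k" if "inner_piece j" "sg j = 1" "inner_piece k" "sg k = 1" for j k
    using positive_piece_unit[OF that(1,2)] positive_piece_unit[OF that(3,4)] by simp
  then have "{k. k \<le> ?n \<and> sg k = 1 \<and>
      (inner_piece k \<longrightarrow> (\<forall>j. inner_piece j \<and> sg j = 1 \<and> cen j = cen k \<longrightarrow> rad j \<le> rad k))} = {k. k \<le> ?n \<and> even k}"
    using sg1 by blast
  moreover
  have unit: "hi j = Suc (lo j)" "cen j = real (lo j) + 1 / 2" if "j \<in> ?E" for j
  proof -
    have "inner_piece j" "rad j = 1 / 2" using that positive_piece_unit by auto
    with lo_hi(4,5)[of j] have "real (hi j) = real (Suc (lo j))" by simp
    then show "hi j = Suc (lo j)" unfolding of_nat_eq_iff .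
    show "cen j = real (lo j) + 1 / 2"
      using lo_hi(4)[OF \<open>inner_piece j\<close>] \<open>rad j = 1 / 2\<close> by simp
  qed
  have "i < lo j \<or> hi j \<le> i \<longleftrightarrow> i \<noteq> lo j" if "j \<in> ?E" for i j
    using unit(1)[OF that] by auto
  then have "{i. i < ?n \<and> (\<forall>j. inner_piece j \<and> sg j = 1 \<longrightarrow> i < lo j \<or> hi j \<le> i)} = {..<?n} - lo ` ?E"
    by auto
  moreover have "inj_on lo ?E"
  proof (rule inj_onI, rule ccontr)
    fix i j assume ij: "i \<in> ?E" "j \<in> ?E" "lo i = lo j" "i \<noteq> j"
    then have "cen i = cen j" using unit(2) by simp
    then show False using unit_pieces_apart[of i j] positive_piece_unit ij by auto
  qed
  moreover have "?E = {k. k \<le> ?n - 1 \<and> even k} - {0}"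
    using n_pos sg1 by (auto simp: inner_piece_def)
  then have "card ?E = (?n - 1) div 2"
    using card_even_atMost[of "?n - 1"] by simp
  moreover have "lo ` ?E \<subseteq> {..<?n}"
    using lo_hi(2,3) by fastforce
  moreover have "finite ?E"
    by (rule finite_subset[of _ "{..?n}"]) (auto simp: inner_piece_def)
  ultimately show ?thesis
    using card_sides_outer_region[of 1] card_even_atMost[of ?n]
    by (simp add: card_Diff_subset card_image)
qed

text \<open>The half diamond of index \<open>b + 1\<close>, if there is a spiral, hides everything
  nested in it, so the count does not involve \<open>h\<close>: arc pieces of odd index up to
  \<open>b + 1\<close> and line pieces of even index up to \<open>b\<close>.\<close>

lemma card_sides_outer_region_neg:
  "card (sides curve (Some ` outer_region (-1))) = (b + 2) div 2 + (b div 2 + 1)"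
proof -
  let ?n = "b + 2 * h"
  have sg1: "sg k = -1 \<longleftrightarrow> odd k" for k by (simp add: sg_def minus_one_power_iff)
  have "k \<le> ?n \<and> sg k = -1 \<and>
      (inner_piece k \<longrightarrow> (\<forall>j. inner_piece j \<and> sg j = -1 \<and> cen j = cen k \<longrightarrow> rad j \<le> rad k))
      \<longleftrightarrow> k \<le> b + 1 \<and> odd k" (is "?L \<longleftrightarrow> ?R") for k
  proof
    assume L: ?L
    then have "odd k" using sg1 by simp
    moreover have "k \<le> b + 1"
    proof (cases "inner_piece k")
      case True
      then show ?thesis
      proof (cases rule: inner_piece_cases)
        case (arch i)
        have 0: "0 < h" using arch by simp
        have "rad j \<le> rad k" if "inner_piece j" "sg j = -1" "cen j = cen k" for j
          using L True that by blast
        from this[OF inner_piece_arch[OF 0] arch_piece(3)[OF 0]]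
        have "rad (b + 1 + 2 * 0) \<le> rad k"
          unfolding arch(2) arch_piece(1)[OF 0] arch_piece(1)[OF arch(1)] by simp
        then show ?thesis using arch_piece(2)[OF 0] arch_piece(2)[OF arch(1)] arch(2) by simp
      next
        case (turn i)
        then show ?thesis using turn_piece(2)[of i] L by simp
      qed simp
    next
      case False
      then have "k = 0 \<or> k = ?n" using L by (auto simp: inner_piece_def)
      then show ?thesis using \<open>odd k\<close> shape by auto
    qed
    ultimately show ?R by simp
  next
    assume R: ?R
    have "k \<le> ?n" using R shape by (cases "k = b + 1") auto
    moreover have "rad j \<le> rad k" if k: "inner_piece k" and j: "inner_piece j" "sg j = -1" "cen j = cen k" for j
    proof (cases "j = k")
      case False
      have "sg k = -1" using R sg1 by simp
      then have "sg j = sg k" using j(2) by simp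
      from separated[OF j(1) k False this]
      have cc: "1 \<le> \<bar>rad j - rad k\<bar>"
      proof (elim disjE conjE)
        assume "rad j + rad k + 1 \<le> \<bar>cen j - cen k\<bar>"
        then show ?thesis unfolding j(3) using rad_ge[OF j(1)] rad_ge[OF k] by simp
      qed
      show ?thesis
        using k
      proof (cases rule: inner_piece_cases)
        case low
        show ?thesis
          using j(1)
        proof (cases rule: inner_piece_cases)
          case jlow: low
          then show ?thesis using cc low_piece(4)[OF low] low_piece(4)[OF jlow] by simp
        next
          case (arch i)
          then show ?thesis using j(3) arch_piece(1)[OF arch(1)] low_piece(3)[OF low] low by simp
        next
          case (turn i)
          then show ?thesis using turn_piece(2)[of i] j(2) by simp
        qed
      next
        case karch: (arch i)
        then have "i = 0" using R by simp
        show ?thesis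
          using j(1)
        proof (cases rule: inner_piece_cases)
          case low
          then show ?thesis using j(3) arch_piece(1)[OF karch(1)] low_piece(3)[OF low] karch by simp
        next
          case (arch l)
          then show ?thesis using arch_piece(2)[OF arch(1)] arch_piece(2)[OF karch(1)] karch \<open>i = 0\<close> by simp
        next
          case (turn l)
          then show ?thesis using turn_piece(2)[of l] j(2) by simp
        qed
      next
        case (turn i)
        then show ?thesis using R by simp
      qed
    qed simp
    ultimately show ?L using R sg1 by simp
  qed
  moreover have "i < ?n \<and> (\<forall>j. inner_piece j \<and> sg j = -1 \<longrightarrow> i < lo j \<or> hi j \<le> i) \<longleftrightarrow> i \<le> b \<and> even i"
    (is "?L \<longleftrightarrow> ?R") for i
  proof
    assume L: ?L
    have ib: "i \<le> b"
    proof (rule ccontr)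
      assume "\<not> i \<le> b"
      then have "0 < h" using L by simp
      from L have "i < lo (b + 1 + 2 * 0) \<or> hi (b + 1 + 2 * 0) \<le> i"
        using inner_piece_arch[OF \<open>0 < h\<close>] arch_piece(3)[OF \<open>0 < h\<close>] by blast
      then have "i < b + 1 \<or> b + 2 * h \<le> i"
        unfolding lo_hi_arch[OF \<open>0 < h\<close>] by simp
      then show False using L \<open>\<not> i \<le> b\<close> by simp
    qed
    moreover have "even i"
    proof (rule ccontr)
      assume "odd i"
      then have "1 \<le> i" "inner_piece i" using L by (auto simp: inner_piece_def elim: oddE)
      then have "i < lo i \<or> hi i \<le> i" using L sg1 \<open>odd i\<close> by blast
      then show False using lo_hi_low[OF \<open>1 \<le> i\<close> ib] L by simp
    qed
    ultimately show ?R by simp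
  next
    assume R: ?R
    have "i < ?n" using R shape by (cases "i = b") auto
    moreover have "i < lo j \<or> hi j \<le> i" if j: "inner_piece j" "sg j = -1" for j
      using j(1)
    proof (cases rule: inner_piece_cases)
      case low
      have "i \<noteq> j" using R j(2) sg1 by auto
      then show ?thesis using lo_hi_low[OF low] by auto
    next
      case (arch k)
      then show ?thesis using lo_hi_arch[OF arch(1)] R by simp
    next
      case (turn k)
      then show ?thesis using turn_piece(2)[of k] j(2) by simp
    qed
    ultimately show ?L by blast
  qed
  ultimately show ?thesis
    using card_sides_outer_region[of "-1"] card_even_atMost[of b] card_odd_atMost[of "b + 1"] by simp
qed

text \<open>Of the \<open>n - 1\<close> inner pieces only the nested half diamonds other than the
  innermost one are larger. Truncated subtraction makes \<open>h - 1\<close> vanish for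
  \<open>h = 0\<close>, as it should.\<close>

lemma card_unit_pieces: "card {j. inner_piece j \<and> rad j = 1 / 2} = b + 2 * h - 1 - (h - 1)"
proof -
  let ?n = "b + 2 * h"
  let ?A = "(\<lambda>i. b + 1 + 2 * i) ` {..<h - 1}"
  have A: "?A \<subseteq> {1..<?n}" by auto
  have "inner_piece j \<and> rad j = 1 / 2 \<longleftrightarrow> j \<in> {1..<?n} - ?A" for j
  proof (cases "inner_piece j")
    case True
    then have "rad j = 1 / 2 \<longleftrightarrow> j \<notin> ?A"
    proof (cases rule: inner_piece_cases)
      case low
      then show ?thesis using low_piece(4)[OF low] by auto
    next
      case (arch i)
      have "j \<in> ?A \<longleftrightarrow> i < h - 1" using arch by auto
      moreover have "rad j = 1 / 2 \<longleftrightarrow> real h = real (Suc i)"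
        using arch_piece(2)[OF arch(1)] arch(2) by auto
      ultimately show ?thesis using arch(1) by (auto simp only: of_nat_eq_iff)
    next
      case (turn i)
      have "j \<notin> ?A"
      proof
        assume "j \<in> ?A"
        then obtain k where "Suc (2 * i) = 2 * k" using turn by auto
        then show False by presburger
      qed
      then show ?thesis using turn_piece(1)[OF turn(1)] turn(2) by simp
    qed
    then show ?thesis using True by (auto simp: inner_piece_def)
  qed (auto simp: inner_piece_def)
  then have "{j. inner_piece j \<and> rad j = 1 / 2} = {1..<?n} - ?A" by blast
  moreover have "card ?A = h - 1" by (simp add: card_image inj_on_def)
  ultimately show ?thesis using A by (simp add: card_Diff_subset)
qed

end

section \<open>Choice of the parameters\<close>

text \<open>With \<open>n = b + 2 * h\<close>, the unbounded regions have
  \<open>2 * (n div 2) + 2\<close> and \<open>2 * (b div 2) + 2\<close> sides, so the orders require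
  \<open>n div 2 = k1 + 1\<close> and \<open>b div 2 = k2 + 1\<close>. For \<open>k1 > k2\<close>
  the even choices work, with \<open>h = k1 - k2\<close>; for \<open>k1 = k2\<close> the spiral is
  empty and the shape requires \<open>b\<close> odd, which gives \<open>2 * k1 + 3\<close>.\<close>

lemma ex_meander_in_stratum:
  fixes k1 k2 :: int
  assumes k: "k1 \<ge> k2" "k2 \<ge> -1"
  shows "\<exists>\<gamma>. singly_anchored_open_meander \<gamma> \<and>
    in_stratum \<gamma> ({#k1, k2#} + replicate_mset (nat (k1 + k2 + 4)) (-1)) \<and>
    int (card (crossings \<gamma>)) = max (2 * k1 + 2) (2 * k2 + 3)"
proof -
  define b where "b = (if k1 = k2 then nat (2 * k1 + 3) else nat (2 * k2 + 2))"
  define h where "h = nat (k1 - k2)"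
  have bh: "int b = (if k1 = k2 then 2 * k1 + 3 else 2 * k2 + 2)" "int h = k1 - k2"
    using k by (simp_all add: b_def h_def)
  interpret spiral_meander b h
  proof
    show "even b \<and> 1 \<le> h \<or> odd b \<and> h = 0"
    proof (cases "k1 = k2")
      case True
      then have "int b = 2 * k1 + 3" "h = 0" using bh by auto
      then have "odd (int b)" by simp
      then show ?thesis using \<open>h = 0\<close> by simp
    next
      case False
      then have "int b = 2 * k2 + 2" "1 \<le> h" using bh k by auto
      then have "even (int b)" by simp
      then show ?thesis using \<open>1 \<le> h\<close> by simp
    qed
  qed
  have "(2 * k2 + 2 * c + r) div 2 = k2 + c" if "r \<in> {0, 1}" for c r :: int
    using that by auto
  from this[of 1 1] this[of 1 0] have half: "int (b div 2) = k2 + 1"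
    using bh(1) by (auto simp: zdiv_int)
  have double: "m div 2 + 1 + (m - (m - 1) div 2) = 2 * (m div 2) + 2" if "0 < m" for m :: nat
    using that by (cases "even m") (auto elim!: evenE oddE)
  have n: "int (b + 2 * h) = max (2 * k1 + 2) (2 * k2 + 3)"
    using bh k by (auto split: if_splits)
  have o1: "int (card (sides curve (Some ` outer_region 1))) = 2 * k1 + 4"
    unfolding card_sides_outer_region_pos double[OF n_pos] using bh(2) half by auto
  have o2: "int (card (sides curve (Some ` outer_region (-1)))) = 2 * k2 + 4"
    unfolding card_sides_outer_region_neg using half by simp
  have "b + 2 * h - 1 - (h - 1) + 2 = nat (k1 + k2 + 4)"
  proof (cases "k1 = k2")
    case True
    then have "int b = 2 * k1 + 3" "h = 0" using bh by auto
    then show ?thesis using k True by linarith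
  next
    case False
    then have "int b = 2 * k2 + 2" using bh by auto
    then show ?thesis using bh(2) k False by linarith
  qed
  then have "in_stratum curve ({#k1, k2#} + replicate_mset (nat (k1 + k2 + 4)) (-1))"
    using in_stratum_curve[OF o1 o2 card_unit_pieces] by simp
  moreover have "card (crossings curve) = b + 2 * h"
    by (simp add: crossings_curve card_image inj_on_def)
  ultimately show ?thesis using meander_curve n by metis
qed

theorem proposition4p4:
  fixes k1 k2 :: int
  assumes "k1 \<ge> k2" and "k2 \<ge> -1"
  defines "K \<equiv> {#k1, k2#} + replicate_mset (nat (k1 + k2 + 4)) (-1)"
  shows "(\<exists>\<gamma>. singly_anchored_open_meander \<gamma> \<and> in_stratum \<gamma> K \<and>
              int (card (crossings \<gamma>)) = max (2 * k1 + 2) (2 * k2 + 3)) \<and>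
         (\<forall>\<gamma>. singly_anchored_open_meander \<gamma> \<and> in_stratum \<gamma> K \<longrightarrow>
              int (card (crossings \<gamma>)) \<ge> max (2 * k1 + 2) (2 * k2 + 3))"
  unfolding K_def
  using ex_meander_in_stratum[OF assms(1,2)] crossings_lower_bound[OF assms(1,2)] by blast

end
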